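(* Let $\mathcal{C}$ be either the category of affine schemes or the category of Noetherian affine schemes. Consider a pretopology on $\mathcal{C}$ whose coverings include at least the syntomic finite locally free faithfully flat morphisms $Y\to X$. Then the map of presheaves $\omega:\underline{\mathbb{Z}}(\mathcal{O})\to W_{\mathrm{rat}}(\mathcal{O})$ induces a surjection of the associated sheaves $\underline{\mathbb{Z}}(\mathcal{O})^{\sharp}\twoheadrightarrow W_{\mathrm{rat}}(\mathcal{O})^{\sharp}$.
   Context: All rings are commutative and unital; the category $\mathcal{C}$ is taken in a suitable small version. For a ring $A$ let $\mathbb{Z}A$ be the monoid ring of the multiplicative monoid $(A,\cdot)$, with basis elements written $(a)$, and let $\underline{\mathbb{Z}}A=\mathbb{Z}A/\mathbb{Z}(0)$ be the reduced monoid ring, the quotient by the ideal $\mathbb{Z}(0)$. $W(A)=1+TA[[T]]$ is the big Witt ring: addition is multiplication of power series (zero element $1$), multiplication is the unique functorial, $T$-adically continuous one with $(1-aT)\cdot(1-bT)=1-abT$, unit $1-T$. $W_{\mathrm{rat}}(A)\subset W(A)$ is the subring of elements $P/Q$ with $P,Q\in A[T]$, $P(0)=1=Q(0)$. The functorial ring homomorphism $\omega:\underline{\mathbb{Z}}A\to W_{\mathrm{rat}}(A)$ is induced by the multiplicative map $a\mapsto[a]=1-aT$. $\underline{\mathbb{Z}}(\mathcal{O})$ and $W_{\mathrm{rat}}(\mathcal{O})$ are the presheaves $Y\mapsto\underline{\mathbb{Z}}\,\mathcal{O}(Y)$ and $Y\mapsto W_{\mathrm{rat}}(\mathcal{O}(Y))$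 on $\mathcal{C}$, and ${}^{\sharp}$ denotes sheafification with respect to the given pretopology (which need not be subcanonical). *)

theory Defs
  imports "HOL-Algebra.Algebra"
begin

section \<open>Monoid algebras, localisation and tensor products\<close>

text \<open>The monoid algebra \<open>R[M]\<close>: finitely supported functions from \<open>M\<close> to \<open>R\<close> (vanishing off
  the carrier of \<open>M\<close>) with convolution. It provides integral monoid rings of multiplicative
  monoids, polynomial rings in several variables, and the ambient ring for tensor products.\<close>

definition monoid_algebra ::
    "('r, 'k) ring_scheme \<Rightarrow> ('m, 'l) monoid_scheme \<Rightarrow> ('m \<Rightarrow> 'r) ring" where
  "monoid_algebra R M = \<lparr>
     carrier = {f. (\<forall>x. f x \<in> carrier R) \<and> finite {x. f x \<noteq> \<zero>\<^bsub>R\<^esub>} \<and>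
                   (\<forall>x. x \<notin> carrier M \<longrightarrow> f x = \<zero>\<^bsub>R\<^esub>)},
     monoid.mult = (\<lambda>f g z. \<Oplus>\<^bsub>R\<^esub>w \<in> {(x, y). x \<in> carrier M \<and> y \<in> carrier M \<and> f x \<noteq> \<zero>\<^bsub>R\<^esub> \<and>
                                g y \<noteq> \<zero>\<^bsub>R\<^esub> \<and> x \<otimes>\<^bsub>M\<^esub> y = z}. f (fst w) \<otimes>\<^bsub>R\<^esub> g (snd w)),
     one = (\<lambda>x. if x = \<one>\<^bsub>M\<^esub> then \<one>\<^bsub>R\<^esub> else \<zero>\<^bsub>R\<^esub>),
     ring.zero = (\<lambda>x. \<zero>\<^bsub>R\<^esub>),
     add = (\<lambda>f g x. f x \<oplus>\<^bsub>R\<^esub> g x)\<rparr>"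

definition monomial :: "('r, 'k) ring_scheme \<Rightarrow> 'm \<Rightarrow> 'r \<Rightarrow> 'm \<Rightarrow> 'r" where
  "monomial R m r = (\<lambda>x. if x = m then r else \<zero>\<^bsub>R\<^esub>)"

text \<open>\<open>R[x\<^sub>0, \<dots>, x\<^sub>n\<^sub>-\<^sub>1]\<close> is the monoid algebra of the exponent vectors of length \<open>n\<close>.\<close>

definition exponents :: "nat \<Rightarrow> (nat \<Rightarrow> nat) monoid" where
  "exponents n = \<lparr>carrier = {m. \<forall>i\<ge>n. m i = 0}, monoid.mult = (\<lambda>m m' i. m i + m' i), one = (\<lambda>i. 0)\<rparr>"

definition poly_ring :: "('r, 'k) ring_scheme \<Rightarrow> nat \<Rightarrow> ((nat \<Rightarrow> nat) \<Rightarrow> 'r) ring" where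
  "poly_ring R n = monoid_algebra R (exponents n)"

text \<open>The fraction \<open>r/s\<close> in \<open>S\<inverse>R\<close>, as an equivalence class of pairs.\<close>

definition loc_frac :: "('r, 'k) ring_scheme \<Rightarrow> 'r set \<Rightarrow> 'r \<Rightarrow> 'r \<Rightarrow> ('r \<times> 'r) set" where
  "loc_frac R S r s = {(r', s'). r' \<in> carrier R \<and> s' \<in> S \<and>
     (\<exists>u\<in>S. u \<otimes>\<^bsub>R\<^esub> (r \<otimes>\<^bsub>R\<^esub> s' \<ominus>\<^bsub>R\<^esub> r' \<otimes>\<^bsub>R\<^esub> s) = \<zero>\<^bsub>R\<^esub>)}"

definition localization :: "('r, 'k) ring_scheme \<Rightarrow> 'r set \<Rightarrow> ('r \<times> 'r) set ring" where
  "localization R S = \<lparr>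
     carrier = {loc_frac R S r s | r s. r \<in> carrier R \<and> s \<in> S},
     monoid.mult = (\<lambda>U V. the_elem {loc_frac R S (r \<otimes>\<^bsub>R\<^esub> r') (s \<otimes>\<^bsub>R\<^esub> s') | r s r' s'.
                              (r, s) \<in> U \<and> (r', s') \<in> V}),
     one = loc_frac R S \<one>\<^bsub>R\<^esub> \<one>\<^bsub>R\<^esub>,
     ring.zero = loc_frac R S \<zero>\<^bsub>R\<^esub> \<one>\<^bsub>R\<^esub>,
     add = (\<lambda>U V. the_elem {loc_frac R S (r \<otimes>\<^bsub>R\<^esub> s' \<oplus>\<^bsub>R\<^esub> r' \<otimes>\<^bsub>R\<^esub> s) (s \<otimes>\<^bsub>R\<^esub> s') | r s r' s'.
                              (r, s) \<in> U \<and> (r', s') \<in> V})\<rparr>"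

definition powers :: "('r, 'k) ring_scheme \<Rightarrow> 'r \<Rightarrow> 'r set" where
  "powers R f = {f [^]\<^bsub>R\<^esub> n | n::nat. True}"

definition localization_map ::
    "('r \<Rightarrow> 's) \<Rightarrow> ('s, 'k) ring_scheme \<Rightarrow> 's set \<Rightarrow> ('r \<times> 'r) set \<Rightarrow> ('s \<times> 's) set" where
  "localization_map \<phi> B T U = the_elem {loc_frac B T (\<phi> r) (\<phi> s) | r s. (r, s) \<in> U}"

text \<open>The residue field \<open>\<kappa>(p) = Frac(R/p)\<close> and the canonical map \<open>R \<rightarrow> \<kappa>(p)\<close>.\<close>

definition residue_field :: "('r, 'k) ring_scheme \<Rightarrow> 'r set \<Rightarrow> ('r set \<times> 'r set) set ring" where
  "residue_field R p = localization (R Quot p) (carrier (R Quot p) - {\<zero>\<^bsub>R Quot p\<^esub>})"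

definition residue_map ::
    "('r, 'k) ring_scheme \<Rightarrow> 'r set \<Rightarrow> 'r \<Rightarrow> ('r set \<times> 'r set) set" where
  "residue_map R p a =
     loc_frac (R Quot p) (carrier (R Quot p) - {\<zero>\<^bsub>R Quot p\<^esub>}) (p +>\<^bsub>R\<^esub> a) \<one>\<^bsub>R Quot p\<^esub>"

text \<open>\<open>B \<otimes>\<^sub>R C\<close> for ring homomorphisms \<open>\<phi> : R \<rightarrow> B\<close> and \<open>\<psi> : R \<rightarrow> C\<close>. It is the free abelian group
  on \<open>B \<times> C\<close> modulo the bilinearity relations; that group carries the ring structure of the
  monoid ring of \<open>B \<times> C\<close>, in which the relations span an ideal.\<close>

definition tensor_relations ::
    "('r, 'k) ring_scheme \<Rightarrow> ('b, 'l) ring_scheme \<Rightarrow> ('r \<Rightarrow> 'b) \<Rightarrow>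
     ('c, 'm) ring_scheme \<Rightarrow> ('r \<Rightarrow> 'c) \<Rightarrow> ('b \<times> 'c \<Rightarrow> int) set" where
  "tensor_relations R B \<phi> C \<psi> =
     (let Z = monoid_algebra \<Z> (B \<times>\<times> C); e = (\<lambda>b c. monomial \<Z> (b, c) (1::int)) in
      {e (b \<oplus>\<^bsub>B\<^esub> b') c \<ominus>\<^bsub>Z\<^esub> (e b c \<oplus>\<^bsub>Z\<^esub> e b' c) | b b' c.
          b \<in> carrier B \<and> b' \<in> carrier B \<and> c \<in> carrier C} \<union>
      {e b (c \<oplus>\<^bsub>C\<^esub> c') \<ominus>\<^bsub>Z\<^esub> (e b c \<oplus>\<^bsub>Z\<^esub> e b c') | b c c'.
          b \<in> carrier B \<and> c \<in> carrier C \<and> c' \<in> carrier C} \<union>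
      {e (\<phi> r \<otimes>\<^bsub>B\<^esub> b) c \<ominus>\<^bsub>Z\<^esub> e b (\<psi> r \<otimes>\<^bsub>C\<^esub> c) | r b c.
          r \<in> carrier R \<and> b \<in> carrier B \<and> c \<in> carrier C})"

definition ring_tensor ::
    "('r, 'k) ring_scheme \<Rightarrow> ('b, 'l) ring_scheme \<Rightarrow> ('r \<Rightarrow> 'b) \<Rightarrow>
     ('c, 'm) ring_scheme \<Rightarrow> ('r \<Rightarrow> 'c) \<Rightarrow> ('b \<times> 'c \<Rightarrow> int) set ring" where
  "ring_tensor R B \<phi> C \<psi> =
     monoid_algebra \<Z> (B \<times>\<times> C) Quot
       (Idl\<^bsub>monoid_algebra \<Z> (B \<times>\<times> C)\<^esub> (tensor_relations R B \<phi> C \<psi>))"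

definition pure_tensor ::
    "('r, 'k) ring_scheme \<Rightarrow> ('b, 'l) ring_scheme \<Rightarrow> ('r \<Rightarrow> 'b) \<Rightarrow>
     ('c, 'm) ring_scheme \<Rightarrow> ('r \<Rightarrow> 'c) \<Rightarrow> 'b \<Rightarrow> 'c \<Rightarrow> ('b \<times> 'c \<Rightarrow> int) set" where
  "pure_tensor R B \<phi> C \<psi> b c =
     (Idl\<^bsub>monoid_algebra \<Z> (B \<times>\<times> C)\<^esub> (tensor_relations R B \<phi> C \<psi>))
       +>\<^bsub>monoid_algebra \<Z> (B \<times>\<times> C)\<^esub> monomial \<Z> (b, c) 1"

text \<open>The tensor product of \<open>R\<close>-modules, as an abelian group.\<close>

definition module_tensor_relations ::
    "('r, 'k) ring_scheme \<Rightarrow> ('r, 'm, 'l) module_scheme \<Rightarrow> ('r, 'n, 'o) module_scheme \<Rightarrow>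
     ('m \<times> 'n \<Rightarrow>\<^sub>0 int) set" where
  "module_tensor_relations R M N =
     generate (free_Abelian_group (carrier M \<times> carrier N))
      ({frag_of (m \<oplus>\<^bsub>M\<^esub> m', n) - (frag_of (m, n) + frag_of (m', n)) | m m' n.
          m \<in> carrier M \<and> m' \<in> carrier M \<and> n \<in> carrier N} \<union>
       {frag_of (m, n \<oplus>\<^bsub>N\<^esub> n') - (frag_of (m, n) + frag_of (m, n')) | m n n'.
          m \<in> carrier M \<and> n \<in> carrier N \<and> n' \<in> carrier N} \<union>
       {frag_of (r \<odot>\<^bsub>M\<^esub> m, n) - frag_of (m, r \<odot>\<^bsub>N\<^esub> n) | r m n.
          r \<in> carrier R \<and> m \<in> carrier M \<and> n \<in> carrier N})"

definition module_tensor ::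
    "('r, 'k) ring_scheme \<Rightarrow> ('r, 'm, 'l) module_scheme \<Rightarrow> ('r, 'n, 'o) module_scheme \<Rightarrow>
     ('m \<times> 'n \<Rightarrow>\<^sub>0 int) set monoid" where
  "module_tensor R M N =
     free_Abelian_group (carrier M \<times> carrier N) Mod module_tensor_relations R M N"

text \<open>The map \<open>id \<otimes> g : M \<otimes> N \<rightarrow> M \<otimes> N'\<close> induced by \<open>g : N \<rightarrow> N'\<close>.\<close>

definition module_tensor_map ::
    "('r, 'k) ring_scheme \<Rightarrow> ('r, 'm, 'l) module_scheme \<Rightarrow> ('r, 'n, 'o) module_scheme \<Rightarrow>
     ('n2 \<Rightarrow> 'n) \<Rightarrow> ('m \<times> 'n2 \<Rightarrow>\<^sub>0 int) set \<Rightarrow> ('m \<times> 'n \<Rightarrow>\<^sub>0 int) set" where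
  "module_tensor_map R M N' g U = the_elem
     ((\<lambda>c. module_tensor_relations R M N'
             #>\<^bsub>free_Abelian_group (carrier M \<times> carrier N')\<^esub>
             frag_extend (\<lambda>(m, n). frag_of (m, g n)) c) ` U)"


section \<open>Properties of ring homomorphisms\<close>

text \<open>Throughout, a homomorphism \<open>\<phi> : A \<rightarrow> B\<close> stands for the morphism \<open>Spec B \<rightarrow> Spec A\<close>.\<close>

definition linear_map ::
    "('r, 'k) ring_scheme \<Rightarrow> ('r, 'm, 'l) module_scheme \<Rightarrow> ('r, 'n, 'o) module_scheme \<Rightarrow>
     ('m \<Rightarrow> 'n) \<Rightarrow> bool" where
  "linear_map R M N g \<longleftrightarrow> g \<in> carrier M \<rightarrow> carrier N \<and>
     (\<forall>x\<in>carrier M. \<forall>y\<in>carrier M. g (x \<oplus>\<^bsub>M\<^esub> y) = g x \<oplus>\<^bsub>N\<^esub> g y) \<and>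
     (\<forall>r\<in>carrier R. \<forall>x\<in>carrier M. g (r \<odot>\<^bsub>M\<^esub> x) = r \<odot>\<^bsub>N\<^esub> g x)"

text \<open>The test modules \<open>N\<close>, \<open>N'\<close> have carriers in the type of the ring \<open>R\<close>. This loses nothing:
  they include the ideals of \<open>R\<close> and \<open>R\<close> itself, and it suffices to test on inclusions \<open>I \<subseteq> R\<close>.\<close>

definition flat_module :: "('r, 'k) ring_scheme \<Rightarrow> ('r, 'm) module \<Rightarrow> bool" where
  "flat_module R M \<longleftrightarrow> module R M \<and>
     (\<forall>(N :: ('r, 'r) module) (N' :: ('r, 'r) module) g.
        module R N \<and> module R N' \<and> linear_map R N N' g \<and> inj_on g (carrier N) \<longrightarrow>
        inj_on (module_tensor_map R M N' g) (carrier (module_tensor R M N)))"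

definition restrict_scalars :: "('r \<Rightarrow> 's) \<Rightarrow> 's ring \<Rightarrow> ('r, 's) module" where
  "restrict_scalars \<phi> B = \<lparr>carrier = carrier B, monoid.mult = monoid.mult B, one = \<one>\<^bsub>B\<^esub>, ring.zero = \<zero>\<^bsub>B\<^esub>,
     add = add B, smult = (\<lambda>a b. \<phi> a \<otimes>\<^bsub>B\<^esub> b)\<rparr>"

definition flat :: "'r ring \<Rightarrow> ('r \<Rightarrow> 's) \<Rightarrow> 's ring \<Rightarrow> bool" where
  "flat A \<phi> B \<longleftrightarrow> flat_module A (restrict_scalars \<phi> B)"

text \<open>Faithfully flat: flat and surjective on spectra.\<close>

definition faithfully_flat :: "'r ring \<Rightarrow> ('r \<Rightarrow> 's) \<Rightarrow> 's ring \<Rightarrow> bool" where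
  "faithfully_flat A \<phi> B \<longleftrightarrow> flat A \<phi> B \<and>
     (\<forall>p. primeideal p A \<longrightarrow> (\<exists>q. primeideal q B \<and> p = {a \<in> carrier A. \<phi> a \<in> q}))"

definition finite_free ::
    "('r, 'k) ring_scheme \<Rightarrow> ('r \<Rightarrow> 's) \<Rightarrow> ('s, 'l) ring_scheme \<Rightarrow> bool" where
  "finite_free R \<phi> S \<longleftrightarrow> (\<exists>(n::nat) e. e \<in> {..<n} \<rightarrow> carrier S \<and>
     (\<forall>s\<in>carrier S. \<exists>!c. c \<in> {..<n} \<rightarrow>\<^sub>E carrier R \<and> s = (\<Oplus>\<^bsub>S\<^esub>i\<in>{..<n}. \<phi> (c i) \<otimes>\<^bsub>S\<^esub> e i)))"

text \<open>The basic open sets \<open>D(f)\<close>, \<open>f \<in> F\<close>, cover the spectrum of \<open>A\<close>.\<close>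

definition spec_cover :: "('r, 'k) ring_scheme \<Rightarrow> 'r set \<Rightarrow> bool" where
  "spec_cover A F \<longleftrightarrow> F \<subseteq> carrier A \<and> (\<forall>p. primeideal p A \<longrightarrow> \<not> F \<subseteq> p)"

definition finite_locally_free :: "'r ring \<Rightarrow> ('r \<Rightarrow> 's) \<Rightarrow> 's ring \<Rightarrow> bool" where
  "finite_locally_free A \<phi> B \<longleftrightarrow> (\<exists>F. spec_cover A F \<and>
     (\<forall>f\<in>F. finite_free (localization A (powers A f))
                        (localization_map \<phi> B (powers B (\<phi> f)))
                        (localization B (powers B (\<phi> f)))))"

text \<open>\<open>S\<close> is isomorphic to \<open>R[x\<^sub>0, \<dots>, x\<^sub>n\<^sub>-\<^sub>1]/(fs)\<close> as an \<open>R\<close>-algebra via \<open>\<phi>\<close>.\<close>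

definition has_presentation ::
    "('r, 'k) ring_scheme \<Rightarrow> ('r \<Rightarrow> 's) \<Rightarrow> ('s, 'l) ring_scheme \<Rightarrow> nat \<Rightarrow>
     ((nat \<Rightarrow> nat) \<Rightarrow> 'r) list \<Rightarrow> bool" where
  "has_presentation R \<phi> S n fs \<longleftrightarrow> set fs \<subseteq> carrier (poly_ring R n) \<and>
     (let P = poly_ring R n; I = Idl\<^bsub>P\<^esub> (set fs) in
      \<exists>h \<in> ring_iso (P Quot I) S.
        \<forall>a\<in>carrier R. h (I +>\<^bsub>P\<^esub> monomial R (\<lambda>i. 0) a) = \<phi> a)"

definition finitely_presented ::
    "('r, 'k) ring_scheme \<Rightarrow> ('r \<Rightarrow> 's) \<Rightarrow> ('s, 'l) ring_scheme \<Rightarrow> bool" where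
  "finitely_presented R \<phi> S \<longleftrightarrow> (\<exists>n fs. has_presentation R \<phi> S n fs)"

definition prime_chain :: "('r, 'k) ring_scheme \<Rightarrow> nat \<Rightarrow> bool" where
  "prime_chain R n \<longleftrightarrow>
     (\<exists>P. (\<forall>i\<le>n. primeideal (P i) R) \<and> (\<forall>i<n. P i \<subset> P (Suc i)))"

text \<open>\<open>R\<close> has Krull dimension \<open>d\<close>. The zero ring, whose dimension is \<open>-\<infinity>\<close>, has none in this sense.\<close>

definition has_krull_dim :: "('r, 'k) ring_scheme \<Rightarrow> int \<Rightarrow> bool" where
  "has_krull_dim R d \<longleftrightarrow> (\<exists>n. d = int n \<and> prime_chain R n) \<and> (\<forall>n. prime_chain R n \<longrightarrow> int n \<le> d)"

definition global_complete_intersection ::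
    "('r, 'k) ring_scheme \<Rightarrow> ('r \<Rightarrow> 's) \<Rightarrow> ('s, 'l) ring_scheme \<Rightarrow> bool" where
  "global_complete_intersection K \<phi> S \<longleftrightarrow>
     (\<exists>n fs. has_presentation K \<phi> S n fs \<and> has_krull_dim S (int n - int (length fs)))"

definition local_complete_intersection ::
    "('r, 'k) ring_scheme \<Rightarrow> ('r \<Rightarrow> 's) \<Rightarrow> ('s, 'l) ring_scheme \<Rightarrow> bool" where
  "local_complete_intersection K \<phi> S \<longleftrightarrow> (\<exists>G. spec_cover S G \<and>
     (\<forall>g\<in>G. global_complete_intersection K (\<lambda>a. loc_frac S (powers S g) (\<phi> a) \<one>\<^bsub>S\<^esub>)
              (localization S (powers S g))))"

text \<open>Syntomic: flat and of finite presentation, all fibres being local complete intersections.\<close>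

definition syntomic :: "'r ring \<Rightarrow> ('r \<Rightarrow> 's) \<Rightarrow> 's ring \<Rightarrow> bool" where
  "syntomic A \<phi> B \<longleftrightarrow> flat A \<phi> B \<and> finitely_presented A \<phi> B \<and>
     (\<forall>p. primeideal p A \<longrightarrow>
        local_complete_intersection (residue_field A p)
          (pure_tensor A B \<phi> (residue_field A p) (residue_map A p) \<one>\<^bsub>B\<^esub>)
          (ring_tensor A B \<phi> (residue_field A p) (residue_map A p)))"


section \<open>Affine schemes and pretopologies\<close>

text \<open>The category of affine schemes is the opposite of the category of commutative rings, so an
  object \<open>Spec A\<close> is represented by \<open>A\<close> and a morphism \<open>Spec B \<rightarrow> Spec A\<close> by a homomorphism
  \<open>A \<rightarrow> B\<close>. Smallness: only rings whose carrier lies in a type \<open>'u\<close> are considered. If \<open>'u\<close> is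
  infinite these are, up to isomorphism, all rings of at most the cardinality of \<open>'u\<close>, a
  class closed under algebras of finite type and under tensor products.\<close>

definition affine_schemes :: "'u ring set" where
  "affine_schemes = {A. cring A}"

definition noetherian_affine_schemes :: "'u ring set" where
  "noetherian_affine_schemes = {A. cring A \<and> noetherian_ring A}"

definition mor :: "'u ring \<Rightarrow> 'u ring \<Rightarrow> ('u \<Rightarrow> 'u) set" where
  "mor A B = ring_hom A B \<inter> extensional (carrier A)"

text \<open>An arrow \<open>(B, \<phi>)\<close> with \<open>\<phi> \<in> mor A B\<close> is a morphism \<open>Spec B \<rightarrow> Spec A\<close> with target \<open>Spec A\<close>.\<close>

type_synonym 'u arrow = "'u ring \<times> ('u \<Rightarrow> 'u)"

definition arrows :: "'u ring set \<Rightarrow> 'u ring \<Rightarrow> 'u arrow set" where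
  "arrows C A = {(B, \<phi>). B \<in> C \<and> \<phi> \<in> mor A B}"

text \<open>\<open>(P, p, q)\<close> represents the fibre product of \<open>Spec B\<close> and \<open>Spec A'\<close> over \<open>Spec A\<close> in \<open>C\<close>.\<close>

definition is_fibre_product ::
    "'u ring set \<Rightarrow> 'u ring \<Rightarrow> 'u arrow \<Rightarrow> 'u arrow \<Rightarrow>
     'u ring \<times> ('u \<Rightarrow> 'u) \<times> ('u \<Rightarrow> 'u) \<Rightarrow> bool" where
  "is_fibre_product C A = (\<lambda>(B, \<phi>) (A', \<psi>) (P, p, q).
     P \<in> C \<and> p \<in> mor B P \<and> q \<in> mor A' P \<and>
     compose (carrier A) p \<phi> = compose (carrier A) q \<psi> \<and>
     (\<forall>Q\<in>C. \<forall>r\<in>mor B Q. \<forall>s\<in>mor A' Q.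
        compose (carrier A) r \<phi> = compose (carrier A) s \<psi> \<longrightarrow>
        (\<exists>!t. t \<in> mor P Q \<and> compose (carrier B) t p = r \<and> compose (carrier A') t q = s)))"

text \<open>\<open>Cov A\<close> is the set of covering families of \<open>Spec A\<close>. Stability under base change is required
  for every choice of the fibre products.\<close>

definition pretopology :: "'u ring set \<Rightarrow> ('u ring \<Rightarrow> 'u arrow set set) \<Rightarrow> bool" where
  "pretopology C Cov \<longleftrightarrow>
     (\<forall>A\<in>C. \<forall>K\<in>Cov A. K \<subseteq> arrows C A) \<and>
     (\<forall>A\<in>C. \<forall>(B, \<phi>)\<in>arrows C A. \<phi> \<in> ring_iso A B \<longrightarrow> {(B, \<phi>)} \<in> Cov A) \<and>
     (\<forall>A\<in>C. \<forall>K\<in>Cov A. \<forall>a\<in>arrows C A.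
        (\<forall>k\<in>K. \<exists>w. is_fibre_product C A k a w) \<and>
        (\<forall>P p q. (\<forall>k\<in>K. is_fibre_product C A k a (P k, p k, q k)) \<longrightarrow>
                 (\<lambda>k. (P k, q k)) ` K \<in> Cov (fst a))) \<and>
     (\<forall>A\<in>C. \<forall>K\<in>Cov A. \<forall>L. (\<forall>k\<in>K. L k \<in> Cov (fst k)) \<longrightarrow>
        {(D, compose (carrier A) \<chi> \<phi>) | B \<phi> D \<chi>. (B, \<phi>) \<in> K \<and> (D, \<chi>) \<in> L (B, \<phi>)} \<in> Cov A)"


section \<open>Presheaves of sets and sheafification\<close>

text \<open>\<open>restr F A B \<phi> : F(Spec A) \<rightarrow> F(Spec B)\<close> for \<open>\<phi> \<in> mor A B\<close>.\<close>

record ('u, 's) presheaf =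
  sections :: "'u ring \<Rightarrow> 's set"
  restr :: "'u ring \<Rightarrow> 'u ring \<Rightarrow> ('u \<Rightarrow> 'u) \<Rightarrow> 's \<Rightarrow> 's"

text \<open>Covering sieves of the Grothendieck topology generated by the pretopology.\<close>

definition covering_sieve ::
    "'u ring set \<Rightarrow> ('u ring \<Rightarrow> 'u arrow set set) \<Rightarrow> 'u ring \<Rightarrow> 'u arrow set \<Rightarrow> bool" where
  "covering_sieve C Cov A S \<longleftrightarrow> S \<subseteq> arrows C A \<and>
     (\<forall>(B, \<phi>)\<in>S. \<forall>(D, \<chi>)\<in>arrows C B. (D, compose (carrier A) \<chi> \<phi>) \<in> S) \<and>
     (\<exists>K\<in>Cov A. K \<subseteq> S)"

definition pullback_sieve ::
    "'u ring set \<Rightarrow> 'u ring \<Rightarrow> 'u ring \<Rightarrow> ('u \<Rightarrow> 'u) \<Rightarrow> 'u arrow set \<Rightarrow> 'u arrow set" where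
  "pullback_sieve C A B \<phi> S = {(D, \<chi>) \<in> arrows C B. (D, compose (carrier A) \<chi> \<phi>) \<in> S}"

definition matching_family ::
    "'u ring set \<Rightarrow> ('u, 's) presheaf \<Rightarrow> 'u ring \<Rightarrow> 'u arrow set \<Rightarrow> ('u arrow \<Rightarrow> 's) \<Rightarrow> bool" where
  "matching_family C F A S x \<longleftrightarrow> x \<in> (\<Pi>\<^sub>E k\<in>S. sections F (fst k)) \<and>
     (\<forall>(B, \<phi>)\<in>S. \<forall>(D, \<chi>)\<in>arrows C B.
        restr F B D \<chi> (x (B, \<phi>)) = x (D, compose (carrier A) \<chi> \<phi>))"

text \<open>The plus construction: \<open>F\<^sup>+(Spec A)\<close> is the colimit over the covering sieves \<open>S\<close> of \<open>Spec A\<close> of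
  the sets of matching families on \<open>S\<close>. The sheaf associated to \<open>F\<close> is \<open>F\<^sup>+\<^sup>+\<close>.\<close>

definition plus_class ::
    "'u ring set \<Rightarrow> ('u ring \<Rightarrow> 'u arrow set set) \<Rightarrow> ('u, 's) presheaf \<Rightarrow> 'u ring \<Rightarrow>
     'u arrow set \<times> ('u arrow \<Rightarrow> 's) \<Rightarrow> ('u arrow set \<times> ('u arrow \<Rightarrow> 's)) set" where
  "plus_class C Cov F A = (\<lambda>(S, x). {(S', x'). covering_sieve C Cov A S' \<and>
     matching_family C F A S' x' \<and>
     (\<exists>T. covering_sieve C Cov A T \<and> T \<subseteq> S \<inter> S' \<and> (\<forall>k\<in>T. x k = x' k))})"

definition plus ::
    "'u ring set \<Rightarrow> ('u ring \<Rightarrow> 'u arrow set set) \<Rightarrow> ('u, 's) presheaf \<Rightarrow>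
     ('u, ('u arrow set \<times> ('u arrow \<Rightarrow> 's)) set) presheaf" where
  "plus C Cov F = \<lparr>
     sections = (\<lambda>A. {plus_class C Cov F A (S, x) | S x.
                        covering_sieve C Cov A S \<and> matching_family C F A S x}),
     restr = (\<lambda>A B \<phi> U. the_elem ((\<lambda>(S, x). plus_class C Cov F B
                (pullback_sieve C A B \<phi> S,
                 \<lambda>(D, \<chi>) \<in> pullback_sieve C A B \<phi> S. x (D, compose (carrier A) \<chi> \<phi>))) ` U))\<rparr>"

definition plus_map ::
    "'u ring set \<Rightarrow> ('u ring \<Rightarrow> 'u arrow set set) \<Rightarrow> ('u, 't) presheaf \<Rightarrow>
     ('u ring \<Rightarrow> 's \<Rightarrow> 't) \<Rightarrow> 'u ring \<Rightarrow>
     ('u arrow set \<times> ('u arrow \<Rightarrow> 's)) set \<Rightarrow> ('u arrow set \<times> ('u arrow \<Rightarrow> 't)) set" where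
  "plus_map C Cov G \<eta> A U =
     the_elem ((\<lambda>(S, x). plus_class C Cov G A (S, \<lambda>k\<in>S. \<eta> (fst k) (x k))) ` U)"

definition sheafification where
  "sheafification C Cov F = plus C Cov (plus C Cov F)"

definition sheafification_map where
  "sheafification_map C Cov G \<eta> = plus_map C Cov (plus C Cov G) (plus_map C Cov G \<eta>)"

text \<open>Surjectivity of a map of sheaves \<open>\<eta> : F \<rightarrow> G\<close>: sections of \<open>G\<close> lift locally.\<close>

definition sheaf_surjection ::
    "'u ring set \<Rightarrow> ('u ring \<Rightarrow> 'u arrow set set) \<Rightarrow> ('u, 's) presheaf \<Rightarrow> ('u, 't) presheaf \<Rightarrow>
     ('u ring \<Rightarrow> 's \<Rightarrow> 't) \<Rightarrow> bool" where
  "sheaf_surjection C Cov F G \<eta> \<longleftrightarrow>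
     (\<forall>A\<in>C. \<forall>t\<in>sections G A. \<exists>K\<in>Cov A. \<forall>(B, \<phi>)\<in>K.
        \<exists>s\<in>sections F B. \<eta> B s = restr G A B \<phi> t)"


section \<open>Reduced monoid rings and rational Witt vectors\<close>

definition monoid_ring :: "'u ring \<Rightarrow> ('u \<Rightarrow> int) ring" where
  "monoid_ring A = monoid_algebra \<Z> A"

definition zero_ideal :: "'u ring \<Rightarrow> ('u \<Rightarrow> int) set" where
  "zero_ideal A = PIdl\<^bsub>monoid_ring A\<^esub> (monomial \<Z> \<zero>\<^bsub>A\<^esub> 1)"

definition reduced_monoid_ring :: "'u ring \<Rightarrow> ('u \<Rightarrow> int) set ring" where
  "reduced_monoid_ring A = monoid_ring A Quot zero_ideal A"

definition monoid_ring_map ::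
    "'u ring \<Rightarrow> 'u ring \<Rightarrow> ('u \<Rightarrow> 'u) \<Rightarrow> ('u \<Rightarrow> int) \<Rightarrow> 'u \<Rightarrow> int" where
  "monoid_ring_map A B \<phi> f = (\<lambda>b. \<Sum>a | a \<in> carrier A \<and> f a \<noteq> 0 \<and> \<phi> a = b. f a)"

definition reduced_monoid_presheaf :: "('u, ('u \<Rightarrow> int) set) presheaf" where
  "reduced_monoid_presheaf = \<lparr>
     sections = (\<lambda>A. carrier (reduced_monoid_ring A)),
     restr = (\<lambda>A B \<phi> U. the_elem
                ((\<lambda>f. zero_ideal B +>\<^bsub>monoid_ring B\<^esub> monoid_ring_map A B \<phi> f) ` U))\<rparr>"

text \<open>Power series are identified with their coefficient sequences.\<close>

definition witt_carrier :: "'u ring \<Rightarrow> (nat \<Rightarrow> 'u) set" where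
  "witt_carrier A = {f. (\<forall>n. f n \<in> carrier A) \<and> f 0 = \<one>\<^bsub>A\<^esub>}"

definition series_mult :: "'u ring \<Rightarrow> (nat \<Rightarrow> 'u) \<Rightarrow> (nat \<Rightarrow> 'u) \<Rightarrow> nat \<Rightarrow> 'u" where
  "series_mult A f g = (\<lambda>n. \<Oplus>\<^bsub>A\<^esub>i\<in>{..n}. f i \<otimes>\<^bsub>A\<^esub> g (n - i))"

text \<open>\<open>teich A a\<close> is \<open>[a] = 1 - aT\<close>.\<close>

definition teich :: "'u ring \<Rightarrow> 'u \<Rightarrow> nat \<Rightarrow> 'u" where
  "teich A a = (\<lambda>n. if n = 0 then \<one>\<^bsub>A\<^esub> else if n = 1 then \<ominus>\<^bsub>A\<^esub> a else \<zero>\<^bsub>A\<^esub>)"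

definition witt_ring_with ::
    "('u ring \<Rightarrow> (nat \<Rightarrow> 'u) \<Rightarrow> (nat \<Rightarrow> 'u) \<Rightarrow> nat \<Rightarrow> 'u) \<Rightarrow> 'u ring \<Rightarrow> (nat \<Rightarrow> 'u) ring" where
  "witt_ring_with \<mu> A = \<lparr>carrier = witt_carrier A, monoid.mult = \<mu> A, one = teich A \<one>\<^bsub>A\<^esub>,
     ring.zero = (\<lambda>n. if n = 0 then \<one>\<^bsub>A\<^esub> else \<zero>\<^bsub>A\<^esub>), add = series_mult A\<rparr>"

text \<open>The conditions below are, in this order: the ring axioms with unit \<open>1 - T\<close>, functoriality,
  \<open>T\<close>-adic continuity, and \<open>(1 - aT)\<cdot>(1 - bT) = 1 - abT\<close>.\<close>

definition is_witt_mult ::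
    "('u ring \<Rightarrow> (nat \<Rightarrow> 'u) \<Rightarrow> (nat \<Rightarrow> 'u) \<Rightarrow> nat \<Rightarrow> 'u) \<Rightarrow> bool" where
  "is_witt_mult \<mu> \<longleftrightarrow>
     (\<forall>A. cring A \<longrightarrow> cring (witt_ring_with \<mu> A)) \<and>
     (\<forall>A B \<phi>. cring A \<and> cring B \<and> \<phi> \<in> ring_hom A B \<longrightarrow>
        (\<forall>f\<in>witt_carrier A. \<forall>g\<in>witt_carrier A. \<phi> \<circ> \<mu> A f g = \<mu> B (\<phi> \<circ> f) (\<phi> \<circ> g))) \<and>
     (\<forall>A. cring A \<longrightarrow> (\<forall>f\<in>witt_carrier A. \<forall>g\<in>witt_carrier A. \<forall>n. \<exists>m.
        \<forall>f'\<in>witt_carrier A. \<forall>g'\<in>witt_carrier A.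
          (\<forall>i<m. f' i = f i \<and> g' i = g i) \<longrightarrow> (\<forall>i<n. \<mu> A f' g' i = \<mu> A f g i))) \<and>
     (\<forall>A. cring A \<longrightarrow> (\<forall>a\<in>carrier A. \<forall>b\<in>carrier A.
        \<mu> A (teich A a) (teich A b) = teich A (a \<otimes>\<^bsub>A\<^esub> b)))"

text \<open>The multiplication characterised above is unique on the carriers; its values elsewhere are
  immaterial.\<close>

definition witt_mult :: "'u ring \<Rightarrow> (nat \<Rightarrow> 'u) \<Rightarrow> (nat \<Rightarrow> 'u) \<Rightarrow> nat \<Rightarrow> 'u" where
  "witt_mult = (SOME \<mu>. is_witt_mult \<mu>)"

definition witt_ring :: "'u ring \<Rightarrow> (nat \<Rightarrow> 'u) ring" where
  "witt_ring = witt_ring_with witt_mult"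

text \<open>Subtraction in \<open>W(A)\<close> is division of power series, so the elements below are the \<open>P/Q\<close>.\<close>

definition rational_witt_ring :: "'u ring \<Rightarrow> (nat \<Rightarrow> 'u) ring" where
  "rational_witt_ring A = (witt_ring A)\<lparr>carrier :=
     {P \<ominus>\<^bsub>witt_ring A\<^esub> Q | P Q. P \<in> carrier (UP A) \<and> Q \<in> carrier (UP A) \<and>
                             P 0 = \<one>\<^bsub>A\<^esub> \<and> Q 0 = \<one>\<^bsub>A\<^esub>}\<rparr>"

definition rational_witt_presheaf :: "('u, nat \<Rightarrow> 'u) presheaf" where
  "rational_witt_presheaf = \<lparr>
     sections = (\<lambda>A. carrier (rational_witt_ring A)),
     restr = (\<lambda>A B \<phi> f. \<phi> \<circ> f)\<rparr>"

text \<open>The extension of \<open>a \<mapsto> [a]\<close> to \<open>\<int>A\<close>, and the induced map \<open>\<omega>\<close> on the quotient by \<open>\<int>(0)\<close>. Sums in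
  the Witt ring are products of power series.\<close>

definition omega_lift :: "'u ring \<Rightarrow> ('u \<Rightarrow> int) \<Rightarrow> nat \<Rightarrow> 'u" where
  "omega_lift A f = (\<Oplus>\<^bsub>rational_witt_ring A\<^esub>a\<in>{a \<in> carrier A. f a \<noteq> 0}.
     [f a] \<cdot>\<^bsub>rational_witt_ring A\<^esub> teich A a)"

definition omega :: "'u ring \<Rightarrow> ('u \<Rightarrow> int) set \<Rightarrow> nat \<Rightarrow> 'u" where
  "omega A U = the_elem (omega_lift A ` U)"

end

theory Submission
  imports Defs
begin

text \<open>
  A polynomial \<open>P = 1 + p\<^sub>1 T + \<dots> + p\<^sub>n T\<^sup>n\<close> over \<open>A\<close> acquires a factor \<open>1 - x T\<close> over
  \<open>B = A[x]/(x\<^sup>n + p\<^sub>1 x\<^sup>n\<^sup>-\<^sup>1 + \<dots> + p\<^sub>n)\<close>. This \<open>B\<close> is free over \<open>A\<close> with basis \<open>1, x, \<dots>, x\<^sup>n\<^sup>-\<^sup>1\<close>, and every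
  base change of it is of the same shape; over a field it is a zero-dimensional quotient of a
  polynomial ring by one equation. Hence \<open>Spec B \<rightarrow> Spec A\<close> is syntomic, finite locally free and, by
  lifting primes from the fibres, faithfully flat. Splitting off one root after the other turns
  every \<open>P/Q\<close> into a quotient of products of elements \<open>[x] = 1 - x T\<close>, which lies in the image of
  \<open>\<omega>\<close>. So \<open>\<omega>\<close> is locally surjective on presheaves, a property that passes to the plus construction.
\<close>

section \<open>Local surjectivity passes to the plus construction\<close>

text \<open>The adjoined equation is the reverse of \<open>P\<close>: P(T) is a product of factors 1
  - x_i T exactly when X^n P(1/X) is the product of the X - x_i. The condition P(0) = 1 is what
  makes this equation monic, whatever the top coefficient of \<open>P\<close>, so \<open>n\<close>
  may be any bound for the degree. The obstacle is that the algebra appears in many guises: as a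
  quotient in a large type, as a copy in the given type, localised at 1, tensored with residue
  fields. The arguments therefore rest on an intrinsic description, \<open>monogenic\<close>: x
  satisfies the equation and 1, ..., x^(n-1) is a basis. It is stable under isomorphism and base
  change, and each geometric property is derived from it. The condition 0 < n keeps the fibres
  nonempty. A second obstacle is size: the covering ring must have its carrier in \<open>'u\<close>,
  which is possible because its elements are n-tuples from \<open>A\<close> and an infinite type
  absorbs finite powers. Finally, sections of the associated sheaf are classes of families, not Witt
  vectors, so lifting has to be proved again for the plus construction.\<close>

definition presheaf_on :: "'u ring set \<Rightarrow> ('u, 's) presheaf \<Rightarrow> bool" where
  "presheaf_on C F \<longleftrightarrow>
     (\<forall>A\<in>C. \<forall>B\<in>C. \<forall>\<phi>\<in>mor A B. restr F A B \<phi> \<in> sections F A \<rightarrow> sections F B) \<and>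
     (\<forall>A\<in>C. \<forall>B\<in>C. \<forall>D\<in>C. \<forall>\<phi>\<in>mor A B. \<forall>\<chi>\<in>mor B D. \<forall>s\<in>sections F A.
        restr F A D (compose (carrier A) \<chi> \<phi>) s = restr F B D \<chi> (restr F A B \<phi> s))"

definition presheaf_morphism ::
    "'u ring set \<Rightarrow> ('u, 's) presheaf \<Rightarrow> ('u, 't) presheaf \<Rightarrow> ('u ring \<Rightarrow> 's \<Rightarrow> 't) \<Rightarrow> bool" where
  "presheaf_morphism C F G \<eta> \<longleftrightarrow>
     (\<forall>A\<in>C. \<eta> A \<in> sections F A \<rightarrow> sections G A) \<and>
     (\<forall>A\<in>C. \<forall>B\<in>C. \<forall>\<phi>\<in>mor A B. \<forall>s\<in>sections F A.
        \<eta> B (restr F A B \<phi> s) = restr G A B \<phi> (\<eta> A s))"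

section \<open>Composition of morphisms and the laws of presheaves\<close>

lemma mor_closed: "\<phi> \<in> mor A B \<Longrightarrow> a \<in> carrier A \<Longrightarrow> \<phi> a \<in> carrier B"
  by (auto simp: mor_def ring_hom_def)

lemma mor_compose:
  assumes "ring A" "\<phi> \<in> mor A B" "\<chi> \<in> mor B D"
  shows "compose (carrier A) \<chi> \<phi> \<in> mor A D"
proof -
  interpret A: ring A by fact
  have "\<phi> \<in> ring_hom A B" "\<chi> \<in> ring_hom B D" using assms by (auto simp: mor_def)
  then have "\<chi> \<circ> \<phi> \<in> ring_hom A D" by (rule ring_hom_trans)
  then have "compose (carrier A) \<chi> \<phi> \<in> ring_hom A D"
    by (auto simp: compose_def ring_hom_def)
  then show ?thesis by (simp add: mor_def)
qed

lemma compose_mor_assoc: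
  assumes "\<phi> \<in> mor A B"
  shows "compose (carrier A) (compose (carrier B) \<psi> \<chi>) \<phi>
         = compose (carrier A) \<psi> (compose (carrier A) \<chi> \<phi>)"
  using mor_closed[OF assms] by (auto simp: compose_def fun_eq_iff)

lemma mor_id: "ring A \<Longrightarrow> (\<lambda>x\<in>carrier A. x) \<in> mor A A"
  by (auto simp: mor_def ring_hom_def ring.ring_simprules monoid.m_closed ring_def)

lemma presheaf_onD:
  assumes "presheaf_on C F" "A \<in> C" "s \<in> sections F A" "(B, \<phi>) \<in> arrows C A"
  shows "restr F A B \<phi> s \<in> sections F B"
    and "(D, \<chi>) \<in> arrows C B \<Longrightarrow>
      restr F A D (compose (carrier A) \<chi> \<phi>) s = restr F B D \<chi> (restr F A B \<phi> s)"
  using assms unfolding presheaf_on_def arrows_def by auto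

lemma presheaf_morphismD:
  assumes "presheaf_morphism C F G \<eta>" "A \<in> C" "s \<in> sections F A"
  shows "\<eta> A s \<in> sections G A"
    and "(B, \<phi>) \<in> arrows C A \<Longrightarrow> \<eta> B (restr F A B \<phi> s) = restr G A B \<phi> (\<eta> A s)"
  using assms unfolding presheaf_morphism_def arrows_def by auto

lemma matching_familyD:
  assumes "matching_family C F A S x" "(B, \<phi>) \<in> S"
  shows "x (B, \<phi>) \<in> sections F B"
    and "(D, \<chi>) \<in> arrows C B \<Longrightarrow>
      restr F B D \<chi> (x (B, \<phi>)) = x (D, compose (carrier A) \<chi> \<phi>)"
  using assms unfolding matching_family_def by (auto simp: PiE_iff)

lemma matching_familyI:
  assumes "x \<in> extensional S" "\<And>B \<phi>. (B, \<phi>) \<in> S \<Longrightarrow> x (B, \<phi>) \<in> sections F B"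
    "\<And>B \<phi> D \<chi>. (B, \<phi>) \<in> S \<Longrightarrow> (D, \<chi>) \<in> arrows C B \<Longrightarrow>
      restr F B D \<chi> (x (B, \<phi>)) = x (D, compose (carrier A) \<chi> \<phi>)"
  shows "matching_family C F A S x"
  using assms unfolding matching_family_def by (auto simp: PiE_iff)

section \<open>Covers and covering sieves of a pretopology\<close>

locale site =
  fixes C :: "'u ring set" and Cov :: "'u ring \<Rightarrow> 'u arrow set set"
  assumes pretopology: "pretopology C Cov"
    and objects_cring: "A \<in> C \<Longrightarrow> cring A"
begin

lemmas pretopology_axioms = pretopology[unfolded pretopology_def]

lemma cover_arrows: "A \<in> C \<Longrightarrow> K \<in> Cov A \<Longrightarrow> K \<subseteq> arrows C A"
  using conjunct1[OF pretopology_axioms] by blast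

lemma iso_cover: "A \<in> C \<Longrightarrow> (B, \<phi>) \<in> arrows C A \<Longrightarrow> \<phi> \<in> ring_iso A B \<Longrightarrow> {(B, \<phi>)} \<in> Cov A"
  using conjunct1[OF conjunct2[OF pretopology_axioms]] by fast

lemma arrow_id: "A \<in> C \<Longrightarrow> (A, \<lambda>x\<in>carrier A. x) \<in> arrows C A"
  using mor_id objects_cring unfolding arrows_def cring_def by auto

lemma id_cover:
  assumes "A \<in> C" shows "{(A, \<lambda>x\<in>carrier A. x)} \<in> Cov A"
proof (rule iso_cover[OF assms arrow_id[OF assms]])
  have "(\<lambda>x\<in>carrier A. x) \<in> mor A A" using arrow_id[OF assms] by (simp add: arrows_def)
  then show "(\<lambda>x\<in>carrier A. x) \<in> ring_iso A A"
    by (auto simp: mor_def ring_iso_def bij_betw_def inj_on_def)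
qed

lemma cover_compose:
  assumes "A \<in> C" "K \<in> Cov A" "\<And>B \<phi>. (B, \<phi>) \<in> K \<Longrightarrow> L (B, \<phi>) \<in> Cov B"
  shows "{(D, compose (carrier A) \<chi> \<phi>) | B \<phi> D \<chi>. (B, \<phi>) \<in> K \<and> (D, \<chi>) \<in> L (B, \<phi>)} \<in> Cov A"
proof -
  have "\<forall>k\<in>K. L k \<in> Cov (fst k)" using assms(3) by auto
  then show ?thesis
    using conjunct2[OF conjunct2[OF conjunct2[OF pretopology_axioms]]] assms(1,2) by simp
qed

text \<open>Comes from stability under base change: fibre products with the members of
  \<open>K\<close> are chosen, and of each only the commuting square is kept. The factorisation
  through a member of \<open>K\<close> is all that arguments with sieves need.\<close>

lemma cover_pullback:
  assumes "A \<in> C" "K \<in> Cov A" "(B, \<phi>) \<in> arrows C A"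
  obtains K' where "K' \<in> Cov B"
    "\<And>D \<chi>. (D, \<chi>) \<in> K' \<Longrightarrow> \<exists>(E, \<kappa>)\<in>K. \<exists>p\<in>mor E D.
        compose (carrier A) \<chi> \<phi> = compose (carrier A) p \<kappa>"
proof -
  note base_change = conjunct1[OF conjunct2[OF conjunct2[OF pretopology_axioms]],
      THEN bspec, OF assms(1), THEN bspec, OF assms(2), THEN bspec, OF assms(3)]
  have "\<forall>k\<in>K. \<exists>w. is_fibre_product C A k (B, \<phi>) w" by (rule conjunct1[OF base_change])
  then obtain w where w: "\<forall>k\<in>K. is_fibre_product C A k (B, \<phi>) (w k)" by metis
  define P p q where "P = fst \<circ> w" and "p = fst \<circ> snd \<circ> w" and "q = snd \<circ> snd \<circ> w"
  have w': "\<forall>k\<in>K. is_fibre_product C A k (B, \<phi>) (P k, p k, q k)"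
    using w by (simp add: P_def p_def q_def)
  have "\<forall>P p q. (\<forall>k\<in>K. is_fibre_product C A k (B, \<phi>) (P k, p k, q k)) \<longrightarrow>
                 (\<lambda>k. (P k, q k)) ` K \<in> Cov (fst (B, \<phi>))"
    by (rule conjunct2[OF base_change])
  from spec[OF spec[OF spec[OF this, of P], of p], of q] w'
  have "(\<lambda>k. (P k, q k)) ` K \<in> Cov (fst (B, \<phi>))" by (rule mp)
  then have K': "(\<lambda>k. (P k, q k)) ` K \<in> Cov B" by (simp only: fst_conv)
  have "\<exists>(E, \<kappa>)\<in>K. \<exists>p\<in>mor E D.
        compose (carrier A) \<chi> \<phi> = compose (carrier A) p \<kappa>"
    if "(D, \<chi>) \<in> (\<lambda>k. (P k, q k)) ` K" for D \<chi>
  proof -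
    obtain k where "k \<in> K" "(D, \<chi>) = (P k, q k)" using \<open>(D, \<chi>) \<in> _\<close> by (rule imageE)
    then obtain E \<kappa> where k: "(E, \<kappa>) \<in> K" "D = P (E, \<kappa>)" "\<chi> = q (E, \<kappa>)"
      by (cases k) simp
    have "is_fibre_product C A (E, \<kappa>) (B, \<phi>) (D, p (E, \<kappa>), \<chi>)"
      using bspec[OF w' k(1)] k(2,3) by simp
    then have "p (E, \<kappa>) \<in> mor E D" "compose (carrier A) (p (E, \<kappa>)) \<kappa> = compose (carrier A) \<chi> \<phi>"
      unfolding is_fibre_product_def by auto
    then show ?thesis using k(1) by (intro bexI[of _ "(E, \<kappa>)"]) (simp, rule bexI[of _ "p (E, \<kappa>)"], simp_all)
  qed
  then show thesis by (rule that[OF K'])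
qed

lemma arrows_compose:
  "A \<in> C \<Longrightarrow> (B, \<phi>) \<in> arrows C A \<Longrightarrow> (D, \<chi>) \<in> arrows C B \<Longrightarrow>
     (D, compose (carrier A) \<chi> \<phi>) \<in> arrows C A"
  using objects_cring by (auto simp: arrows_def cring_def intro: mor_compose)

lemma sieve_compose:
  "covering_sieve C Cov A S \<Longrightarrow> (B, \<phi>) \<in> S \<Longrightarrow> (D, \<chi>) \<in> arrows C B \<Longrightarrow>
     (D, compose (carrier A) \<chi> \<phi>) \<in> S"
  unfolding covering_sieve_def by blast

lemma covering_sieveI:
  assumes "K \<in> Cov A" "K \<subseteq> S" "S \<subseteq> arrows C A"
    "\<And>B \<phi> D \<chi>. (B, \<phi>) \<in> S \<Longrightarrow> (D, \<chi>) \<in> arrows C B \<Longrightarrow> (D, compose (carrier A) \<chi> \<phi>) \<in> S"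
  shows "covering_sieve C Cov A S"
  unfolding covering_sieve_def using assms(1-3) by (intro conjI ballI bexI[of _ K]) (auto intro: assms(4))

lemma sieve_arrows: "covering_sieve C Cov A S \<Longrightarrow> S \<subseteq> arrows C A"
  unfolding covering_sieve_def by blast

lemma covering_sieve_arrows:
  assumes "A \<in> C" shows "covering_sieve C Cov A (arrows C A)"
  using arrow_id[OF assms] arrows_compose[OF assms]
  by (intro covering_sieveI[OF id_cover[OF assms]]) auto

text \<open>A member of the base-changed cover, composed with \<phi>, factors through a member of
  \<open>K\<close>; since \<open>S\<close> is closed under further composition, it lies in the
  pullback.\<close>

lemma covering_sieve_pullback:
  assumes A: "A \<in> C" and S: "covering_sieve C Cov A S" and \<phi>: "(B, \<phi>) \<in> arrows C A"
  shows "covering_sieve C Cov B (pullback_sieve C A B \<phi> S)"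
proof -
  obtain K where K: "K \<in> Cov A" "K \<subseteq> S" using S unfolding covering_sieve_def by blast
  obtain K' where K': "K' \<in> Cov B" "\<And>D \<chi>. (D, \<chi>) \<in> K' \<Longrightarrow> \<exists>(E, \<kappa>)\<in>K. \<exists>p\<in>mor E D.
        compose (carrier A) \<chi> \<phi> = compose (carrier A) p \<kappa>"
    using cover_pullback[OF A K(1) \<phi>] by blast
  have B: "B \<in> C" "\<phi> \<in> mor A B" using \<phi> by (auto simp: arrows_def)
  have "K' \<subseteq> pullback_sieve C A B \<phi> S"
  proof (clarify)
    fix D \<chi> assume d: "(D, \<chi>) \<in> K'"
    obtain E \<kappa> p where e: "(E, \<kappa>) \<in> K" "p \<in> mor E D"
      "compose (carrier A) \<chi> \<phi> = compose (carrier A) p \<kappa>" using K'(2)[OF d] by auto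
    have d': "(D, \<chi>) \<in> arrows C B" using cover_arrows[OF B(1) K'(1)] d by (rule subsetD)
    then have "(D, p) \<in> arrows C E" using e(2) by (auto simp: arrows_def)
    then have "(D, compose (carrier A) \<chi> \<phi>) \<in> S"
      using sieve_compose[OF S subsetD[OF K(2) e(1)]] e(3) by simp
    then show "(D, \<chi>) \<in> pullback_sieve C A B \<phi> S" using d' by (simp add: pullback_sieve_def)
  qed
  moreover have "(E, compose (carrier B) \<psi> \<chi>) \<in> pullback_sieve C A B \<phi> S"
    if "(D, \<chi>) \<in> pullback_sieve C A B \<phi> S" "(E, \<psi>) \<in> arrows C D" for D \<chi> E \<psi>
  proof -
    have d: "(D, \<chi>) \<in> arrows C B" "(D, compose (carrier A) \<chi> \<phi>) \<in> S"
      using that(1) by (auto simp: pullback_sieve_def)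
    show ?thesis using sieve_compose[OF S d(2) that(2)] arrows_compose[OF B(1) d(1) that(2)]
      by (simp add: pullback_sieve_def compose_mor_assoc[OF B(2)])
  qed
  moreover have "pullback_sieve C A B \<phi> S \<subseteq> arrows C B" by (auto simp: pullback_sieve_def)
  ultimately show ?thesis by (intro covering_sieveI[OF K'(1)])
qed

text \<open>Transitivity of covers: a cover inside \<open>S\<close> is refined on each of its
  members by a cover inside the pullback of \<open>T\<close>. The composites lie in \<open>S\<close>
  because \<open>S\<close> is a sieve, and in \<open>T\<close> by the choice of the
  refinement.\<close>

lemma covering_sieve_Int:
  assumes A: "A \<in> C" and S: "covering_sieve C Cov A S" and T: "covering_sieve C Cov A T"
  shows "covering_sieve C Cov A (S \<inter> T)"
proof -
  obtain K where K: "K \<in> Cov A" "K \<subseteq> S" using S unfolding covering_sieve_def by blast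
  have "\<forall>k\<in>K. \<exists>L. L \<in> Cov (fst k) \<and> L \<subseteq> pullback_sieve C A (fst k) (snd k) T"
  proof
    fix k assume "k \<in> K"
    then have "(fst k, snd k) \<in> arrows C A" using cover_arrows[OF A K(1)] by auto
    from covering_sieve_pullback[OF A T this]
    show "\<exists>L. L \<in> Cov (fst k) \<and> L \<subseteq> pullback_sieve C A (fst k) (snd k) T"
      unfolding covering_sieve_def by blast
  qed
  from bchoice[OF this] obtain L where L': "\<forall>k\<in>K. L k \<in> Cov (fst k) \<and>
      L k \<subseteq> pullback_sieve C A (fst k) (snd k) T" by blast
  have L: "L (B, \<phi>) \<in> Cov B" "L (B, \<phi>) \<subseteq> pullback_sieve C A B \<phi> T" if "(B, \<phi>) \<in> K" for B \<phi>
    using bspec[OF L' that] by auto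
  let ?M = "{(D, compose (carrier A) \<chi> \<phi>) | B \<phi> D \<chi>. (B, \<phi>) \<in> K \<and> (D, \<chi>) \<in> L (B, \<phi>)}"
  have "(D, compose (carrier A) \<chi> \<phi>) \<in> S \<inter> T"
    if k: "(B, \<phi>) \<in> K" "(D, \<chi>) \<in> L (B, \<phi>)" for B \<phi> D \<chi>
  proof -
    have "(D, \<chi>) \<in> pullback_sieve C A B \<phi> T" using subsetD[OF L(2)[OF k(1)] k(2)] .
    then have "(D, \<chi>) \<in> arrows C B" "(D, compose (carrier A) \<chi> \<phi>) \<in> T"
      by (auto simp: pullback_sieve_def)
    then show ?thesis using sieve_compose[OF S subsetD[OF K(2) k(1)]] by simp
  qed
  then have "?M \<subseteq> S \<inter> T" by (intro subsetI) (elim CollectE exE conjE, simp)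
  moreover have "?M \<in> Cov A" by (rule cover_compose[OF A K(1) L(1)])
  moreover have "S \<inter> T \<subseteq> arrows C A" using sieve_arrows[OF S] by (rule le_infI1)
  ultimately show ?thesis
    by (intro covering_sieveI[of ?M] IntI sieve_compose[OF S] sieve_compose[OF T]) simp_all
qed

section \<open>The plus construction computed on representatives\<close>

definition represents ::
    "('u, 's) presheaf \<Rightarrow> 'u ring \<Rightarrow> 'u arrow set \<Rightarrow> ('u arrow \<Rightarrow> 's) \<Rightarrow> bool" where
  "represents F A S x \<longleftrightarrow> covering_sieve C Cov A S \<and> matching_family C F A S x"

text \<open>Agreement on one covering sieve \<open>T\<close> is enough: a sieve that witnesses
  membership in one class is intersected with \<open>T\<close> to witness membership in the
  other.\<close>

lemma plus_class_eqI:
  assumes A: "A \<in> C" and T: "covering_sieve C Cov A T" "T \<subseteq> S" "T \<subseteq> S'" "\<And>k. k \<in> T \<Longrightarrow> x k = x' k"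
  shows "plus_class C Cov F A (S, x) = plus_class C Cov F A (S', x')"
proof -
  have *: "\<exists>T'. covering_sieve C Cov A T' \<and> T' \<subseteq> S2 \<and> T' \<subseteq> R \<and> (\<forall>k\<in>T'. x2 k = y k)"
    if "covering_sieve C Cov A T1" "T1 \<subseteq> R" "\<forall>k\<in>T1. x1 k = y k"
      "T \<subseteq> S2" "\<And>k. k \<in> T \<Longrightarrow> x1 k = x2 k" for T1 S2 R x1 x2 y
  proof (intro exI conjI)
    show "covering_sieve C Cov A (T1 \<inter> T)" by (rule covering_sieve_Int[OF A that(1) T(1)])
  qed (use that in auto)
  show ?thesis unfolding plus_class_def prod.case
    apply (rule Collect_cong, clarsimp)
    apply (intro conj_cong refl iffI; elim exE conjE)
    subgoal for R y T1 by (rule *[of T1 _ x]) (use T in simp_all)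
    subgoal for R y T1 by (rule *[of T1 _ x']) (use T in simp_all)
    done
qed

lemma plus_class_memD:
  assumes "(S', x') \<in> plus_class C Cov F A (S, x)"
  shows "represents F A S' x'"
    and "\<exists>T. covering_sieve C Cov A T \<and> T \<subseteq> S \<and> T \<subseteq> S' \<and> (\<forall>k\<in>T. x k = x' k)"
  using assms by (auto simp: plus_class_def represents_def)

lemma plus_class_self: "represents F A S x \<Longrightarrow> (S, x) \<in> plus_class C Cov F A (S, x)"
  by (auto simp: plus_class_def represents_def)

lemma sections_plus:
  "sections (plus C Cov F) A = {plus_class C Cov F A (S, x) | S x. represents F A S x}"
  by (simp add: plus_def represents_def)

lemma plus_class_section:
  assumes "represents F A S x" shows "plus_class C Cov F A (S, x) \<in> sections (plus C Cov F) A"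
  unfolding sections_plus by (rule CollectI, intro exI conjI, rule refl, rule assms)

text \<open>Restrictions and induced maps on F^+ are defined as the sole element of an image of a
  class. This is the corresponding test of well-definedness: it suffices to compare representatives
  that agree on a covering sieve.\<close>

lemma the_elem_plus_class:
  assumes "represents F A S x"
    and "\<And>S' x' T. represents F A S' x' \<Longrightarrow> covering_sieve C Cov A T \<Longrightarrow> T \<subseteq> S \<Longrightarrow> T \<subseteq> S' \<Longrightarrow>
           (\<forall>k\<in>T. x k = x' k) \<Longrightarrow> h (S', x') = h (S, x)"
  shows "the_elem (h ` plus_class C Cov F A (S, x)) = h (S, x)"
proof -
  have "h (S', x') = h (S, x)" if p: "(S', x') \<in> plus_class C Cov F A (S, x)" for S' x'
    using plus_class_memD(2)[OF p] assms(2)[OF plus_class_memD(1)[OF p]] by blast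
  then have "h ` plus_class C Cov F A (S, x) \<subseteq> {h (S, x)}" by auto
  then have "h ` plus_class C Cov F A (S, x) = {h (S, x)}"
    using imageI[OF plus_class_self[OF assms(1)], of h] by blast
  then show ?thesis by simp
qed

lemma plus_map_class:
  assumes "A \<in> C" "represents F A S x"
  shows "plus_map C Cov G \<eta> A (plus_class C Cov F A (S, x))
         = plus_class C Cov G A (S, \<lambda>k\<in>S. \<eta> (fst k) (x k))"
  unfolding plus_map_def
  apply (subst the_elem_plus_class[OF assms(2)])
  subgoal for S' x' T
    by (simp only: prod.case, rule plus_class_eqI[OF assms(1), of T]) (auto simp: subset_iff)
  subgoal by simp
  done

definition family_restr where
  "family_restr A B \<phi> S x =
     (\<lambda>(D, \<chi>) \<in> pullback_sieve C A B \<phi> S. x (D, compose (carrier A) \<chi> \<phi>))"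

lemma restr_plus_class:
  assumes "A \<in> C" "represents F A S x" "(B, \<phi>) \<in> arrows C A"
  shows "restr (plus C Cov F) A B \<phi> (plus_class C Cov F A (S, x))
         = plus_class C Cov F B (pullback_sieve C A B \<phi> S, family_restr A B \<phi> S x)"
proof -
  have B: "B \<in> C" using assms(3) by (auto simp: arrows_def)
  show ?thesis
    unfolding plus_def family_restr_def presheaf.simps
    apply (subst the_elem_plus_class[OF assms(2)])
    subgoal for S' x' T
      apply simp
      apply (rule plus_class_eqI[OF B covering_sieve_pullback[OF assms(1) _ assms(3)], of T])
      by (auto simp: pullback_sieve_def)
    subgoal by simp
    done
qed

lemma pullback_sieveD:
  assumes "(D, \<chi>) \<in> pullback_sieve C A B \<phi> S"
  shows "(D, \<chi>) \<in> arrows C B" "(D, compose (carrier A) \<chi> \<phi>) \<in> S"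
  using assms by (auto simp: pullback_sieve_def)

lemma represents_restr:
  assumes "A \<in> C" "represents F A S x" "(B, \<phi>) \<in> arrows C A"
  shows "represents F B (pullback_sieve C A B \<phi> S) (family_restr A B \<phi> S x)"
proof -
  have S: "covering_sieve C Cov A S" and x: "matching_family C F A S x"
    using assms(2) by (auto simp: represents_def)
  have \<phi>: "\<phi> \<in> mor A B" using assms(3) by (auto simp: arrows_def)
  note P = covering_sieve_pullback[OF assms(1) S assms(3)]
  have "matching_family C F B (pullback_sieve C A B \<phi> S) (family_restr A B \<phi> S x)"
  proof (rule matching_familyI)
    show "family_restr A B \<phi> S x \<in> extensional (pullback_sieve C A B \<phi> S)"
      by (simp add: family_restr_def)
    fix D \<chi> assume d: "(D, \<chi>) \<in> pullback_sieve C A B \<phi> S"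
    show "family_restr A B \<phi> S x (D, \<chi>) \<in> sections F D"
      using matching_familyD(1)[OF x pullback_sieveD(2)[OF d]] d by (simp add: family_restr_def)
    fix E \<psi> assume e: "(E, \<psi>) \<in> arrows C D"
    show "restr F D E \<psi> (family_restr A B \<phi> S x (D, \<chi>))
            = family_restr A B \<phi> S x (E, compose (carrier B) \<psi> \<chi>)"
      using matching_familyD(2)[OF x pullback_sieveD(2)[OF d] e] d sieve_compose[OF P d e]
      by (simp add: family_restr_def compose_mor_assoc[OF \<phi>])
  qed
  then show ?thesis using P by (simp add: represents_def)
qed

lemma presheaf_on_plus: "presheaf_on C (plus C Cov F)"
  unfolding presheaf_on_def
proof (intro conjI ballI funcsetI)
  fix A B \<phi> s assume A: "A \<in> C" and B: "B \<in> C" "\<phi> \<in> mor A B" and s: "s \<in> sections (plus C Cov F) A"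
  obtain S x where Sx: "represents F A S x" "s = plus_class C Cov F A (S, x)"
    using s unfolding sections_plus by blast
  have \<phi>: "(B, \<phi>) \<in> arrows C A" using B by (simp add: arrows_def)
  show "restr (plus C Cov F) A B \<phi> s \<in> sections (plus C Cov F) B"
    unfolding Sx(2) restr_plus_class[OF A Sx(1) \<phi>]
    by (rule plus_class_section[OF represents_restr[OF A Sx(1) \<phi>]])
  fix D \<chi> assume D: "D \<in> C" "\<chi> \<in> mor B D"
  have \<chi>: "(D, \<chi>) \<in> arrows C B" using D by (simp add: arrows_def)
  have "(E, compose (carrier B) \<psi> \<chi>) \<in> arrows C B" if "(E, \<psi>) \<in> arrows C D" for E \<psi>
    using arrows_compose[OF B(1) \<chi> that] .
  then have *: "pullback_sieve C A D (compose (carrier A) \<chi> \<phi>) S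
        = pullback_sieve C B D \<chi> (pullback_sieve C A B \<phi> S)"
    by (auto simp: pullback_sieve_def compose_mor_assoc[OF B(2)])
  have "family_restr A D (compose (carrier A) \<chi> \<phi>) S x
      = family_restr B D \<chi> (pullback_sieve C A B \<phi> S) (family_restr A B \<phi> S x)"
    unfolding family_restr_def *
    by (auto simp: fun_eq_iff restrict_def pullback_sieve_def compose_mor_assoc[OF B(2)])
  then show "restr (plus C Cov F) A D (compose (carrier A) \<chi> \<phi>) s
     = restr (plus C Cov F) B D \<chi> (restr (plus C Cov F) A B \<phi> s)"
    unfolding Sx(2) restr_plus_class[OF A Sx(1) \<phi>]
      restr_plus_class[OF A Sx(1) arrows_compose[OF A \<phi> \<chi>]]
      restr_plus_class[OF B(1) represents_restr[OF A Sx(1) \<phi>] \<chi>] * by simp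
qed

lemma represents_map:
  assumes "presheaf_morphism C F G \<eta>" "represents F A S x"
  shows "represents G A S (\<lambda>k\<in>S. \<eta> (fst k) (x k))"
proof -
  have S: "covering_sieve C Cov A S" and x: "matching_family C F A S x"
    using assms(2) by (auto simp: represents_def)
  have "matching_family C G A S (\<lambda>k\<in>S. \<eta> (fst k) (x k))"
  proof (rule matching_familyI)
    fix B \<phi> assume b: "(B, \<phi>) \<in> S"
    have B: "B \<in> C" using subsetD[OF sieve_arrows[OF S] b] by (simp add: arrows_def)
    note xb = matching_familyD[OF x b]
    show "(\<lambda>k\<in>S. \<eta> (fst k) (x k)) (B, \<phi>) \<in> sections G B"
      using presheaf_morphismD(1)[OF assms(1) B xb(1)] b by simp
    fix D \<chi> assume d: "(D, \<chi>) \<in> arrows C B"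
    show "restr G B D \<chi> ((\<lambda>k\<in>S. \<eta> (fst k) (x k)) (B, \<phi>))
        = (\<lambda>k\<in>S. \<eta> (fst k) (x k)) (D, compose (carrier A) \<chi> \<phi>)"
      using presheaf_morphismD(2)[OF assms(1) B xb(1) d] xb(2)[OF d] b sieve_compose[OF S b d] by simp
  qed simp
  then show ?thesis using S by (simp add: represents_def)
qed

lemma presheaf_morphism_plus:
  assumes "presheaf_morphism C F G \<eta>"
  shows "presheaf_morphism C (plus C Cov F) (plus C Cov G) (plus_map C Cov G \<eta>)"
  unfolding presheaf_morphism_def
proof (intro conjI ballI funcsetI)
  fix A s assume A: "A \<in> C" and s: "s \<in> sections (plus C Cov F) A"
  obtain S x where Sx: "represents F A S x" "s = plus_class C Cov F A (S, x)"
    using s unfolding sections_plus by blast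
  show "plus_map C Cov G \<eta> A s \<in> sections (plus C Cov G) A"
    unfolding Sx(2) plus_map_class[OF A Sx(1)]
    by (rule plus_class_section[OF represents_map[OF assms Sx(1)]])
  fix B \<phi> assume B: "B \<in> C" "\<phi> \<in> mor A B"
  have \<phi>: "(B, \<phi>) \<in> arrows C A" using B by (simp add: arrows_def)
  have "(\<lambda>k\<in>pullback_sieve C A B \<phi> S. \<eta> (fst k) (family_restr A B \<phi> S x k))
      = family_restr A B \<phi> S (\<lambda>k\<in>S. \<eta> (fst k) (x k))"
    by (auto simp: family_restr_def fun_eq_iff pullback_sieve_def restrict_def)
  then show "plus_map C Cov G \<eta> B (restr (plus C Cov F) A B \<phi> s)
    = restr (plus C Cov G) A B \<phi> (plus_map C Cov G \<eta> A s)"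
    unfolding Sx(2) plus_map_class[OF A Sx(1)] restr_plus_class[OF A Sx(1) \<phi>]
      restr_plus_class[OF A represents_map[OF assms Sx(1)] \<phi>]
      plus_map_class[OF B(1) represents_restr[OF A Sx(1) \<phi>]] by simp
qed

text \<open>The canonical map from F to F^+: a section goes to the class of its restrictions, taken
  as a family on the maximal sieve.\<close>

definition plus_unit where
  "plus_unit F A s = plus_class C Cov F A (arrows C A, \<lambda>(B, \<phi>)\<in>arrows C A. restr F A B \<phi> s)"

lemma represents_unit:
  assumes "presheaf_on C F" "A \<in> C" "s \<in> sections F A"
  shows "represents F A (arrows C A) (\<lambda>(B, \<phi>)\<in>arrows C A. restr F A B \<phi> s)"
proof -
  have "matching_family C F A (arrows C A) (\<lambda>(B, \<phi>)\<in>arrows C A. restr F A B \<phi> s)"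
    using presheaf_onD[OF assms] arrows_compose[OF assms(2)] by (intro matching_familyI) auto
  then show ?thesis using covering_sieve_arrows[OF assms(2)] by (simp add: represents_def)
qed

lemma plus_unit_section:
  "presheaf_on C F \<Longrightarrow> A \<in> C \<Longrightarrow> s \<in> sections F A \<Longrightarrow> plus_unit F A s \<in> sections (plus C Cov F) A"
  unfolding plus_unit_def by (intro plus_class_section represents_unit)

lemma plus_map_unit:
  assumes "presheaf_on C F" "presheaf_morphism C F G \<eta>" "A \<in> C" "s \<in> sections F A"
  shows "plus_map C Cov G \<eta> A (plus_unit F A s) = plus_unit G A (\<eta> A s)"
proof -
  have "(\<lambda>k\<in>arrows C A. \<eta> (fst k) ((\<lambda>(B, \<phi>)\<in>arrows C A. restr F A B \<phi> s) k))
      = (\<lambda>(B, \<phi>)\<in>arrows C A. restr G A B \<phi> (\<eta> A s))"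
    using presheaf_morphismD(2)[OF assms(2-4)] by (auto simp: restrict_def fun_eq_iff)
  then show ?thesis
    unfolding plus_unit_def plus_map_class[OF assms(3) represents_unit[OF assms(1,3,4)]] by simp
qed

text \<open>Along a member of \<open>S\<close> the pullback sieve is maximal, and matching says that
  the pulled back family consists of the restrictions of the single section
  \<open>x (B, \<phi>)\<close>. So every section of F^+ comes locally from F.\<close>

lemma restr_plus_unit:
  assumes "A \<in> C" "represents F A S x" "(B, \<phi>) \<in> S"
  shows "restr (plus C Cov F) A B \<phi> (plus_class C Cov F A (S, x)) = plus_unit F B (x (B, \<phi>))"
proof -
  have S: "covering_sieve C Cov A S" and x: "matching_family C F A S x"
    using assms(2) by (auto simp: represents_def)
  have \<phi>: "(B, \<phi>) \<in> arrows C A" using assms(3) sieve_arrows[OF S] by blast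
  have "(D, compose (carrier A) \<chi> \<phi>) \<in> S" if "(D, \<chi>) \<in> arrows C B" for D \<chi>
    using sieve_compose[OF S assms(3) that] .
  then have *: "pullback_sieve C A B \<phi> S = arrows C B" by (auto simp: pullback_sieve_def)
  have "family_restr A B \<phi> S x = (\<lambda>(D, \<chi>)\<in>arrows C B. restr F B D \<chi> (x (B, \<phi>)))"
    using matching_familyD(2)[OF x assms(3)]
    by (auto simp: family_restr_def restrict_def fun_eq_iff *)
  then show ?thesis unfolding restr_plus_class[OF assms(1,2) \<phi>] plus_unit_def * by simp
qed

lemma restr_plus_unit_arrow:
  assumes "presheaf_on C F" "A \<in> C" "s \<in> sections F A" "(B, \<phi>) \<in> arrows C A"
  shows "restr (plus C Cov F) A B \<phi> (plus_unit F A s) = plus_unit F B (restr F A B \<phi> s)"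
  using restr_plus_unit[OF assms(2) represents_unit[OF assms(1-3)] assms(4)] assms(4)
  by (simp add: plus_unit_def)

text \<open>On a cover inside its sieve, a section of G^+ becomes the image of sections of G; on a
  further cover these lift to F. The composite cover carries the lift, which is the canonical image
  in F^+ of the lift in F, by naturality of \<open>plus_unit\<close>.\<close>

lemma sheaf_surjection_plus:
  assumes F: "presheaf_on C F" and G: "presheaf_on C G" and \<eta>: "presheaf_morphism C F G \<eta>"
    and surj: "sheaf_surjection C Cov F G \<eta>"
  shows "sheaf_surjection C Cov (plus C Cov F) (plus C Cov G) (plus_map C Cov G \<eta>)"
  unfolding sheaf_surjection_def
proof (intro ballI)
  fix A t assume A: "A \<in> C" and t: "t \<in> sections (plus C Cov G) A"
  obtain S x where Sx: "represents G A S x" "t = plus_class C Cov G A (S, x)"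
    using t unfolding sections_plus by blast
  have S: "covering_sieve C Cov A S" and x: "matching_family C G A S x"
    using Sx(1) by (auto simp: represents_def)
  obtain K where K: "K \<in> Cov A" "K \<subseteq> S" using S unfolding covering_sieve_def by blast
  have sec: "x (B, \<phi>) \<in> sections G B" "B \<in> C" "(B, \<phi>) \<in> arrows C A" if "(B, \<phi>) \<in> S" for B \<phi>
    using matching_familyD(1)[OF x that] subsetD[OF sieve_arrows[OF S] that] by (auto simp: arrows_def)
  have "\<forall>k\<in>K. \<exists>L. L \<in> Cov (fst k) \<and>
      (\<forall>(D, \<chi>)\<in>L. \<exists>s\<in>sections F D. \<eta> D s = restr G (fst k) D \<chi> (x k))"
  proof
    fix k assume "k \<in> K"
    then have "x (fst k, snd k) \<in> sections G (fst k)" "fst k \<in> C"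
      using sec[of "fst k" "snd k"] K(2) by auto
    then show "\<exists>L. L \<in> Cov (fst k) \<and>
      (\<forall>(D, \<chi>)\<in>L. \<exists>s\<in>sections F D. \<eta> D s = restr G (fst k) D \<chi> (x k))"
      using surj unfolding sheaf_surjection_def by simp blast
  qed
  from bchoice[OF this] obtain L where L': "\<forall>k\<in>K. L k \<in> Cov (fst k) \<and>
      (\<forall>(D, \<chi>)\<in>L k. \<exists>s\<in>sections F D. \<eta> D s = restr G (fst k) D \<chi> (x k))" by blast
  have L: "L (B, \<phi>) \<in> Cov B"
    "\<And>D \<chi>. (D, \<chi>) \<in> L (B, \<phi>) \<Longrightarrow> \<exists>s\<in>sections F D. \<eta> D s = restr G B D \<chi> (x (B, \<phi>))"
    if "(B, \<phi>) \<in> K" for B \<phi>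
    using bspec[OF L' that] by auto
  let ?M = "{(D, compose (carrier A) \<chi> \<phi>) | B \<phi> D \<chi>. (B, \<phi>) \<in> K \<and> (D, \<chi>) \<in> L (B, \<phi>)}"
  have M: "?M \<in> Cov A" by (rule cover_compose[OF A K(1) L(1)])
  have lift: "\<exists>s\<in>sections (plus C Cov F) D. plus_map C Cov G \<eta> D s
           = restr (plus C Cov G) A D (compose (carrier A) \<chi> \<phi>) t"
    if k: "(B, \<phi>) \<in> K" "(D, \<chi>) \<in> L (B, \<phi>)" for B \<phi> D \<chi>
  proof -
    have k': "(B, \<phi>) \<in> S" using subsetD[OF K(2) k(1)] .
    note sec = sec[OF k']
    have \<chi>: "(D, \<chi>) \<in> arrows C B" using cover_arrows[OF sec(2) L(1)[OF k(1)]] k(2) by (rule subsetD)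
    then have D: "D \<in> C" "\<chi> \<in> mor B D" "\<phi> \<in> mor A B" using sec(3) by (auto simp: arrows_def)
    obtain s where s: "s \<in> sections F D" "\<eta> D s = restr G B D \<chi> (x (B, \<phi>))"
      using L(2)[OF k] by blast
    have "restr (plus C Cov G) A D (compose (carrier A) \<chi> \<phi>) t
        = restr (plus C Cov G) B D \<chi> (restr (plus C Cov G) A B \<phi> t)"
      by (rule presheaf_onD(2)[OF presheaf_on_plus A t sec(3) \<chi>])
    also have "\<dots> = plus_unit G D (\<eta> D s)"
      unfolding Sx(2) restr_plus_unit[OF A Sx(1) k'] s(2)
      by (rule restr_plus_unit_arrow[OF G sec(2,1) \<chi>])
    also have "\<dots> = plus_map C Cov G \<eta> D (plus_unit F D s)"
      by (rule plus_map_unit[OF F \<eta> D(1) s(1), symmetric])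
    finally show ?thesis using plus_unit_section[OF F D(1) s(1)] by metis
  qed
  show "\<exists>K\<in>Cov A. \<forall>(B, \<phi>)\<in>K. \<exists>s\<in>sections (plus C Cov F) B.
      plus_map C Cov G \<eta> B s = restr (plus C Cov G) A B \<phi> t"
  proof (rule bexI[OF _ M], rule ballI)
    fix k assume "k \<in> ?M"
    then obtain B \<phi> D \<chi> where k: "k = (D, compose (carrier A) \<chi> \<phi>)" "(B, \<phi>) \<in> K" "(D, \<chi>) \<in> L (B, \<phi>)"
      by (elim CollectE exE conjE)
    show "case k of (B, \<phi>) \<Rightarrow> \<exists>s\<in>sections (plus C Cov F) B.
        plus_map C Cov G \<eta> B s = restr (plus C Cov G) A B \<phi> t"
      unfolding k(1) prod.case by (rule lift[OF k(2,3)])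
  qed
qed

text \<open>The passage from F to F^+ is made twice. The second round applies because F^+ is again a
  presheaf and the induced map again a morphism.\<close>

lemma sheaf_surjection_sheafification:
  assumes F: "presheaf_on C F" and G: "presheaf_on C G" and \<eta>: "presheaf_morphism C F G \<eta>"
    and surj: "sheaf_surjection C Cov F G \<eta>"
  shows "sheaf_surjection C Cov (sheafification C Cov F) (sheafification C Cov G)
           (sheafification_map C Cov G \<eta>)"
  unfolding sheafification_def sheafification_map_def
  by (intro sheaf_surjection_plus presheaf_on_plus presheaf_morphism_plus assms)

end

section \<open>The additive group of rational Witt vectors\<close>

definition witt_group :: "'u ring \<Rightarrow> (nat \<Rightarrow> 'u) monoid" where
  "witt_group A = \<lparr>carrier = witt_carrier A, monoid.mult = series_mult A,
     one = (\<lambda>n. if n = 0 then \<one>\<^bsub>A\<^esub> else \<zero>\<^bsub>A\<^esub>)\<rparr>"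

lemma add_monoid_witt_ring: "add_monoid (witt_ring A) = witt_group A"
  by (simp add: witt_ring_def witt_ring_with_def witt_group_def)

text \<open>The coefficients of 1/f for a series with constant term 1: the vanishing of the
  coefficient of T^(n+1) in f times 1/f is solved for the last unknown, whose factor is f 0 =
  1.\<close>

fun series_inverse :: "'u ring \<Rightarrow> (nat \<Rightarrow> 'u) \<Rightarrow> nat \<Rightarrow> 'u" where
  "series_inverse A f 0 = \<one>\<^bsub>A\<^esub>"
| "series_inverse A f (Suc n) = \<ominus>\<^bsub>A\<^esub> (\<Oplus>\<^bsub>A\<^esub>i\<in>{..n}. f (Suc i) \<otimes>\<^bsub>A\<^esub> series_inverse A f (n - i))"

text \<open>The sections and the map \<open>\<omega>\<close> involve only the additive group of \<open>W(A)\<close>, so nothing has to be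
  known about the chosen multiplication \<open>witt_mult\<close>.\<close>

definition rational_witt_group :: "'u ring \<Rightarrow> (nat \<Rightarrow> 'u) monoid" where
  "rational_witt_group A = add_monoid (rational_witt_ring A)"

definition unit_polynomials :: "'u ring \<Rightarrow> (nat \<Rightarrow> 'u) set" where
  "unit_polynomials A = {P \<in> carrier (UP A). P 0 = \<one>\<^bsub>A\<^esub>}"

section \<open>Power series with constant term one form an abelian group\<close>

context cring
begin

lemma series_mult_closed:
  "f \<in> UNIV \<rightarrow> carrier R \<Longrightarrow> g \<in> UNIV \<rightarrow> carrier R \<Longrightarrow>
     (\<Oplus>i\<in>{..n}. f i \<otimes> g (n - i)) \<in> carrier R"
  by (intro finsum_closed) auto

lemma series_mult_cong:
  fixes f f' g g' :: "nat \<Rightarrow> 'a"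
  assumes "\<And>i. i \<le> n \<Longrightarrow> f i = f' i" "\<And>i. i \<le> n \<Longrightarrow> g i = g' i"
    and "f' \<in> UNIV \<rightarrow> carrier R" "g' \<in> UNIV \<rightarrow> carrier R"
  shows "(\<Oplus>i\<in>{..n}. f i \<otimes> g (n - i)) = (\<Oplus>i\<in>{..n}. f' i \<otimes> g' (n - i))"
  using assms by (intro finsum_cong') (auto simp: Pi_iff)

end

context
  fixes A :: "'u ring"
  assumes A: "cring A"
begin

interpretation A: cring A by (rule A)

lemma series_truncate_up:
  assumes "f \<in> UNIV \<rightarrow> carrier A"
  shows "(\<lambda>i. if i \<le> n then f i else \<zero>\<^bsub>A\<^esub>) \<in> carrier (UP A)"
  using assms by (auto simp: UP_def up_def bound_def intro!: exI[of _ n])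

lemma UP_mult_series:
  "f \<in> carrier (UP A) \<Longrightarrow> g \<in> carrier (UP A) \<Longrightarrow> f \<otimes>\<^bsub>UP A\<^esub> g = series_mult A f g"
  unfolding UP_def series_mult_def by simp

lemma UP_carrier_fun: "f \<in> carrier (UP A) \<Longrightarrow> f \<in> UNIV \<rightarrow> carrier A"
  by (auto simp: UP_def up_def)

lemma one_unit_polynomial: "\<one>\<^bsub>witt_group A\<^esub> \<in> unit_polynomials A"
  unfolding unit_polynomials_def witt_group_def
  by (auto simp: UP_def up_def bound_def)

lemma teich_unit_polynomial: "a \<in> carrier A \<Longrightarrow> teich A a \<in> unit_polynomials A"
  unfolding unit_polynomials_def
  by (auto simp: UP_def up_def bound_def teich_def intro!: exI[of _ 1])

interpretation UP: UP_cring A "UP A" by (simp add: UP_cring_def A)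

text \<open>A coefficient of index k of a product involves only coefficients up to k, so it can be
  computed with truncations, that is, in \<open>UP A\<close>. Associativity and commutativity for
  power series are inherited from polynomials in this way.\<close>

lemma series_mult_truncate:
  assumes "f \<in> UNIV \<rightarrow> carrier A" "g \<in> UNIV \<rightarrow> carrier A" "k \<le> n"
  shows "series_mult A f g k = ((\<lambda>i. if i \<le> n then f i else \<zero>\<^bsub>A\<^esub>) \<otimes>\<^bsub>UP A\<^esub>
           (\<lambda>i. if i \<le> n then g i else \<zero>\<^bsub>A\<^esub>)) k"
  unfolding UP_mult_series[OF series_truncate_up[OF assms(1)] series_truncate_up[OF assms(2)]]
  unfolding series_mult_def using assms by (intro A.series_mult_cong) auto

lemma witt_carrier_fun: "f \<in> witt_carrier A \<Longrightarrow> f \<in> UNIV \<rightarrow> carrier A"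
  by (auto simp: witt_carrier_def)

lemma series_mult_fun:
  "f \<in> UNIV \<rightarrow> carrier A \<Longrightarrow> g \<in> UNIV \<rightarrow> carrier A \<Longrightarrow> series_mult A f g \<in> UNIV \<rightarrow> carrier A"
  unfolding series_mult_def using A.series_mult_closed by auto

lemma series_mult_assoc:
  assumes "f \<in> UNIV \<rightarrow> carrier A" "g \<in> UNIV \<rightarrow> carrier A" "h \<in> UNIV \<rightarrow> carrier A"
  shows "series_mult A (series_mult A f g) h = series_mult A f (series_mult A g h)"
proof
  fix n :: nat
  let ?t = "\<lambda>f i. if i \<le> n then f i else \<zero>\<^bsub>A\<^esub>"
  note tr = series_truncate_up[OF assms(1), of n] series_truncate_up[OF assms(2), of n]
    series_truncate_up[OF assms(3), of n]
  note tf = tr[THEN UP_carrier_fun]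
  note pr = UP.P.m_closed[OF tr(1,2), THEN UP_carrier_fun] UP.P.m_closed[OF tr(2,3), THEN UP_carrier_fun]
  have "series_mult A (series_mult A f g) h n = series_mult A (?t f \<otimes>\<^bsub>UP A\<^esub> ?t g) (?t h) n"
    unfolding series_mult_def[of A "series_mult A f g"] series_mult_def[of A "?t f \<otimes>\<^bsub>UP A\<^esub> ?t g"]
    by (rule A.series_mult_cong) (simp_all add: series_mult_truncate[OF assms(1,2)] pr tf)
  also have "\<dots> = ((?t f \<otimes>\<^bsub>UP A\<^esub> ?t g) \<otimes>\<^bsub>UP A\<^esub> ?t h) n"
    by (simp only: UP_mult_series[OF UP.P.m_closed[OF tr(1,2)] tr(3)])
  also have "\<dots> = (?t f \<otimes>\<^bsub>UP A\<^esub> (?t g \<otimes>\<^bsub>UP A\<^esub> ?t h)) n"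
    using UP.P.m_assoc[OF tr] by simp
  also have "\<dots> = series_mult A (?t f) (?t g \<otimes>\<^bsub>UP A\<^esub> ?t h) n"
    by (simp only: UP_mult_series[OF tr(1) UP.P.m_closed[OF tr(2,3)]])
  also have "\<dots> = series_mult A f (series_mult A g h) n"
    unfolding series_mult_def[of A f] series_mult_def[of A "?t f"]
    by (rule A.series_mult_cong[symmetric]) (simp_all add: series_mult_truncate[OF assms(2,3)] pr tf)
  finally show "series_mult A (series_mult A f g) h n = series_mult A f (series_mult A g h) n" .
qed

lemma series_mult_comm:
  assumes "f \<in> UNIV \<rightarrow> carrier A" "g \<in> UNIV \<rightarrow> carrier A"
  shows "series_mult A f g = series_mult A g f"
proof
  fix n show "series_mult A f g n = series_mult A g f n"
    unfolding series_mult_truncate[OF assms order_refl] series_mult_truncate[OF assms(2,1) order_refl]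
    by (rule arg_cong[where f = "\<lambda>h. h n"])
      (rule UP.P.m_comm[OF series_truncate_up[OF assms(1)] series_truncate_up[OF assms(2)]])
qed

lemma series_mult_one:
  assumes "f \<in> UNIV \<rightarrow> carrier A"
  shows "series_mult A (\<lambda>n. if n = 0 then \<one>\<^bsub>A\<^esub> else \<zero>\<^bsub>A\<^esub>) f = f"
proof
  fix n :: nat
  have "(\<Oplus>\<^bsub>A\<^esub>i\<in>{..n}. (if i = 0 then \<one>\<^bsub>A\<^esub> else \<zero>\<^bsub>A\<^esub>) \<otimes>\<^bsub>A\<^esub> f (n - i))
      = (\<Oplus>\<^bsub>A\<^esub>i\<in>{..n}. if 0 = i then f (n - i) else \<zero>\<^bsub>A\<^esub>)"
    using assms by (intro A.finsum_cong') (auto simp: Pi_iff)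
  also have "\<dots> = f n" using assms A.finsum_singleton[of 0 "{..n}" "\<lambda>i. f (n - i)"] by (auto simp: Pi_iff)
  finally show "series_mult A (\<lambda>n. if n = 0 then \<one>\<^bsub>A\<^esub> else \<zero>\<^bsub>A\<^esub>) f n = f n"
    by (simp add: series_mult_def)
qed

lemma series_inverse_fun:
  assumes "f \<in> UNIV \<rightarrow> carrier A"
  shows "series_inverse A f \<in> UNIV \<rightarrow> carrier A"
proof -
  have "series_inverse A f n \<in> carrier A" for n
  proof (induction n rule: less_induct)
    case (less n)
    show ?case
    proof (cases n)
      case (Suc m)
      have "(\<Oplus>\<^bsub>A\<^esub>i\<in>{..m}. f (Suc i) \<otimes>\<^bsub>A\<^esub> series_inverse A f (m - i)) \<in> carrier A"
        using less assms Suc by (intro A.finsum_closed) (auto simp: Pi_iff)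
      then show ?thesis using Suc by simp
    qed simp
  qed
  then show ?thesis by simp
qed

lemma series_mult_inverse:
  assumes "f \<in> witt_carrier A"
  shows "series_mult A f (series_inverse A f) = (\<lambda>n. if n = 0 then \<one>\<^bsub>A\<^esub> else \<zero>\<^bsub>A\<^esub>)"
proof
  fix n :: nat
  note f = witt_carrier_fun[OF assms] and g = series_inverse_fun[OF witt_carrier_fun[OF assms]]
  have f0: "f 0 = \<one>\<^bsub>A\<^esub>" using assms by (simp add: witt_carrier_def)
  show "series_mult A f (series_inverse A f) n = (if n = 0 then \<one>\<^bsub>A\<^esub> else \<zero>\<^bsub>A\<^esub>)"
  proof (cases n)
    case 0 then show ?thesis using f0 by (simp add: series_mult_def)
  next
    case (Suc m)
    have s: "(\<Oplus>\<^bsub>A\<^esub>i\<in>{..m}. f (Suc i) \<otimes>\<^bsub>A\<^esub> series_inverse A f (m - i)) \<in> carrier A"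
      using f g by (intro A.finsum_closed) (auto simp: Pi_iff)
    have "series_mult A f (series_inverse A f) n
        = (\<Oplus>\<^bsub>A\<^esub>i\<in>{..m}. f (Suc i) \<otimes>\<^bsub>A\<^esub> series_inverse A f (m - i)) \<oplus>\<^bsub>A\<^esub> series_inverse A f (Suc m)"
      unfolding series_mult_def Suc
      using A.finsum_Suc2[of "\<lambda>i. f i \<otimes>\<^bsub>A\<^esub> series_inverse A f (Suc m - i)" m] f g f0
      by (simp add: Pi_iff del: series_inverse.simps)
    then show ?thesis using s Suc by (simp add: A.r_neg)
  qed
qed

lemma witt_group_simps:
  "carrier (witt_group A) = witt_carrier A" "x \<otimes>\<^bsub>witt_group A\<^esub> y = series_mult A x y"
  "\<one>\<^bsub>witt_group A\<^esub> = (\<lambda>n. if n = 0 then \<one>\<^bsub>A\<^esub> else \<zero>\<^bsub>A\<^esub>)"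
  by (simp_all add: witt_group_def)

lemma series_mult_witt:
  assumes "f \<in> witt_carrier A" "g \<in> witt_carrier A"
  shows "series_mult A f g \<in> witt_carrier A"
  using series_mult_fun[OF witt_carrier_fun[OF assms(1)] witt_carrier_fun[OF assms(2)]] assms
  by (auto simp: witt_carrier_def series_mult_def Pi_iff)

lemma witt_group: "comm_group (witt_group A)"
proof (rule comm_groupI; unfold witt_group_simps)
  fix x assume x: "x \<in> witt_carrier A"
  have "series_inverse A x \<in> witt_carrier A"
    using series_inverse_fun[OF witt_carrier_fun[OF x]] by (auto simp: witt_carrier_def Pi_iff)
  then show "\<exists>y\<in>witt_carrier A. series_mult A y x = (\<lambda>n. if n = 0 then \<one>\<^bsub>A\<^esub> else \<zero>\<^bsub>A\<^esub>)"
    using series_mult_inverse[OF x] series_mult_comm witt_carrier_fun[OF x] witt_carrier_fun by metis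
next
  fix x y assume "x \<in> witt_carrier A" "y \<in> witt_carrier A"
  then show "series_mult A x y = series_mult A y x" by (intro series_mult_comm witt_carrier_fun)
next
  show "(\<lambda>n. if n = 0 then \<one>\<^bsub>A\<^esub> else \<zero>\<^bsub>A\<^esub>) \<in> witt_carrier A" by (simp add: witt_carrier_def)
qed (simp_all add: series_mult_witt witt_carrier_fun series_mult_assoc series_mult_one)

text \<open>Subtraction in \<open>witt_ring A\<close> unfolds to the inverse in its additive monoid,
  which is \<open>witt_group A\<close>; the chosen multiplication disappears from the
  description.\<close>

lemma rational_witt_group_eq:
  "rational_witt_group A = (witt_group A)\<lparr>carrier :=
     {P \<otimes>\<^bsub>witt_group A\<^esub> inv\<^bsub>witt_group A\<^esub> Q | P Q. P \<in> unit_polynomials A \<and> Q \<in> unit_polynomials A}\<rparr>"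
proof -
  have 1: "P \<ominus>\<^bsub>witt_ring A\<^esub> Q = P \<otimes>\<^bsub>witt_group A\<^esub> inv\<^bsub>witt_group A\<^esub> Q" for P Q
    unfolding a_minus_def a_inv_def add_monoid_witt_ring
    by (simp add: witt_ring_def witt_ring_with_def witt_group_def)
  have 2: "{P \<ominus>\<^bsub>witt_ring A\<^esub> Q | P Q. P \<in> carrier (UP A) \<and> Q \<in> carrier (UP A) \<and>
       P 0 = \<one>\<^bsub>A\<^esub> \<and> Q 0 = \<one>\<^bsub>A\<^esub>} =
     {P \<otimes>\<^bsub>witt_group A\<^esub> inv\<^bsub>witt_group A\<^esub> Q | P Q. P \<in> unit_polynomials A \<and> Q \<in> unit_polynomials A}"
    unfolding 1 unit_polynomials_def by (intro Collect_cong) auto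
  show ?thesis unfolding rational_witt_group_def rational_witt_ring_def 2
    using add_monoid_witt_ring[of A] by (simp add: witt_group_def)
qed

lemma unit_polynomials_mult:
  assumes "P \<in> unit_polynomials A" "Q \<in> unit_polynomials A"
  shows "P \<otimes>\<^bsub>witt_group A\<^esub> Q \<in> unit_polynomials A"
  using assms UP.P.m_closed[of P Q] UP_mult_series[of P Q]
  unfolding unit_polynomials_def by (auto simp: witt_group_simps series_mult_def)

lemma unit_polynomials_witt: "unit_polynomials A \<subseteq> carrier (witt_group A)"
  unfolding unit_polynomials_def witt_group_simps
  using UP_carrier_fun by (auto simp: witt_carrier_def Pi_iff)

text \<open>The unit polynomials are closed under products, and in an abelian group the quotients of
  elements of a submonoid form a subgroup.\<close>

lemma rational_witt_subgroup: "subgroup (carrier (rational_witt_group A)) (witt_group A)"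
proof -
  interpret W: comm_group "witt_group A" by (rule witt_group)
  note cl = subsetD[OF unit_polynomials_witt]
  define H where "H = {P \<otimes>\<^bsub>witt_group A\<^esub> inv\<^bsub>witt_group A\<^esub> Q | P Q. P \<in> unit_polynomials A \<and> Q \<in> unit_polynomials A}"
  have HI: "P \<otimes>\<^bsub>witt_group A\<^esub> inv\<^bsub>witt_group A\<^esub> Q \<in> H"
    if "P \<in> unit_polynomials A" "Q \<in> unit_polynomials A" for P Q
    unfolding H_def using that by blast
  have HE: "\<exists>P Q. x = P \<otimes>\<^bsub>witt_group A\<^esub> inv\<^bsub>witt_group A\<^esub> Q \<and> P \<in> unit_polynomials A \<and>
      Q \<in> unit_polynomials A" if "x \<in> H" for x using that unfolding H_def by blast
  have "subgroup H (witt_group A)"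
  proof (rule W.subgroupI)
    show "H \<subseteq> carrier (witt_group A)" using HE cl by fastforce
    show "H \<noteq> {}" using HI one_unit_polynomial by blast
    fix x assume "x \<in> H"
    then obtain P Q where x: "x = P \<otimes>\<^bsub>witt_group A\<^esub> inv\<^bsub>witt_group A\<^esub> Q"
      and PQ: "P \<in> unit_polynomials A" "Q \<in> unit_polynomials A" using HE by blast
    have "inv\<^bsub>witt_group A\<^esub> x = Q \<otimes>\<^bsub>witt_group A\<^esub> inv\<^bsub>witt_group A\<^esub> P"
      unfolding x using cl PQ by (simp add: W.inv_mult_group)
    then show "inv\<^bsub>witt_group A\<^esub> x \<in> H" using HI[OF PQ(2,1)] by simp
    fix y assume "y \<in> H"
    then obtain P' Q' where y: "y = P' \<otimes>\<^bsub>witt_group A\<^esub> inv\<^bsub>witt_group A\<^esub> Q'"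
      and PQ': "P' \<in> unit_polynomials A" "Q' \<in> unit_polynomials A" using HE by blast
    have "x \<otimes>\<^bsub>witt_group A\<^esub> y = (P \<otimes>\<^bsub>witt_group A\<^esub> P') \<otimes>\<^bsub>witt_group A\<^esub>
        inv\<^bsub>witt_group A\<^esub> (Q \<otimes>\<^bsub>witt_group A\<^esub> Q')"
      unfolding x y using cl PQ PQ' by (simp add: W.inv_mult W.m_ac)
    then show "x \<otimes>\<^bsub>witt_group A\<^esub> y \<in> H"
      using HI[OF unit_polynomials_mult unit_polynomials_mult, OF PQ(1) PQ'(1) PQ(2) PQ'(2)] by simp
  qed
  then show ?thesis unfolding rational_witt_group_eq H_def by simp
qed

lemma rational_witt_group: "comm_group (rational_witt_group A)"
proof -
  interpret W: comm_group "witt_group A" by (rule witt_group)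
  have "rational_witt_group A = (witt_group A)\<lparr>carrier := carrier (rational_witt_group A)\<rparr>"
    by (subst (1 2) rational_witt_group_eq) simp
  then have "group (rational_witt_group A)"
    using subgroup.subgroup_is_group[OF rational_witt_subgroup W.is_group] by simp
  moreover have "x \<otimes>\<^bsub>rational_witt_group A\<^esub> y = y \<otimes>\<^bsub>rational_witt_group A\<^esub> x"
    if "x \<in> carrier (rational_witt_group A)" "y \<in> carrier (rational_witt_group A)" for x y
    using that W.m_comm subgroup.subset[OF rational_witt_subgroup]
    by (subst (1 2) rational_witt_group_eq) auto
  ultimately show ?thesis by (simp add: group.group_comm_groupI)
qed

lemma rational_witt_mult: "x \<otimes>\<^bsub>rational_witt_group A\<^esub> y = series_mult A x y"
  by (subst rational_witt_group_eq) (simp add: witt_group_def)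

lemma unit_polynomial_rational: "unit_polynomials A \<subseteq> carrier (rational_witt_group A)"
proof
  interpret W: comm_group "witt_group A" by (rule witt_group)
  fix P assume P: "P \<in> unit_polynomials A"
  have "P = P \<otimes>\<^bsub>witt_group A\<^esub> inv\<^bsub>witt_group A\<^esub> \<one>\<^bsub>witt_group A\<^esub>"
    using subsetD[OF unit_polynomials_witt P] by simp
  then show "P \<in> carrier (rational_witt_group A)"
    unfolding rational_witt_group_eq using P one_unit_polynomial
    by (simp del: W.inv_one) (rule exI[of _ P], rule exI[of _ "\<one>\<^bsub>witt_group A\<^esub>"], simp del: W.inv_one)
qed

text \<open>The inverse is now taken in the group of rational elements itself. It agrees with the
  inverse in the ambient group, so that later arguments never have to leave the smaller one.\<close>

lemma rational_witt_quotient: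
  assumes "f \<in> carrier (rational_witt_group A)"
  obtains P Q where "P \<in> unit_polynomials A" "Q \<in> unit_polynomials A"
    "f = P \<otimes>\<^bsub>rational_witt_group A\<^esub> inv\<^bsub>rational_witt_group A\<^esub> Q"
proof -
  interpret W: comm_group "witt_group A" by (rule witt_group)
  have eq: "rational_witt_group A = (witt_group A)\<lparr>carrier := carrier (rational_witt_group A)\<rparr>"
    by (subst (1 2) rational_witt_group_eq) simp
  obtain P Q where PQ: "P \<in> unit_polynomials A" "Q \<in> unit_polynomials A"
    "f = P \<otimes>\<^bsub>witt_group A\<^esub> inv\<^bsub>witt_group A\<^esub> Q"
    using assms unfolding rational_witt_group_eq by auto
  have "inv\<^bsub>rational_witt_group A\<^esub> Q = inv\<^bsub>witt_group A\<^esub> Q"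
    using W.m_inv_consistent[OF rational_witt_subgroup subsetD[OF unit_polynomial_rational PQ(2)]] eq by simp
  then show thesis using that[OF PQ(1,2)] PQ(3)
    by (simp add: rational_witt_mult witt_group_simps)
qed

end

lemma series_mult_hom:
  assumes "cring A" "cring B" "\<phi> \<in> ring_hom A B" "f \<in> UNIV \<rightarrow> carrier A" "g \<in> UNIV \<rightarrow> carrier A"
  shows "\<phi> \<circ> series_mult A f g = series_mult B (\<phi> \<circ> f) (\<phi> \<circ> g)"
proof
  interpret h: ring_hom_cring A B \<phi>
    using assms by (simp add: ring_hom_cring_def ring_hom_cring_axioms_def)
  fix n :: nat
  have "\<phi> (\<Oplus>\<^bsub>A\<^esub>i\<in>{..n}. f i \<otimes>\<^bsub>A\<^esub> g (n - i)) = (\<Oplus>\<^bsub>B\<^esub>i\<in>{..n}. \<phi> (f i \<otimes>\<^bsub>A\<^esub> g (n - i)))"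
    using assms(4,5) by (subst h.hom_finsum) (auto simp: Pi_iff o_def)
  also have "\<dots> = (\<Oplus>\<^bsub>B\<^esub>i\<in>{..n}. \<phi> (f i) \<otimes>\<^bsub>B\<^esub> \<phi> (g (n - i)))"
    using assms(4,5) by (intro h.S.finsum_cong') (auto simp: Pi_iff)
  finally show "(\<phi> \<circ> series_mult A f g) n = series_mult B (\<phi> \<circ> f) (\<phi> \<circ> g) n"
    by (simp add: series_mult_def)
qed

lemma unit_polynomials_hom:
  assumes "cring A" "cring B" "\<phi> \<in> ring_hom A B" "P \<in> unit_polynomials A"
  shows "\<phi> \<circ> P \<in> unit_polynomials B"
proof -
  interpret h: ring_hom_cring A B \<phi>
    using assms by (simp add: ring_hom_cring_def ring_hom_cring_axioms_def)
  show ?thesis using assms(4) unfolding unit_polynomials_def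
    by (auto simp: UP_def up_def bound_def Pi_iff) (metis h.hom_zero)
qed


text \<open>That \<phi> \<circ> f is rational is read off from the equation f Q = P: applying \<phi>
  gives (\<phi> \<circ> f) (\<phi> \<circ> Q) = \<phi> \<circ> P, which is solved in the group W(B).
  No formula for the inverse series has to be transported.\<close>

lemma rational_witt_hom:
  assumes "cring A" "cring B" "\<phi> \<in> ring_hom A B"
  shows "(\<lambda>f. \<phi> \<circ> f) \<in> hom (rational_witt_group A) (rational_witt_group B)"
proof -
  interpret W: comm_group "witt_group A" by (rule witt_group[OF assms(1)])
  interpret V: comm_group "witt_group B" by (rule witt_group[OF assms(2)])
  interpret R: comm_group "rational_witt_group A" by (rule rational_witt_group[OF assms(1)])
  interpret S: comm_group "rational_witt_group B" by (rule rational_witt_group[OF assms(2)])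
  have fn: "f \<in> UNIV \<rightarrow> carrier A" if "f \<in> carrier (rational_witt_group A)" for f
    using subsetD[OF subgroup.subset[OF rational_witt_subgroup[OF assms(1)]] that]
    by (auto simp: witt_group_def witt_carrier_def)
  have mult: "\<phi> \<circ> (f \<otimes>\<^bsub>rational_witt_group A\<^esub> g)
      = (\<phi> \<circ> f) \<otimes>\<^bsub>rational_witt_group B\<^esub> (\<phi> \<circ> g)"
    if "f \<in> carrier (rational_witt_group A)" "g \<in> carrier (rational_witt_group A)" for f g
    unfolding rational_witt_mult[OF assms(1)] rational_witt_mult[OF assms(2)]
    by (rule series_mult_hom[OF assms fn[OF that(1)] fn[OF that(2)]])
  have "\<phi> \<circ> f \<in> carrier (rational_witt_group B)" if f: "f \<in> carrier (rational_witt_group A)" for f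
  proof -
    obtain P Q where PQ: "P \<in> unit_polynomials A" "Q \<in> unit_polynomials A"
      "f = P \<otimes>\<^bsub>rational_witt_group A\<^esub> inv\<^bsub>rational_witt_group A\<^esub> Q"
      using rational_witt_quotient[OF assms(1) f] by metis
    note cl = subsetD[OF unit_polynomial_rational[OF assms(1)]]
    note cl' = subsetD[OF unit_polynomial_rational[OF assms(2)]]
    have fQ: "f \<otimes>\<^bsub>rational_witt_group A\<^esub> Q = P"
      unfolding PQ(3) using cl[OF PQ(1)] cl[OF PQ(2)] by (simp add: R.m_assoc)
    have P: "\<phi> \<circ> P \<in> carrier (rational_witt_group B)" and Q: "\<phi> \<circ> Q \<in> carrier (rational_witt_group B)"
      using cl' unit_polynomials_hom[OF assms] PQ by auto
    have "\<phi> \<circ> f \<in> witt_carrier B"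
      using subsetD[OF subgroup.subset[OF rational_witt_subgroup[OF assms(1)]] f] assms(3)
      by (auto simp: witt_group_def witt_carrier_def ring_hom_def)
    then have fW: "\<phi> \<circ> f \<in> carrier (witt_group B)" by (simp add: witt_group_def)
    have sub: "carrier (rational_witt_group B) \<subseteq> carrier (witt_group B)"
      using subgroup.subset[OF rational_witt_subgroup[OF assms(2)]] .
    have "(\<phi> \<circ> f) \<otimes>\<^bsub>witt_group B\<^esub> (\<phi> \<circ> Q) = \<phi> \<circ> P"
      using mult[OF f cl[OF PQ(2)]] fQ
      by (simp add: rational_witt_mult[OF assms(2)] witt_group_def)
    then have "\<phi> \<circ> f = (\<phi> \<circ> P) \<otimes>\<^bsub>witt_group B\<^esub> inv\<^bsub>witt_group B\<^esub> (\<phi> \<circ> Q)"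
      using fW subsetD[OF sub P] subsetD[OF sub Q] V.inv_solve_right by metis
    then show ?thesis
      using subgroup.m_closed[OF rational_witt_subgroup[OF assms(2)] P
          subgroup.m_inv_closed[OF rational_witt_subgroup[OF assms(2)] Q]] by simp
  qed
  then show ?thesis using mult by (auto simp: hom_def)
qed

section \<open>Integral combinations in an abelian group\<close>

context comm_group
begin

definition int_combination :: "('c \<Rightarrow> 'a) \<Rightarrow> ('c \<Rightarrow> int) \<Rightarrow> 'c set \<Rightarrow> 'a" where
  "int_combination t f V = (\<Otimes>a\<in>V. t a [^] f a)"

lemma int_combination_mono:
  assumes "finite Y" "V \<subseteq> Y" "\<And>a. a \<in> Y - V \<Longrightarrow> f a = 0 \<or> t a = \<one>" "t \<in> Y \<rightarrow> carrier G"
  shows "int_combination t f V = int_combination t f Y"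
  unfolding int_combination_def
proof (rule finprod_mono_neutral_cong_left[OF assms(1,2)])
  show "t i [^] f i = \<one>" if "i \<in> Y - V" for i using assms(3)[OF that] by auto
  show "(\<lambda>a. t a [^] f a) \<in> Y \<rightarrow> carrier G" using assms(4) by (auto simp: Pi_iff)
qed simp

lemma int_combination_closed:
  "t \<in> V \<rightarrow> carrier G \<Longrightarrow> int_combination t f V \<in> carrier G"
  unfolding int_combination_def by (intro finprod_closed) (auto simp: Pi_iff)

lemma int_combination_cong:
  assumes "t \<in> V \<rightarrow> carrier G" "\<And>a. a \<in> V \<Longrightarrow> f a = g a \<or> t a = \<one>"
  shows "int_combination t f V = int_combination t g V"
  unfolding int_combination_def
proof (rule finprod_cong')
  show "t i [^] f i = t i [^] g i" if "i \<in> V" for i using assms(2)[OF that] by auto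
qed (use assms in \<open>auto simp: Pi_iff\<close>)

lemma int_combination_add:
  assumes "t \<in> V \<rightarrow> carrier G"
  shows "int_combination t (\<lambda>a. f a + g a) V
         = int_combination t f V \<otimes> int_combination t g V"
proof -
  have "int_combination t (\<lambda>a. f a + g a) V = (\<Otimes>a\<in>V. t a [^] f a \<otimes> t a [^] g a)"
    unfolding int_combination_def using assms
    by (intro finprod_cong') (auto simp: Pi_iff int_pow_mult)
  also have "\<dots> = int_combination t f V \<otimes> int_combination t g V"
    unfolding int_combination_def using assms by (intro finprod_multf) (auto simp: Pi_iff)
  finally show ?thesis .
qed

lemma int_combination_single:
  assumes "finite V" "x \<in> V" "t \<in> V \<rightarrow> carrier G"
  shows "int_combination t (\<lambda>a. if x = a then k else 0) V = t x [^] k"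
proof -
  have "int_combination t (\<lambda>a. if x = a then k else 0) V
      = (\<Otimes>a\<in>V. if x = a then t a [^] k else \<one>)"
    unfolding int_combination_def using assms by (intro finprod_cong') (auto simp: Pi_iff)
  also have "\<dots> = t x [^] k"
    using finprod_singleton[OF assms(2,1), of "\<lambda>a. t a [^] k"] assms(3) by (auto simp: Pi_iff)
  finally show ?thesis .
qed

text \<open>Collecting the coefficients along the fibres of \<phi> amounts to relabelling the terms.
  In the induction on \<open>V\<close> a new index x changes the collected coefficient at \<phi> x
  only, by f x.\<close>

lemma int_combination_push:
  assumes "finite V" "finite Y" "\<phi> ` V \<subseteq> Y" "t \<in> Y \<rightarrow> carrier G"
  shows "int_combination t (\<lambda>b. \<Sum>a\<in>{a \<in> V. \<phi> a = b}. f a) Y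
         = int_combination (t \<circ> \<phi>) f V"
  using assms(1,3)
proof (induction V)
  case empty
  show ?case using int_combination_mono[OF assms(2), of "{}" "\<lambda>b. 0" t] assms(4)
    by (simp add: int_combination_def)
next
  case (insert x V)
  have tX: "t \<circ> \<phi> \<in> V \<rightarrow> carrier G" "t (\<phi> x) \<in> carrier G"
    using assms(4) insert.prems by (auto simp: Pi_iff)
  have "(\<Sum>a\<in>{a \<in> insert x V. \<phi> a = b}. f a)
      = (\<Sum>a\<in>{a \<in> V. \<phi> a = b}. f a) + (if \<phi> x = b then f x else 0)" for b
  proof (cases "\<phi> x = b")
    case True
    then have "{a \<in> insert x V. \<phi> a = b} = insert x {a \<in> V. \<phi> a = b}" by auto
    then show ?thesis using insert.hyps True by simp
  next
    case False
    then have "{a \<in> insert x V. \<phi> a = b} = {a \<in> V. \<phi> a = b}" by auto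
    then show ?thesis using False by simp
  qed
  then have "int_combination t (\<lambda>b. \<Sum>a\<in>{a \<in> insert x V. \<phi> a = b}. f a) Y
      = int_combination (t \<circ> \<phi>) f V \<otimes> t (\<phi> x) [^] f x"
    using insert.IH insert.prems int_combination_single[OF assms(2) _ assms(4), of "\<phi> x" "f x"]
    by (simp add: int_combination_add[OF assms(4)] o_def)
  also have "\<dots> = int_combination (t \<circ> \<phi>) f (insert x V)"
    unfolding int_combination_def using insert.hyps tX
    by (subst finprod_insert) (auto simp: Pi_iff m_comm)
  finally show ?case .
qed

lemma int_combination_uminus:
  assumes "t \<in> V \<rightarrow> carrier G"
  shows "int_combination t (\<lambda>a. - f a) V = inv (int_combination t f V)"
proof -
  have "int_combination t f V \<otimes> int_combination t (\<lambda>a. - f a) V = \<one>"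
    using int_combination_add[OF assms, of f "\<lambda>a. - f a"] by (simp add: int_combination_def)
  then show ?thesis using int_combination_closed[OF assms]
    by (metis inv_equality m_comm)
qed

end

lemma hom_int_combination:
  assumes "comm_group G" "comm_group H" "h \<in> hom G H" "finite V" "t \<in> V \<rightarrow> carrier G"
  shows "h (comm_group.int_combination G t f V) = comm_group.int_combination H (h \<circ> t) f V"
proof -
  interpret G: comm_group G by fact
  interpret H: comm_group H by fact
  interpret h: group_hom G H h by (simp add: group_hom_def group_hom_axioms_def assms G.is_group H.is_group)
  show ?thesis using assms(4,5)
  proof (induction V)
    case empty then show ?case by (simp add: G.int_combination_def H.int_combination_def)
  next
    case (insert x V)
    have "h (G.int_combination t f (insert x V)) = h (t x [^]\<^bsub>G\<^esub> f x \<otimes>\<^bsub>G\<^esub> G.int_combination t f V)"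
      unfolding G.int_combination_def using insert by (subst G.finprod_insert) (auto simp: Pi_iff)
    also have "\<dots> = h (t x) [^]\<^bsub>H\<^esub> f x \<otimes>\<^bsub>H\<^esub> H.int_combination (h \<circ> t) f V"
      using insert G.int_combination_closed[of t V f] by (simp add: h.hom_int_pow o_def)
    also have "\<dots> = H.int_combination (h \<circ> t) f (insert x V)"
      unfolding H.int_combination_def using insert by (subst H.finprod_insert) (auto simp: Pi_iff)
    finally show ?case .
  qed
qed


section \<open>The map from the reduced monoid ring to rational Witt vectors\<close>

lemma carrier_monoid_ring:
  "f \<in> carrier (monoid_ring A) \<longleftrightarrow> finite {x. f x \<noteq> 0} \<and> (\<forall>x. x \<notin> carrier A \<longrightarrow> f x = 0)"
  by (simp add: monoid_ring_def monoid_algebra_def)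

lemma monoid_ring_add: "f \<oplus>\<^bsub>monoid_ring A\<^esub> g = (\<lambda>x. f x + g x)"
  by (simp add: monoid_ring_def monoid_algebra_def)

lemma support_subset_carrier:
  assumes "f \<in> carrier (monoid_ring A)" shows "{a \<in> carrier A. f a \<noteq> 0} = {a. f a \<noteq> 0}"
  using assms by (auto simp: carrier_monoid_ring)

text \<open>Since x 0 = 0 in \<open>A\<close>, multiplying by the basis element (0) collapses
  everything to the point 0. Conversely (0) (0) = (0), so a function supported at 0 is fixed by this
  multiplication and hence lies in the principal ideal. This identifies the ideal with Z(0).\<close>

lemma zero_ideal_eq:
  assumes "cring A"
  shows "zero_ideal A = {h \<in> carrier (monoid_ring A). \<forall>a. a \<noteq> \<zero>\<^bsub>A\<^esub> \<longrightarrow> h a = 0}"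
proof -
  interpret A: cring A by fact
  let ?e = "monomial \<Z> \<zero>\<^bsub>A\<^esub> (1::int)"
  have e: "?e y \<noteq> 0 \<longleftrightarrow> y = \<zero>\<^bsub>A\<^esub>" for y by (simp add: monomial_def)
  have mult: "(f \<otimes>\<^bsub>monoid_ring A\<^esub> ?e) z = (\<Sum>w\<in>{(x, y). x \<in> carrier A \<and> y \<in> carrier A \<and> f x \<noteq> 0 \<and>
      ?e y \<noteq> 0 \<and> x \<otimes>\<^bsub>A\<^esub> y = z}. f (fst w) * ?e (snd w))" for f z
    by (simp add: monoid_ring_def monoid_algebra_def int_finsum_eq)
  have off: "(f \<otimes>\<^bsub>monoid_ring A\<^esub> ?e) z = 0" if "z \<noteq> \<zero>\<^bsub>A\<^esub>" for f z
  proof -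
    have *: "{(x, y). x \<in> carrier A \<and> y \<in> carrier A \<and> f x \<noteq> 0 \<and> ?e y \<noteq> 0 \<and> x \<otimes>\<^bsub>A\<^esub> y = z} = {}"
      using that by (auto simp: e)
    show ?thesis unfolding mult * by simp
  qed
  have sup: "f \<otimes>\<^bsub>monoid_ring A\<^esub> ?e \<in> carrier (monoid_ring A)" for f
  proof -
    have "{x. (f \<otimes>\<^bsub>monoid_ring A\<^esub> ?e) x \<noteq> 0} \<subseteq> {\<zero>\<^bsub>A\<^esub>}" using off by blast
    then show ?thesis unfolding carrier_monoid_ring using off
      by (metis A.zero_closed finite.emptyI finite.insertI finite_subset)
  qed
  have id: "h \<otimes>\<^bsub>monoid_ring A\<^esub> ?e = h"
    if h: "h \<in> carrier (monoid_ring A)" "\<forall>a. a \<noteq> \<zero>\<^bsub>A\<^esub> \<longrightarrow> h a = 0" for h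
  proof
    fix z show "(h \<otimes>\<^bsub>monoid_ring A\<^esub> ?e) z = h z"
    proof (cases "z = \<zero>\<^bsub>A\<^esub>")
      case True
      have *: "{(x, y). x \<in> carrier A \<and> y \<in> carrier A \<and> h x \<noteq> 0 \<and> ?e y \<noteq> 0 \<and> x \<otimes>\<^bsub>A\<^esub> y = z}
          = (if h \<zero>\<^bsub>A\<^esub> = 0 then {} else {(\<zero>\<^bsub>A\<^esub>, \<zero>\<^bsub>A\<^esub>)})"
        using h(2) True by (cases "h \<zero>\<^bsub>A\<^esub> = 0") (auto simp: e, metis)
      show ?thesis unfolding mult * using True by (simp add: monomial_def)
    qed (use off h(2) in auto)
  qed
  show ?thesis unfolding zero_ideal_def cgenideal_def
  proof (intro subset_antisym subsetI)
    fix h assume "h \<in> {x \<otimes>\<^bsub>monoid_ring A\<^esub> ?e |x. x \<in> carrier (monoid_ring A)}"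
    then show "h \<in> {h \<in> carrier (monoid_ring A). \<forall>a. a \<noteq> \<zero>\<^bsub>A\<^esub> \<longrightarrow> h a = 0}" using off sup by auto
  next
    fix h assume "h \<in> {h \<in> carrier (monoid_ring A). \<forall>a. a \<noteq> \<zero>\<^bsub>A\<^esub> \<longrightarrow> h a = 0}"
    then show "h \<in> {x \<otimes>\<^bsub>monoid_ring A\<^esub> ?e |x. x \<in> carrier (monoid_ring A)}"
      using id[of h] by (intro CollectI exI[of _ h]) auto
  qed
qed

text \<open>The coset of \<open>f\<close> modulo Z(0), described without the ideal: the coefficient
  at 0 is forgotten and all others are kept.\<close>

definition reduced_class :: "'u ring \<Rightarrow> ('u \<Rightarrow> int) \<Rightarrow> ('u \<Rightarrow> int) set" where
  "reduced_class A f = {g \<in> carrier (monoid_ring A). \<forall>a. a \<noteq> \<zero>\<^bsub>A\<^esub> \<longrightarrow> g a = f a}"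

lemma zero_ideal_coset:
  assumes "cring A" "f \<in> carrier (monoid_ring A)"
  shows "zero_ideal A +>\<^bsub>monoid_ring A\<^esub> f = reduced_class A f"
proof -
  have "reduced_class A f \<subseteq> (\<Union>h\<in>zero_ideal A. {h \<oplus>\<^bsub>monoid_ring A\<^esub> f})"
  proof
    fix g assume g: "g \<in> reduced_class A f"
    have "{x. g x - f x \<noteq> 0} \<subseteq> {x. g x \<noteq> 0} \<union> {x. f x \<noteq> 0}" by auto
    then have "(\<lambda>x. g x - f x) \<in> carrier (monoid_ring A)"
      using g assms(2) unfolding reduced_class_def carrier_monoid_ring
      by (auto intro: finite_subset)
    then have "(\<lambda>x. g x - f x) \<in> zero_ideal A"
      using g unfolding zero_ideal_eq[OF assms(1)] reduced_class_def by auto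
    then show "g \<in> (\<Union>h\<in>zero_ideal A. {h \<oplus>\<^bsub>monoid_ring A\<^esub> f})"
      by (rule UN_I) (simp add: monoid_ring_add)
  qed
  moreover have "h \<oplus>\<^bsub>monoid_ring A\<^esub> f \<in> reduced_class A f" if "h \<in> zero_ideal A" for h
  proof -
    have "{x. h x + f x \<noteq> 0} \<subseteq> {x. h x \<noteq> 0} \<union> {x. f x \<noteq> 0}" by auto
    then show ?thesis using that assms(2)
      unfolding zero_ideal_eq[OF assms(1)] reduced_class_def carrier_monoid_ring monoid_ring_add
      by (auto intro: finite_subset)
  qed
  ultimately show ?thesis unfolding a_r_coset_def r_coset_def by auto
qed

lemma reduced_monoid_sections:
  assumes "cring A"
  shows "sections reduced_monoid_presheaf A = reduced_class A ` carrier (monoid_ring A)"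
proof -
  have "sections reduced_monoid_presheaf A
      = (\<lambda>f. zero_ideal A +>\<^bsub>monoid_ring A\<^esub> f) ` carrier (monoid_ring A)"
    unfolding reduced_monoid_presheaf_def reduced_monoid_ring_def FactRing_def A_RCOSETS_def
      RCOSETS_def a_r_coset_def by auto
  also have "\<dots> = reduced_class A ` carrier (monoid_ring A)"
    by (rule image_cong[OF refl]) (rule zero_ideal_coset[OF assms])
  finally show ?thesis .
qed

lemma monoid_ring_map_eq:
  assumes "f \<in> carrier (monoid_ring A)"
  shows "monoid_ring_map A B \<phi> f b = (\<Sum>a\<in>{a \<in> {a. f a \<noteq> 0}. \<phi> a = b}. f a)"
proof -
  have "{a. a \<in> carrier A \<and> f a \<noteq> 0 \<and> \<phi> a = b} = {a \<in> {a. f a \<noteq> 0}. \<phi> a = b}"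
    using assms by (auto simp: carrier_monoid_ring)
  then show ?thesis by (simp add: monoid_ring_map_def)
qed

lemma monoid_ring_map_support:
  assumes "f \<in> carrier (monoid_ring A)"
  shows "{b. monoid_ring_map A B \<phi> f b \<noteq> 0} \<subseteq> \<phi> ` {a. f a \<noteq> 0}"
proof -
  have "monoid_ring_map A B \<phi> f b = 0" if "b \<notin> \<phi> ` {a. f a \<noteq> 0}" for b
  proof -
    have "{a \<in> {a. f a \<noteq> 0}. \<phi> a = b} = {}" using that by auto
    then show ?thesis unfolding monoid_ring_map_eq[OF assms] by (simp only: sum.empty)
  qed
  then show ?thesis by blast
qed

lemma monoid_ring_map_closed:
  assumes "f \<in> carrier (monoid_ring A)" "\<phi> \<in> mor A B"
  shows "monoid_ring_map A B \<phi> f \<in> carrier (monoid_ring B)"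
proof -
  have "finite {a. f a \<noteq> 0}" and sub: "{a. f a \<noteq> 0} \<subseteq> carrier A"
    using assms(1) by (auto simp: carrier_monoid_ring)
  then have "finite {b. monoid_ring_map A B \<phi> f b \<noteq> 0}"
    using monoid_ring_map_support[OF assms(1)] by (meson finite_imageI finite_subset)
  moreover have "\<phi> ` {a. f a \<noteq> 0} \<subseteq> carrier B" using sub assms(2) by (auto simp: mor_def ring_hom_def)
  ultimately show ?thesis unfolding carrier_monoid_ring using monoid_ring_map_support[OF assms(1)] by blast
qed

lemma monoid_ring_map_compose:
  assumes "f \<in> carrier (monoid_ring A)" "\<phi> \<in> mor A B" "\<chi> \<in> mor B D"
  shows "monoid_ring_map A D (compose (carrier A) \<chi> \<phi>) f
       = monoid_ring_map B D \<chi> (monoid_ring_map A B \<phi> f)"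
proof
  fix d
  let ?S = "{a. f a \<noteq> 0}" and ?g = "monoid_ring_map A B \<phi> f"
  have fin: "finite ?S" and sub: "?S \<subseteq> carrier A" using assms(1) by (auto simp: carrier_monoid_ring)
  let ?T = "{b \<in> \<phi> ` ?S. \<chi> b = d}"
  have "monoid_ring_map B D \<chi> ?g d = (\<Sum>b\<in>{b \<in> {b. ?g b \<noteq> 0}. \<chi> b = d}. ?g b)"
    by (rule monoid_ring_map_eq[OF monoid_ring_map_closed[OF assms(1,2)]])
  also have "\<dots> = (\<Sum>b\<in>?T. ?g b)"
    using monoid_ring_map_support[OF assms(1), of B \<phi>] fin by (intro sum.mono_neutral_left) auto
  also have "\<dots> = (\<Sum>b\<in>?T. \<Sum>a\<in>{a \<in> {a \<in> ?S. \<chi> (\<phi> a) = d}. \<phi> a = b}. f a)"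
    unfolding monoid_ring_map_eq[OF assms(1)] by (intro sum.cong refl arg_cong2[where f = sum]) auto
  also have "\<dots> = (\<Sum>a\<in>{a \<in> ?S. \<chi> (\<phi> a) = d}. f a)"
    using fin by (intro sum.group) auto
  also have "\<dots> = monoid_ring_map A D (compose (carrier A) \<chi> \<phi>) f d"
    unfolding monoid_ring_map_eq[OF assms(1)] using sub
    by (intro sum.cong) (auto simp: compose_def)
  finally show "monoid_ring_map A D (compose (carrier A) \<chi> \<phi>) f d = monoid_ring_map B D \<chi> ?g d" ..
qed

lemma the_elem_image_const:
  assumes "x \<in> U" "\<And>y. y \<in> U \<Longrightarrow> h y = h x"
  shows "the_elem (h ` U) = h x"
proof -
  have "h ` U \<subseteq> {h x}" by (rule image_subsetI) (rule singleton_iff[THEN iffD2, OF assms(2)])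
  then have "h ` U = {h x}" using imageI[OF assms(1), of h] by blast
  then show ?thesis by simp
qed

lemma reduced_class_self: "f \<in> carrier (monoid_ring A) \<Longrightarrow> f \<in> reduced_class A f"
  by (simp add: reduced_class_def)

text \<open>Elements with nonzero image under \<phi> are themselves nonzero, so the forgotten
  coefficient at 0 can influence only the coefficient at 0 of the image, which is forgotten as
  well.\<close>

lemma restr_reduced_class:
  assumes "cring A" "cring B" "\<phi> \<in> mor A B" "f \<in> carrier (monoid_ring A)"
  shows "restr reduced_monoid_presheaf A B \<phi> (reduced_class A f)
         = reduced_class B (monoid_ring_map A B \<phi> f)"
proof -
  interpret h: ring_hom_cring A B \<phi>
    using assms by (simp add: ring_hom_cring_def ring_hom_cring_axioms_def mor_def)
  have "monoid_ring_map A B \<phi> g b = monoid_ring_map A B \<phi> f b"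
    if g: "g \<in> reduced_class A f" and b: "b \<noteq> \<zero>\<^bsub>B\<^esub>" for g b
  proof -
    have "a \<noteq> \<zero>\<^bsub>A\<^esub>" if "\<phi> a = b" for a using b that by auto
    then have "g a = f a" if "\<phi> a = b" for a
      using g that by (simp add: reduced_class_def)
    then show ?thesis unfolding monoid_ring_map_def by (intro sum.cong) auto
  qed
  then have "reduced_class B (monoid_ring_map A B \<phi> g) = reduced_class B (monoid_ring_map A B \<phi> f)"
    if "g \<in> reduced_class A f" for g
    using that unfolding reduced_class_def by (intro Collect_cong) auto
  moreover have "zero_ideal B +>\<^bsub>monoid_ring B\<^esub> monoid_ring_map A B \<phi> g
      = reduced_class B (monoid_ring_map A B \<phi> g)" if "g \<in> reduced_class A f" for g
    using that assms by (intro zero_ideal_coset monoid_ring_map_closed) (auto simp: reduced_class_def)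
  ultimately have h: "zero_ideal B +>\<^bsub>monoid_ring B\<^esub> monoid_ring_map A B \<phi> g
      = reduced_class B (monoid_ring_map A B \<phi> f)" if "g \<in> reduced_class A f" for g
    using that by (simp only:)
  note self = reduced_class_self[OF assms(4)]
  show ?thesis unfolding reduced_monoid_presheaf_def presheaf.simps
    by (subst the_elem_image_const[OF self], simp only: h h[OF self], rule h[OF self])
qed

lemma omega_lift_eq:
  assumes "cring A" "f \<in> carrier (monoid_ring A)" "finite V" "{a. f a \<noteq> 0} \<subseteq> V" "V \<subseteq> carrier A"
  shows "omega_lift A f = comm_group.int_combination (rational_witt_group A) (teich A) f V"
proof -
  interpret R: comm_group "rational_witt_group A" by (rule rational_witt_group[OF assms(1)])
  have t: "teich A \<in> V \<rightarrow> carrier (rational_witt_group A)"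
    using subsetD[OF unit_polynomial_rational[OF assms(1)] teich_unit_polynomial[OF assms(1)]] assms(5) by auto
  have "omega_lift A f = R.int_combination (teich A) f {a. f a \<noteq> 0}"
    unfolding omega_lift_def R.int_combination_def finsum_def add_pow_def
      support_subset_carrier[OF assms(2)] rational_witt_group_def[symmetric] ..
  also have "\<dots> = R.int_combination (teich A) f V"
    using assms(3,4) t by (intro R.int_combination_mono) auto
  finally show ?thesis .
qed

text \<open>The coefficient at 0 has no effect because [0] = 1 - 0 T = 1 is the neutral element. Two
  representatives of a class are compared over the union of their supports.\<close>

lemma omega_reduced_class:
  assumes "cring A" "f \<in> carrier (monoid_ring A)"
  shows "omega A (reduced_class A f) = omega_lift A f"
  unfolding omega_def
proof (rule the_elem_image_const[OF reduced_class_self[OF assms(2)]])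
  interpret A: cring A by fact
  interpret R: comm_group "rational_witt_group A" by (rule rational_witt_group[OF assms(1)])
  fix g assume g: "g \<in> reduced_class A f"
  then have gc: "g \<in> carrier (monoid_ring A)" by (simp add: reduced_class_def)
  let ?V = "{a. f a \<noteq> 0} \<union> {a. g a \<noteq> 0}"
  have V: "finite ?V" "?V \<subseteq> carrier A" using assms(2) gc by (auto simp: carrier_monoid_ring)
  have t: "teich A \<in> ?V \<rightarrow> carrier (rational_witt_group A)"
    using subsetD[OF unit_polynomial_rational[OF assms(1)] teich_unit_polynomial[OF assms(1)]] V(2) by auto
  have "teich A \<zero>\<^bsub>A\<^esub> = \<one>\<^bsub>rational_witt_group A\<^esub>"
    by (auto simp: rational_witt_group_eq[OF assms(1)] witt_group_def teich_def fun_eq_iff)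
  moreover have "g a = f a" if "a \<noteq> \<zero>\<^bsub>A\<^esub>" for a using g that by (simp add: reduced_class_def)
  ultimately have "g a = f a \<or> teich A a = \<one>\<^bsub>rational_witt_group A\<^esub>" for a
    by (cases "a = \<zero>\<^bsub>A\<^esub>") auto
  then have comb: "R.int_combination (teich A) g ?V = R.int_combination (teich A) f ?V"
    by (rule R.int_combination_cong[OF t])
  show "omega_lift A g = omega_lift A f"
    unfolding omega_lift_eq[OF assms(1) gc V(1) Un_upper2 V(2)]
      omega_lift_eq[OF assms(1,2) V(1) Un_upper1 V(2)] comb ..
qed

lemma teich_hom:
  assumes "cring A" "cring B" "\<phi> \<in> ring_hom A B" "a \<in> carrier A"
  shows "\<phi> \<circ> teich A a = teich B (\<phi> a)"
proof -
  interpret h: ring_hom_cring A B \<phi>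
    using assms by (simp add: ring_hom_cring_def ring_hom_cring_axioms_def)
  show ?thesis using assms(4) by (auto simp: teich_def fun_eq_iff)
qed

text \<open>Three facts are chained: a homomorphism commutes with integral combinations, \<phi>
  takes [a] to [\<phi> a], and a combination over pulled back terms equals the one with pushed
  forward coefficients.\<close>

lemma omega_lift_natural:
  assumes "cring A" "cring B" "\<phi> \<in> mor A B" "f \<in> carrier (monoid_ring A)"
  shows "\<phi> \<circ> omega_lift A f = omega_lift B (monoid_ring_map A B \<phi> f)"
proof -
  interpret R: comm_group "rational_witt_group A" by (rule rational_witt_group[OF assms(1)])
  interpret S: comm_group "rational_witt_group B" by (rule rational_witt_group[OF assms(2)])
  let ?V = "{a. f a \<noteq> 0}"
  have \<phi>: "\<phi> \<in> ring_hom A B" using assms(3) by (simp add: mor_def)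
  have V: "finite ?V" "?V \<subseteq> carrier A" using assms(4) by (auto simp: carrier_monoid_ring)
  have \<phi>V: "\<phi> ` ?V \<subseteq> carrier B" using V(2) \<phi> by (auto simp: ring_hom_def)
  have t: "teich A \<in> ?V \<rightarrow> carrier (rational_witt_group A)"
    "teich B \<in> \<phi> ` ?V \<rightarrow> carrier (rational_witt_group B)"
    "teich B \<circ> \<phi> \<in> ?V \<rightarrow> carrier (rational_witt_group B)"
    using subsetD[OF unit_polynomial_rational[OF assms(1)] teich_unit_polynomial[OF assms(1)]] V(2)
      subsetD[OF unit_polynomial_rational[OF assms(2)] teich_unit_polynomial[OF assms(2)]] \<phi>V by auto
  have "\<phi> \<circ> omega_lift A f = S.int_combination ((\<lambda>f. \<phi> \<circ> f) \<circ> teich A) f ?V"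
    using omega_lift_eq[OF assms(1,4) V(1) _ V(2)]
      hom_int_combination[OF R.comm_group_axioms S.comm_group_axioms
        rational_witt_hom[OF assms(1,2) \<phi>] V(1) t(1)] by simp
  also have "\<dots> = S.int_combination (teich B \<circ> \<phi>) f ?V"
    unfolding S.int_combination_def using teich_hom[OF assms(1,2) \<phi>] V(2) t(3)
    by (intro S.finprod_cong') (auto simp: Pi_iff)
  also have "\<dots> = S.int_combination (teich B) (monoid_ring_map A B \<phi> f) (\<phi> ` ?V)"
    unfolding monoid_ring_map_eq[OF assms(4)]
    by (rule S.int_combination_push[OF V(1) finite_imageI[OF V(1)] subset_refl t(2), symmetric])
  also have "\<dots> = omega_lift B (monoid_ring_map A B \<phi> f)"
    using omega_lift_eq[OF assms(2) monoid_ring_map_closed[OF assms(4,3)]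
        finite_imageI[OF V(1)] monoid_ring_map_support[OF assms(4)] \<phi>V] by simp
  finally show ?thesis .
qed

lemma sections_rational_witt:
  "sections rational_witt_presheaf A = carrier (rational_witt_group A)"
  by (simp add: rational_witt_presheaf_def rational_witt_group_def)

lemma restr_rational_witt: "restr rational_witt_presheaf A B \<phi> f = \<phi> \<circ> f"
  by (simp add: rational_witt_presheaf_def)

text \<open>The image of \<omega>. As addition of Witt vectors is multiplication of series, it
  consists of the finite products of integral powers of series 1 - aT.\<close>

definition teich_products :: "'u ring \<Rightarrow> (nat \<Rightarrow> 'u) set" where
  "teich_products A = omega_lift A ` carrier (monoid_ring A)"

context
  fixes A :: "'u ring"
  assumes A: "cring A"
begin

interpretation A: cring A by (rule A)
interpretation R: comm_group "rational_witt_group A" by (rule rational_witt_group[OF A])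

lemma teich_rational: "V \<subseteq> carrier A \<Longrightarrow> teich A \<in> V \<rightarrow> carrier (rational_witt_group A)"
  using subsetD[OF unit_polynomial_rational[OF A] teich_unit_polynomial[OF A]] by auto

lemma teich_products_rational: "teich_products A \<subseteq> carrier (rational_witt_group A)"
proof
  fix x assume "x \<in> teich_products A"
  then obtain f where f: "f \<in> carrier (monoid_ring A)" "x = omega_lift A f"
    by (auto simp: teich_products_def)
  have V: "finite {a. f a \<noteq> 0}" "{a. f a \<noteq> 0} \<subseteq> carrier A" using f(1) by (auto simp: carrier_monoid_ring)
  show "x \<in> carrier (rational_witt_group A)"
    unfolding f(2) omega_lift_eq[OF A f(1) V(1) subset_refl V(2)]
    by (rule R.int_combination_closed[OF teich_rational[OF V(2)]])
qed

lemma teich_in_teich_products: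
  assumes "a \<in> carrier A" shows "teich A a \<in> teich_products A"
proof -
  let ?f = "\<lambda>b. if a = b then (1::int) else 0"
  have V: "{a. ?f a \<noteq> 0} \<subseteq> {a}" "{a} \<subseteq> carrier A" using assms by auto
  have f: "?f \<in> carrier (monoid_ring A)"
    unfolding carrier_monoid_ring using assms by (auto intro: finite_subset[OF V(1)])
  have "omega_lift A ?f = teich A a [^]\<^bsub>rational_witt_group A\<^esub> (1::int)"
    unfolding omega_lift_eq[OF A f _ V(1) V(2), simplified]
    using R.int_combination_single[of "{a}" a "teich A" 1] teich_rational[OF V(2)] by simp
  then have "omega_lift A ?f = teich A a" using teich_rational[OF V(2)] by (simp add: R.int_pow_1)
  then show ?thesis unfolding teich_products_def using f by (metis imageI)
qed

lemma teich_products_closed: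
  assumes "x \<in> teich_products A" "y \<in> teich_products A"
  shows "x \<otimes>\<^bsub>rational_witt_group A\<^esub> y \<in> teich_products A"
    and "inv\<^bsub>rational_witt_group A\<^esub> y \<in> teich_products A"
proof -
  obtain f where f: "f \<in> carrier (monoid_ring A)" "x = omega_lift A f"
    using assms(1) by (auto simp: teich_products_def)
  obtain g where g: "g \<in> carrier (monoid_ring A)" "y = omega_lift A g"
    using assms(2) by (auto simp: teich_products_def)
  let ?V = "{a. f a \<noteq> 0} \<union> {a. g a \<noteq> 0}"
  have V: "finite ?V" "?V \<subseteq> carrier A" using f g by (auto simp: carrier_monoid_ring)
  have s: "{a. f a + g a \<noteq> 0} \<subseteq> ?V" "{a. - g a \<noteq> 0} \<subseteq> ?V" by auto
  have c: "(\<lambda>a. f a + g a) \<in> carrier (monoid_ring A)" "(\<lambda>a. - g a) \<in> carrier (monoid_ring A)"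
    using f(1) g(1) finite_subset[OF s(1) V(1)] unfolding carrier_monoid_ring by auto
  have "x \<otimes>\<^bsub>rational_witt_group A\<^esub> y = omega_lift A (\<lambda>a. f a + g a)"
    unfolding f(2) g(2) omega_lift_eq[OF A c(1) V(1) s(1) V(2)]
      R.int_combination_add[OF teich_rational[OF V(2)]]
    unfolding omega_lift_eq[OF A f(1) V(1) Un_upper1 V(2)] omega_lift_eq[OF A g(1) V(1) Un_upper2 V(2)] ..
  then show "x \<otimes>\<^bsub>rational_witt_group A\<^esub> y \<in> teich_products A"
    unfolding teich_products_def using c(1) by blast
  have "inv\<^bsub>rational_witt_group A\<^esub> y = omega_lift A (\<lambda>a. - g a)"
    unfolding g(2) omega_lift_eq[OF A c(2) V(1) s(2) V(2)]
      R.int_combination_uminus[OF teich_rational[OF V(2)]]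
    unfolding omega_lift_eq[OF A g(1) V(1) Un_upper2 V(2)] ..
  then show "inv\<^bsub>rational_witt_group A\<^esub> y \<in> teich_products A"
    unfolding teich_products_def using c(2) by blast
qed

end

lemma teich_products_hom:
  assumes "cring A" "cring B" "\<phi> \<in> mor A B" "x \<in> teich_products A"
  shows "\<phi> \<circ> x \<in> teich_products B"
  using assms(4) omega_lift_natural[OF assms(1-3)] monoid_ring_map_closed[OF _ assms(3)]
  unfolding teich_products_def by auto

section \<open>Monoid algebras\<close>

locale monoid_algebra_setup = R?: cring R + M: comm_monoid M
  for R (structure) and M
begin

abbreviation "Z \<equiv> monoid_algebra R M"

lemma carrier_iff:
  "f \<in> carrier Z \<longleftrightarrow> (\<forall>x. f x \<in> carrier R) \<and> finite {x. f x \<noteq> \<zero>} \<and> (\<forall>x. x \<notin> carrier M \<longrightarrow> f x = \<zero>)"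
  by (simp add: monoid_algebra_def)

lemma ring_operations:
  "f \<oplus>\<^bsub>Z\<^esub> g = (\<lambda>x. f x \<oplus> g x)" "\<zero>\<^bsub>Z\<^esub> = (\<lambda>x. \<zero>)" "\<one>\<^bsub>Z\<^esub> = monomial R \<one>\<^bsub>M\<^esub> \<one>"
  by (simp_all add: monoid_algebra_def monomial_def)

text \<open>The definition sums over the pairs in the two supports with product z. Here the
  condition moves into the summand, and any finite rectangle containing the supports may serve as
  index set; this allows different products to be compared term by term.\<close>

lemma mult_eq:
  assumes "f \<in> carrier Z" "g \<in> carrier Z" "finite S" "finite T" "S \<subseteq> carrier M" "T \<subseteq> carrier M"
    "{x. f x \<noteq> \<zero>} \<subseteq> S" "{x. g x \<noteq> \<zero>} \<subseteq> T"
  shows "(f \<otimes>\<^bsub>Z\<^esub> g) z = (\<Oplus>w\<in>S \<times> T. if fst w \<otimes>\<^bsub>M\<^esub> snd w = z then f (fst w) \<otimes> g (snd w) else \<zero>)"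
proof -
  have fg: "f x \<in> carrier R" "g x \<in> carrier R" for x using assms(1,2) by (auto simp: carrier_iff)
  let ?N = "{(x, y). x \<in> carrier M \<and> y \<in> carrier M \<and> f x \<noteq> \<zero> \<and> g y \<noteq> \<zero> \<and> x \<otimes>\<^bsub>M\<^esub> y = z}"
  have "(f \<otimes>\<^bsub>Z\<^esub> g) z = (\<Oplus>w\<in>?N. f (fst w) \<otimes> g (snd w))" by (simp add: monoid_algebra_def)
  also have "\<dots> = (\<Oplus>w\<in>S \<times> T. if fst w \<otimes>\<^bsub>M\<^esub> snd w = z then f (fst w) \<otimes> g (snd w) else \<zero>)"
  proof (rule R.add.finprod_mono_neutral_cong_left)
    show "finite (S \<times> T)" using assms by simp
    show "?N \<subseteq> S \<times> T" using assms(7,8) by auto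
    show "(if fst w \<otimes>\<^bsub>M\<^esub> snd w = z then f (fst w) \<otimes> g (snd w) else \<zero>) = \<zero>" if "w \<in> S \<times> T - ?N" for w
    proof -
      have "f (fst w) = \<zero> \<or> g (snd w) = \<zero> \<or> fst w \<otimes>\<^bsub>M\<^esub> snd w \<noteq> z" using that assms(5,6) by auto
      then show ?thesis using fg by auto
    qed
  qed (use fg in auto)
  finally show ?thesis .
qed

lemma mult_closed:
  assumes "f \<in> carrier Z" "g \<in> carrier Z" shows "f \<otimes>\<^bsub>Z\<^esub> g \<in> carrier Z"
proof -
  let ?S = "{x. f x \<noteq> \<zero>}" and ?T = "{x. g x \<noteq> \<zero>}"
  have fin: "finite ?S" "finite ?T" "?S \<subseteq> carrier M" "?T \<subseteq> carrier M"
    and fg: "f x \<in> carrier R" "g x \<in> carrier R" for x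
    using assms by (auto simp: carrier_iff)
  note eq = mult_eq[OF assms fin subset_refl subset_refl]
  have "(f \<otimes>\<^bsub>Z\<^esub> g) z \<in> carrier R" for z
    unfolding eq using fg by (intro R.finsum_closed) auto
  moreover have zero: "(f \<otimes>\<^bsub>Z\<^esub> g) z = \<zero>" if "z \<notin> (\<lambda>w. fst w \<otimes>\<^bsub>M\<^esub> snd w) ` (?S \<times> ?T)" for z
    unfolding eq using that by (intro R.add.finprod_one_eqI) auto
  then have "{z. (f \<otimes>\<^bsub>Z\<^esub> g) z \<noteq> \<zero>} \<subseteq> (\<lambda>w. fst w \<otimes>\<^bsub>M\<^esub> snd w) ` (?S \<times> ?T)" by blast
  then have "finite {z. (f \<otimes>\<^bsub>Z\<^esub> g) z \<noteq> \<zero>}" using fin(1,2) by (meson finite_SigmaI finite_imageI finite_subset)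
  moreover have "(\<lambda>w. fst w \<otimes>\<^bsub>M\<^esub> snd w) ` (?S \<times> ?T) \<subseteq> carrier M"
    using assms by (intro image_subsetI M.m_closed) (auto simp: carrier_iff)
  then have "(f \<otimes>\<^bsub>Z\<^esub> g) z = \<zero>" if "z \<notin> carrier M" for z using zero that by blast
  ultimately show ?thesis by (simp add: carrier_iff)
qed

lemma add_closed: "f \<in> carrier Z \<Longrightarrow> g \<in> carrier Z \<Longrightarrow> f \<oplus>\<^bsub>Z\<^esub> g \<in> carrier Z"
proof -
  assume fg: "f \<in> carrier Z" "g \<in> carrier Z"
  have "{x. f x \<oplus> g x \<noteq> \<zero>} \<subseteq> {x. f x \<noteq> \<zero>} \<union> {x. g x \<noteq> \<zero>}" by auto
  then have "finite {x. f x \<oplus> g x \<noteq> \<zero>}" using fg by (auto simp: carrier_iff intro: finite_subset)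
  then show ?thesis using fg by (auto simp: carrier_iff ring_operations)
qed

lemma monomial_closed: "m \<in> carrier M \<Longrightarrow> r \<in> carrier R \<Longrightarrow> monomial R m r \<in> carrier Z"
  by (auto simp: carrier_iff monomial_def intro: finite_subset[of _ "{m}"])

lemma abelian_group: "abelian_group Z"
proof (rule abelian_groupI)
  show "\<zero>\<^bsub>Z\<^esub> \<in> carrier Z" by (simp add: carrier_iff ring_operations)
  fix f assume f: "f \<in> carrier Z"
  then have fR: "f x \<in> carrier R" for x by (simp add: carrier_iff)
  show "\<zero>\<^bsub>Z\<^esub> \<oplus>\<^bsub>Z\<^esub> f = f" using fR by (simp add: ring_operations fun_eq_iff)
  have "{x. \<ominus> f x \<noteq> \<zero>} \<subseteq> {x. f x \<noteq> \<zero>}" by auto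
  then have "(\<lambda>x. \<ominus> f x) \<in> carrier Z" using f by (auto simp: carrier_iff intro: finite_subset)
  moreover have "(\<lambda>x. \<ominus> f x) \<oplus>\<^bsub>Z\<^esub> f = \<zero>\<^bsub>Z\<^esub>" using fR by (simp add: ring_operations fun_eq_iff R.l_neg)
  ultimately show "\<exists>g\<in>carrier Z. g \<oplus>\<^bsub>Z\<^esub> f = \<zero>\<^bsub>Z\<^esub>" by blast
next
  fix f g assume "f \<in> carrier Z" "g \<in> carrier Z"
  then show "f \<oplus>\<^bsub>Z\<^esub> g \<in> carrier Z" by (rule add_closed)
qed (auto simp: ring_operations carrier_iff fun_eq_iff R.a_assoc intro: R.a_comm)

lemma mult_add_left:
  assumes "f \<in> carrier Z" "g \<in> carrier Z" "h \<in> carrier Z"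
  shows "(f \<oplus>\<^bsub>Z\<^esub> g) \<otimes>\<^bsub>Z\<^esub> h = (f \<otimes>\<^bsub>Z\<^esub> h) \<oplus>\<^bsub>Z\<^esub> (g \<otimes>\<^bsub>Z\<^esub> h)"
proof
  fix z
  let ?S = "{x. f x \<noteq> \<zero>} \<union> {x. g x \<noteq> \<zero>}" and ?T = "{x. h x \<noteq> \<zero>}"
  have fin: "finite ?S" "finite ?T" "?S \<subseteq> carrier M" "?T \<subseteq> carrier M"
    and R: "f x \<in> carrier R" "g x \<in> carrier R" "h x \<in> carrier R" for x
    using assms by (auto simp: carrier_iff)
  have sub: "{x. (f \<oplus>\<^bsub>Z\<^esub> g) x \<noteq> \<zero>} \<subseteq> ?S" by (auto simp: ring_operations)
  note eq = mult_eq[OF add_closed[OF assms(1,2)] assms(3) fin sub subset_refl, of z]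
    mult_eq[OF assms(1,3) fin Un_upper1 subset_refl, of z] mult_eq[OF assms(2,3) fin Un_upper2 subset_refl, of z]
  have "((f \<oplus>\<^bsub>Z\<^esub> g) \<otimes>\<^bsub>Z\<^esub> h) z = (\<Oplus>w\<in>?S \<times> ?T.
      (if fst w \<otimes>\<^bsub>M\<^esub> snd w = z then f (fst w) \<otimes> h (snd w) else \<zero>) \<oplus>
      (if fst w \<otimes>\<^bsub>M\<^esub> snd w = z then g (fst w) \<otimes> h (snd w) else \<zero>))"
    unfolding eq(1) using R by (intro R.finsum_cong') (auto simp: ring_operations R.l_distr)
  also have "\<dots> = (f \<otimes>\<^bsub>Z\<^esub> h) z \<oplus> (g \<otimes>\<^bsub>Z\<^esub> h) z"
    unfolding eq(2,3) using R by (intro R.finsum_addf) auto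
  finally show "((f \<oplus>\<^bsub>Z\<^esub> g) \<otimes>\<^bsub>Z\<^esub> h) z = ((f \<otimes>\<^bsub>Z\<^esub> h) \<oplus>\<^bsub>Z\<^esub> (g \<otimes>\<^bsub>Z\<^esub> h)) z"
    by (simp add: ring_operations)
qed

lemma mult_commute:
  assumes "f \<in> carrier Z" "g \<in> carrier Z" shows "f \<otimes>\<^bsub>Z\<^esub> g = g \<otimes>\<^bsub>Z\<^esub> f"
proof
  fix z
  let ?S = "{x. f x \<noteq> \<zero>}" and ?T = "{x. g x \<noteq> \<zero>}"
  have fin: "finite ?S" "finite ?T" "?S \<subseteq> carrier M" "?T \<subseteq> carrier M"
    and R: "f x \<in> carrier R" "g x \<in> carrier R" for x using assms by (auto simp: carrier_iff)
  have "(\<Oplus>w\<in>?S \<times> ?T. if fst w \<otimes>\<^bsub>M\<^esub> snd w = z then f (fst w) \<otimes> g (snd w) else \<zero>)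
      = (\<Oplus>w\<in>prod.swap ` (?T \<times> ?S). if fst w \<otimes>\<^bsub>M\<^esub> snd w = z then f (fst w) \<otimes> g (snd w) else \<zero>)"
    by (simp only: product_swap)
  also have "\<dots> = (\<Oplus>w\<in>?T \<times> ?S. if fst (prod.swap w) \<otimes>\<^bsub>M\<^esub> snd (prod.swap w) = z
      then f (fst (prod.swap w)) \<otimes> g (snd (prod.swap w)) else \<zero>)"
    using R by (intro R.finsum_reindex) (auto simp: inj_on_def)
  also have "\<dots> = (\<Oplus>w\<in>?T \<times> ?S. if fst w \<otimes>\<^bsub>M\<^esub> snd w = z then g (fst w) \<otimes> f (snd w) else \<zero>)"
    using R fin(3,4) M.m_comm by (intro R.finsum_cong') (auto simp: R.m_comm subset_iff)
  finally show "(f \<otimes>\<^bsub>Z\<^esub> g) z = (g \<otimes>\<^bsub>Z\<^esub> f) z"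
    unfolding mult_eq[OF assms fin subset_refl subset_refl]
      mult_eq[OF assms(2,1) fin(2,1,4,3) subset_refl subset_refl] .
qed

lemma mult_add_right:
  assumes "f \<in> carrier Z" "g \<in> carrier Z" "h \<in> carrier Z"
  shows "h \<otimes>\<^bsub>Z\<^esub> (f \<oplus>\<^bsub>Z\<^esub> g) = (h \<otimes>\<^bsub>Z\<^esub> f) \<oplus>\<^bsub>Z\<^esub> (h \<otimes>\<^bsub>Z\<^esub> g)"
  using mult_add_left[OF assms] mult_commute assms add_closed by simp

lemma monomial_mult:
  assumes "x \<in> carrier M" "y \<in> carrier M" "r \<in> carrier R" "s \<in> carrier R"
  shows "monomial R x r \<otimes>\<^bsub>Z\<^esub> monomial R y s = monomial R (x \<otimes>\<^bsub>M\<^esub> y) (r \<otimes> s)"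
proof
  fix z
  show "(monomial R x r \<otimes>\<^bsub>Z\<^esub> monomial R y s) z = monomial R (x \<otimes>\<^bsub>M\<^esub> y) (r \<otimes> s) z"
    using assms
    by (subst mult_eq[OF monomial_closed monomial_closed, of x r y s "{x}" "{y}"])
      (auto simp: monomial_def)
qed

lemma monomial_add:
  "r \<in> carrier R \<Longrightarrow> s \<in> carrier R \<Longrightarrow> monomial R m r \<oplus>\<^bsub>Z\<^esub> monomial R m s = monomial R m (r \<oplus> s)"
  by (auto simp: ring_operations monomial_def)

lemma monomial_zero: "monomial R m \<zero> = \<zero>\<^bsub>Z\<^esub>"
  by (auto simp: ring_operations monomial_def)

text \<open>Induction on a finite set containing the support, splitting off the value at one point.
  The zero function is covered by the case of a monomial with coefficient 0.\<close>

lemma monomial_induct [consumes 1, case_names monomial add]: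
  assumes "f \<in> carrier Z"
    and "\<And>m r. m \<in> carrier M \<Longrightarrow> r \<in> carrier R \<Longrightarrow> P (monomial R m r)"
    and "\<And>f g. f \<in> carrier Z \<Longrightarrow> g \<in> carrier Z \<Longrightarrow> P f \<Longrightarrow> P g \<Longrightarrow> P (f \<oplus>\<^bsub>Z\<^esub> g)"
  shows "P f"
proof -
  have "\<forall>f\<in>carrier Z. {x. f x \<noteq> \<zero>} \<subseteq> S \<longrightarrow> P f" if "finite S" for S
    using that
  proof (induction S)
    case empty
    have "P (monomial R \<one>\<^bsub>M\<^esub> \<zero>)" using assms(2) by simp
    moreover have "f = monomial R \<one>\<^bsub>M\<^esub> \<zero>" if "{x. f x \<noteq> \<zero>} \<subseteq> {}" for f
      using that by (auto simp: monomial_def)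
    ultimately show ?case by metis
  next
    case (insert m S)
    show ?case
    proof (intro ballI impI)
      fix f assume f: "f \<in> carrier Z" "{x. f x \<noteq> \<zero>} \<subseteq> insert m S"
      let ?g = "f(m := \<zero>)"
      have "{x. ?g x \<noteq> \<zero>} \<subseteq> {x. f x \<noteq> \<zero>}" by auto
      then have g: "?g \<in> carrier Z" using f(1) by (auto simp: carrier_iff intro: finite_subset)
      have "{x. ?g x \<noteq> \<zero>} \<subseteq> S" using f(2) by auto
      then have Pg: "P ?g" using insert.IH g by blast
      show "P f"
      proof (cases "m \<in> carrier M")
        case True
        have fm: "f m \<in> carrier R" using f(1) by (simp add: carrier_iff)
        have "f = monomial R m (f m) \<oplus>\<^bsub>Z\<^esub> ?g"
          using f(1) by (auto simp: ring_operations monomial_def carrier_iff)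
        then show ?thesis using assms(3)[OF monomial_closed[OF True fm] g assms(2)[OF True fm] Pg] by simp
      next
        case False
        then have "?g = f" using f(1) by (auto simp: carrier_iff)
        then show ?thesis using Pg by simp
      qed
    qed
  qed
  then show ?thesis using assms(1) by (auto simp: carrier_iff)
qed

text \<open>Both sides are additive in each of the three factors, so associativity reduces to
  monomials, where it is that of \<open>M\<close> and of \<open>R\<close>.\<close>

lemma mult_assoc:
  assumes f: "f \<in> carrier Z" and g: "g \<in> carrier Z" and h: "h \<in> carrier Z"
  shows "(f \<otimes>\<^bsub>Z\<^esub> g) \<otimes>\<^bsub>Z\<^esub> h = f \<otimes>\<^bsub>Z\<^esub> (g \<otimes>\<^bsub>Z\<^esub> h)"
  using f
proof (induction rule: monomial_induct)
  case (monomial x r)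
  note x = monomial
  show ?case using g
  proof (induction rule: monomial_induct)
    case (monomial y s)
    note y = monomial
    show ?case using h
    proof (induction rule: monomial_induct)
      case (monomial z t)
      then show ?case using x y by (simp add: monomial_mult R.m_assoc M.m_assoc)
    next
      case (add h h')
      then show ?case using x y by (simp add: mult_add_right mult_closed monomial_closed)
    qed
  next
    case (add g g')
    then show ?case using x h by (simp add: mult_add_left mult_add_right mult_closed monomial_closed)
  qed
next
  case (add f f')
  then show ?case using g h by (simp add: mult_add_left mult_closed)
qed

lemma one_mult:
  assumes "f \<in> carrier Z" shows "\<one>\<^bsub>Z\<^esub> \<otimes>\<^bsub>Z\<^esub> f = f"
  using assms
proof (induction rule: monomial_induct)
  case (monomial m r)
  then show ?case by (simp add: ring_operations(3) monomial_mult)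
next
  case (add f g)
  then show ?case by (simp add: mult_add_right ring_operations(3) monomial_closed)
qed

lemma cring_monoid_algebra: "cring Z"
proof (rule cringI[OF abelian_group])
  show "comm_monoid Z"
    by (intro comm_monoidI mult_closed mult_assoc one_mult mult_commute) (simp_all add: ring_operations(3) monomial_closed)
qed (simp add: mult_add_left)

end

text \<open>The map given by the universal property of R[M]. With exponent vectors for
  \<open>M\<close> and powers of x for \<mu> it is evaluation of polynomials; with pairs (b, k) for
  \<open>M\<close> and products \<beta> b \<gamma> k for \<mu> it yields maps out of a tensor
  product of rings.\<close>

definition monoid_algebra_lift ::
    "('r, 'k) ring_scheme \<Rightarrow> ('s, 'l) ring_scheme \<Rightarrow> ('r \<Rightarrow> 's) \<Rightarrow> ('m \<Rightarrow> 's) \<Rightarrow> ('m \<Rightarrow> 'r) \<Rightarrow> 's" where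
  "monoid_algebra_lift R S \<phi> \<mu> f = (\<Oplus>\<^bsub>S\<^esub>x\<in>{x. f x \<noteq> \<zero>\<^bsub>R\<^esub>}. \<phi> (f x) \<otimes>\<^bsub>S\<^esub> \<mu> x)"

locale monoid_algebra_hom = monoid_algebra_setup R M + S: cring S
  for R (structure) and M and S +
  fixes \<phi> \<mu>
  assumes \<phi>: "\<phi> \<in> ring_hom R S"
    and \<mu>: "\<mu> \<in> carrier M \<rightarrow> carrier S"
    and \<mu>_one: "\<mu> \<one>\<^bsub>M\<^esub> = \<one>\<^bsub>S\<^esub>"
    and \<mu>_mult: "x \<in> carrier M \<Longrightarrow> y \<in> carrier M \<Longrightarrow> \<mu> (x \<otimes>\<^bsub>M\<^esub> y) = \<mu> x \<otimes>\<^bsub>S\<^esub> \<mu> y"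
begin

abbreviation "lift \<equiv> monoid_algebra_lift R S \<phi> \<mu>"

sublocale h: ring_hom_cring R S \<phi>
  using \<phi> R.is_cring S.is_cring by (simp add: ring_hom_cring_def ring_hom_cring_axioms_def)

lemma lift_eq:
  assumes "f \<in> carrier Z" "finite V" "V \<subseteq> carrier M" "{x. f x \<noteq> \<zero>} \<subseteq> V"
  shows "lift f = (\<Oplus>\<^bsub>S\<^esub>x\<in>V. \<phi> (f x) \<otimes>\<^bsub>S\<^esub> \<mu> x)"
  unfolding monoid_algebra_lift_def
proof (rule S.add.finprod_mono_neutral_cong_left[OF assms(2,4)])
  have fR: "f x \<in> carrier R" for x using assms(1) by (simp add: carrier_iff)
  show "\<phi> (f x) \<otimes>\<^bsub>S\<^esub> \<mu> x = \<zero>\<^bsub>S\<^esub>" if "x \<in> V - {x. f x \<noteq> \<zero>}" for x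
    using that funcset_mem[OF \<mu> subsetD[OF assms(3)]] by auto
  show "(\<lambda>x. \<phi> (f x) \<otimes>\<^bsub>S\<^esub> \<mu> x) \<in> V \<rightarrow> carrier S" using fR assms(3) \<mu> by auto
qed simp

lemma lift_closed: "f \<in> carrier Z \<Longrightarrow> lift f \<in> carrier S"
  unfolding monoid_algebra_lift_def using \<mu>
  by (intro S.finsum_closed) (auto simp: carrier_iff)

lemma lift_add:
  assumes "f \<in> carrier Z" "g \<in> carrier Z"
  shows "lift (f \<oplus>\<^bsub>Z\<^esub> g) = lift f \<oplus>\<^bsub>S\<^esub> lift g"
proof -
  let ?S = "{x. f x \<noteq> \<zero>} \<union> {x. g x \<noteq> \<zero>}"
  have fin: "finite ?S" "?S \<subseteq> carrier M" and R: "f x \<in> carrier R" "g x \<in> carrier R" for x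
    using assms by (auto simp: carrier_iff)
  have sub: "{x. (f \<oplus>\<^bsub>Z\<^esub> g) x \<noteq> \<zero>} \<subseteq> ?S" by (auto simp: ring_operations)
  have "lift (f \<oplus>\<^bsub>Z\<^esub> g) = (\<Oplus>\<^bsub>S\<^esub>x\<in>?S. \<phi> (f x) \<otimes>\<^bsub>S\<^esub> \<mu> x \<oplus>\<^bsub>S\<^esub> \<phi> (g x) \<otimes>\<^bsub>S\<^esub> \<mu> x)"
    unfolding lift_eq[OF add_closed[OF assms] fin sub] using R fin(2) \<mu>
    by (intro S.finsum_cong') (auto simp: ring_operations S.l_distr Pi_iff subset_iff)
  also have "\<dots> = lift f \<oplus>\<^bsub>S\<^esub> lift g"
    unfolding lift_eq[OF assms(1) fin Un_upper1] lift_eq[OF assms(2) fin Un_upper2]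
    using R fin(2) \<mu> by (intro S.finsum_addf) (auto simp: Pi_iff subset_iff)
  finally show ?thesis .
qed

lemma lift_monomial:
  assumes "m \<in> carrier M" "r \<in> carrier R" shows "lift (monomial R m r) = \<phi> r \<otimes>\<^bsub>S\<^esub> \<mu> m"
proof -
  have "lift (monomial R m r) = (\<Oplus>\<^bsub>S\<^esub>x\<in>{m}. \<phi> (monomial R m r x) \<otimes>\<^bsub>S\<^esub> \<mu> x)"
    using assms by (intro lift_eq monomial_closed) (auto simp: monomial_def)
  also have "\<dots> = \<phi> r \<otimes>\<^bsub>S\<^esub> \<mu> m"
    using assms \<mu> by (subst S.finsum_insert) (auto simp: monomial_def Pi_iff)
  finally show ?thesis .
qed

lemma lift_mult:
  assumes f: "f \<in> carrier Z" and g: "g \<in> carrier Z"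
  shows "lift (f \<otimes>\<^bsub>Z\<^esub> g) = lift f \<otimes>\<^bsub>S\<^esub> lift g"
  using f
proof (induction rule: monomial_induct)
  case (monomial x r)
  note x = monomial
  show ?case using g
  proof (induction rule: monomial_induct)
    case (monomial y s)
    have "\<mu> x \<in> carrier S" "\<mu> y \<in> carrier S" using x monomial \<mu> by auto
    then show ?case using x monomial by (simp add: monomial_mult lift_monomial \<mu>_mult S.m_ac)
  next
    case (add g g')
    then show ?case using x
      by (simp add: mult_add_right lift_add mult_closed monomial_closed lift_closed S.r_distr)
  qed
next
  case (add f f')
  then show ?case using g by (simp add: mult_add_left lift_add mult_closed lift_closed S.l_distr)
qed

lemma lift_hom: "lift \<in> ring_hom Z S"
  using lift_monomial[of "\<one>\<^bsub>M\<^esub>" \<one>]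
  by (intro ring_hom_memI) (simp_all add: lift_closed lift_add lift_mult ring_operations(3) \<mu>_one)

end

section \<open>Localisation at regular elements\<close>

text \<open>The localisations below are at \<open>{1}\<close> or at the nonzero elements of a domain, so equality of
  fractions needs no auxiliary factor.\<close>

locale regular_localization = R?: cring R for R (structure) +
  fixes S
  assumes S_subset: "S \<subseteq> carrier R" and one_S: "\<one> \<in> S"
    and mult_S: "s \<in> S \<Longrightarrow> t \<in> S \<Longrightarrow> s \<otimes> t \<in> S"
    and regular: "s \<in> S \<Longrightarrow> r \<in> carrier R \<Longrightarrow> s \<otimes> r = \<zero> \<Longrightarrow> r = \<zero>"
begin

abbreviation "L \<equiv> localization R S"
abbreviation "fr \<equiv> loc_frac R S"

lemma S_carrier [simp, intro]: "s \<in> S \<Longrightarrow> s \<in> carrier R"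
  using S_subset by auto

lemma cancel:
  assumes "s \<in> S" "x \<in> carrier R" "y \<in> carrier R" "s \<otimes> x = s \<otimes> y" shows "x = y"
proof -
  have "s \<otimes> (x \<ominus> y) = \<zero>" using assms by (simp add: R.r_distr R.minus_eq R.r_minus R.r_neg)
  then have "x \<ominus> y = \<zero>" using regular[OF assms(1)] assms by simp
  then show ?thesis using assms by simp
qed

lemma mem_frac:
  assumes "r \<in> carrier R" "s \<in> S"
  shows "(a, b) \<in> fr r s \<longleftrightarrow> a \<in> carrier R \<and> b \<in> S \<and> r \<otimes> b = a \<otimes> s"
proof -
  have "(\<exists>u\<in>S. u \<otimes> (r \<otimes> b \<ominus> a \<otimes> s) = \<zero>) \<longleftrightarrow> r \<otimes> b = a \<otimes> s" if "a \<in> carrier R" "b \<in> S"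
  proof
    assume "\<exists>u\<in>S. u \<otimes> (r \<otimes> b \<ominus> a \<otimes> s) = \<zero>"
    then obtain u where u: "u \<in> S" "u \<otimes> (r \<otimes> b \<ominus> a \<otimes> s) = \<zero>" ..
    have "r \<otimes> b \<ominus> a \<otimes> s = \<zero>" by (rule regular[OF u(1) _ u(2)]) (use assms that in simp)
    then show "r \<otimes> b = a \<otimes> s" using assms that by simp
  next
    assume "r \<otimes> b = a \<otimes> s"
    then have "\<one> \<otimes> (r \<otimes> b \<ominus> a \<otimes> s) = \<zero>" using assms that by (simp add: R.minus_eq R.r_neg)
    then show "\<exists>u\<in>S. u \<otimes> (r \<otimes> b \<ominus> a \<otimes> s) = \<zero>" using one_S by blast
  qed
  then show ?thesis unfolding loc_frac_def by auto
qed

lemma frac_eq_iff: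
  assumes "r \<in> carrier R" "s \<in> S" "r' \<in> carrier R" "s' \<in> S"
  shows "fr r s = fr r' s' \<longleftrightarrow> r \<otimes> s' = r' \<otimes> s"
proof
  assume "fr r s = fr r' s'"
  moreover have "(r', s') \<in> fr r' s'" using mem_frac assms by simp
  ultimately have "(r', s') \<in> fr r s" by simp
  then show "r \<otimes> s' = r' \<otimes> s" using mem_frac[OF assms(1,2)] by simp
next
  \<comment> \<open>Transitivity of equality of fractions: both sides agree after multiplication by
    s, and s is regular.\<close>
  have *: "r' \<otimes> b = a \<otimes> s'" if "r \<otimes> s' = r' \<otimes> s" "r \<otimes> b = a \<otimes> s" "a \<in> carrier R" "b \<in> S"
    "r \<in> carrier R" "s \<in> S" "r' \<in> carrier R" "s' \<in> S" for a b r s r' s'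
  proof (rule cancel[OF that(6)])
    have "s \<otimes> (r' \<otimes> b) = (r' \<otimes> s) \<otimes> b" using that by (simp add: R.m_ac)
    also have "\<dots> = (r \<otimes> b) \<otimes> s'" using that(1)[symmetric] that(3-) by (simp add: R.m_ac)
    also have "\<dots> = s \<otimes> (a \<otimes> s')" using that by (simp add: R.m_ac)
    finally show "s \<otimes> (r' \<otimes> b) = s \<otimes> (a \<otimes> s')" .
  qed (use that in auto)
  have sub: "fr r s \<subseteq> fr r' s'" if "r \<otimes> s' = r' \<otimes> s"
    "r \<in> carrier R" "s \<in> S" "r' \<in> carrier R" "s' \<in> S" for r s r' s'
  proof (rule subrelI)
    fix a b assume "(a, b) \<in> fr r s"
    then have ab: "a \<in> carrier R" "b \<in> S" "r \<otimes> b = a \<otimes> s" using mem_frac[OF that(2,3)] by auto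
    show "(a, b) \<in> fr r' s'"
      unfolding mem_frac[OF that(4,5)] using *[OF that(1) ab(3,1,2) that(2-5)] ab by simp
  qed
  assume eq: "r \<otimes> s' = r' \<otimes> s"
  show "fr r s = fr r' s'"
    by (rule subset_antisym) (rule sub[OF eq assms], rule sub[OF eq[symmetric] assms(3,4,1,2)])
qed

lemma frac_self: "r \<in> carrier R \<Longrightarrow> s \<in> S \<Longrightarrow> (r, s) \<in> fr r s"
  by (simp add: mem_frac)

lemma carrier_L: "carrier L = {fr r s | r s. r \<in> carrier R \<and> s \<in> S}"
  by (simp add: localization_def)

lemma frac_closed: "r \<in> carrier R \<Longrightarrow> s \<in> S \<Longrightarrow> fr r s \<in> carrier L"
  unfolding carrier_L by blast

lemma frac_cases:
  assumes "x \<in> carrier L"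
  obtains r s where "r \<in> carrier R" "s \<in> S" "x = fr r s"
  using assms unfolding carrier_L by blast

lemma frac_mult:
  assumes "r \<in> carrier R" "s \<in> S" "r' \<in> carrier R" "s' \<in> S"
  shows "fr r s \<otimes>\<^bsub>L\<^esub> fr r' s' = fr (r \<otimes> r') (s \<otimes> s')"
proof -
  have *: "fr (a \<otimes> a') (b \<otimes> b') = fr (r \<otimes> r') (s \<otimes> s')"
    if "(a, b) \<in> fr r s" "(a', b') \<in> fr r' s'" for a b a' b'
  proof -
    have ab: "a \<in> carrier R" "b \<in> S" "r \<otimes> b = a \<otimes> s" "a' \<in> carrier R" "b' \<in> S" "r' \<otimes> b' = a' \<otimes> s'"
      using that mem_frac assms by auto
    have "(a \<otimes> a') \<otimes> (s \<otimes> s') = (a \<otimes> s) \<otimes> (a' \<otimes> s')" using ab(1,2,4,5) assms by (simp add: R.m_ac)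
    also have "\<dots> = (r \<otimes> b) \<otimes> (r' \<otimes> b')" using ab by simp
    also have "\<dots> = (r \<otimes> r') \<otimes> (b \<otimes> b')" using ab(1,2,4,5) assms by (simp add: R.m_ac)
    finally show ?thesis using ab assms by (simp add: frac_eq_iff mult_S)
  qed
  have "{fr (a \<otimes> a') (b \<otimes> b') | a b a' b'. (a, b) \<in> fr r s \<and> (a', b') \<in> fr r' s'}
      = {fr (r \<otimes> r') (s \<otimes> s')}"
  (is "?F = _")
  proof (rule subset_antisym)
    show "?F \<subseteq> {fr (r \<otimes> r') (s \<otimes> s')}" by (intro subsetI) (elim CollectE exE conjE, simp add: *)
    show "{fr (r \<otimes> r') (s \<otimes> s')} \<subseteq> ?F" using frac_self[OF assms(1,2)] frac_self[OF assms(3,4)] by simp blast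
  qed
  then show ?thesis by (simp add: localization_def)
qed

lemma frac_add:
  assumes "r \<in> carrier R" "s \<in> S" "r' \<in> carrier R" "s' \<in> S"
  shows "fr r s \<oplus>\<^bsub>L\<^esub> fr r' s' = fr (r \<otimes> s' \<oplus> r' \<otimes> s) (s \<otimes> s')"
proof -
  have *: "fr (a \<otimes> b' \<oplus> a' \<otimes> b) (b \<otimes> b') = fr (r \<otimes> s' \<oplus> r' \<otimes> s) (s \<otimes> s')"
    if "(a, b) \<in> fr r s" "(a', b') \<in> fr r' s'" for a b a' b'
  proof -
    have ab: "a \<in> carrier R" "b \<in> S" "r \<otimes> b = a \<otimes> s" "a' \<in> carrier R" "b' \<in> S" "r' \<otimes> b' = a' \<otimes> s'"
      using that mem_frac assms by auto
    have "(a \<otimes> b' \<oplus> a' \<otimes> b) \<otimes> (s \<otimes> s') = (a \<otimes> s) \<otimes> (b' \<otimes> s') \<oplus> (a' \<otimes> s') \<otimes> (b \<otimes> s)"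
      using ab(1,2,4,5) assms by (simp add: R.m_ac R.l_distr R.r_distr)
    also have "\<dots> = (r \<otimes> b) \<otimes> (b' \<otimes> s') \<oplus> (r' \<otimes> b') \<otimes> (b \<otimes> s)" using ab by simp
    also have "\<dots> = (r \<otimes> s' \<oplus> r' \<otimes> s) \<otimes> (b \<otimes> b')"
      using ab(1,2,4,5) assms by (simp add: R.m_ac R.l_distr R.r_distr)
    finally show ?thesis using ab assms by (simp add: frac_eq_iff mult_S)
  qed
  have "{fr (a \<otimes> b' \<oplus> a' \<otimes> b) (b \<otimes> b') | a b a' b'. (a, b) \<in> fr r s \<and> (a', b') \<in> fr r' s'}
      = {fr (r \<otimes> s' \<oplus> r' \<otimes> s) (s \<otimes> s')}"
  (is "?F = _")
  proof (rule subset_antisym)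
    show "?F \<subseteq> {fr (r \<otimes> s' \<oplus> r' \<otimes> s) (s \<otimes> s')}" by (intro subsetI) (elim CollectE exE conjE, simp add: *)
    show "{fr (r \<otimes> s' \<oplus> r' \<otimes> s) (s \<otimes> s')} \<subseteq> ?F"
      using frac_self[OF assms(1,2)] frac_self[OF assms(3,4)] by simp blast
  qed
  then show ?thesis by (simp add: localization_def)
qed

lemma L_simps: "\<one>\<^bsub>L\<^esub> = fr \<one> \<one>" "\<zero>\<^bsub>L\<^esub> = fr \<zero> \<one>"
  by (simp_all add: localization_def)

lemma cring_L: "cring L"
proof (rule cringI)
  show "abelian_group L"
  proof (rule abelian_groupI)
    fix x y z assume "x \<in> carrier L" "y \<in> carrier L" "z \<in> carrier L"
    then obtain r s r' s' r'' s'' where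
      e: "r \<in> carrier R" "s \<in> S" "r' \<in> carrier R" "s' \<in> S" "r'' \<in> carrier R" "s'' \<in> S"
      and xyz: "x = fr r s" "y = fr r' s'" "z = fr r'' s''" by (metis frac_cases)
    show "x \<oplus>\<^bsub>L\<^esub> y \<oplus>\<^bsub>L\<^esub> z = x \<oplus>\<^bsub>L\<^esub> (y \<oplus>\<^bsub>L\<^esub> z)"
      using e unfolding xyz by (simp add: frac_add mult_S R.l_distr R.r_distr R.m_ac R.a_ac)
  next
    fix x y assume "x \<in> carrier L" "y \<in> carrier L"
    then obtain r s r' s' where e: "r \<in> carrier R" "s \<in> S" "r' \<in> carrier R" "s' \<in> S"
      and xy: "x = fr r s" "y = fr r' s'" by (metis frac_cases)
    show "x \<oplus>\<^bsub>L\<^esub> y \<in> carrier L" using e unfolding xy by (simp add: frac_add mult_S frac_closed)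
    show "x \<oplus>\<^bsub>L\<^esub> y = y \<oplus>\<^bsub>L\<^esub> x" using e unfolding xy by (simp add: frac_add R.a_comm R.m_comm)
  next
    show "\<zero>\<^bsub>L\<^esub> \<in> carrier L" using one_S by (simp add: L_simps frac_closed)
  next
    fix x assume "x \<in> carrier L"
    then obtain r s where e: "r \<in> carrier R" "s \<in> S" and x: "x = fr r s" by (metis frac_cases)
    show "\<zero>\<^bsub>L\<^esub> \<oplus>\<^bsub>L\<^esub> x = x" using e one_S unfolding x by (simp add: L_simps frac_add)
    have "fr (\<ominus> r) s \<oplus>\<^bsub>L\<^esub> x = \<zero>\<^bsub>L\<^esub>"
      using e one_S unfolding x by (simp add: L_simps frac_add frac_eq_iff mult_S R.l_minus R.l_neg)
    then show "\<exists>y\<in>carrier L. y \<oplus>\<^bsub>L\<^esub> x = \<zero>\<^bsub>L\<^esub>" using e frac_closed[of "\<ominus> r" s] by blast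
  qed
  show "comm_monoid L"
  proof (rule comm_monoidI)
    fix x y z assume "x \<in> carrier L" "y \<in> carrier L" "z \<in> carrier L"
    then obtain r s r' s' r'' s'' where
      e: "r \<in> carrier R" "s \<in> S" "r' \<in> carrier R" "s' \<in> S" "r'' \<in> carrier R" "s'' \<in> S"
      and xyz: "x = fr r s" "y = fr r' s'" "z = fr r'' s''" by (metis frac_cases)
    show "x \<otimes>\<^bsub>L\<^esub> y \<otimes>\<^bsub>L\<^esub> z = x \<otimes>\<^bsub>L\<^esub> (y \<otimes>\<^bsub>L\<^esub> z)"
      using e unfolding xyz by (simp add: frac_mult mult_S R.m_ac)
  next
    fix x y assume "x \<in> carrier L" "y \<in> carrier L"
    then obtain r s r' s' where e: "r \<in> carrier R" "s \<in> S" "r' \<in> carrier R" "s' \<in> S"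
      and xy: "x = fr r s" "y = fr r' s'" by (metis frac_cases)
    show "x \<otimes>\<^bsub>L\<^esub> y \<in> carrier L" using e unfolding xy by (simp add: frac_mult mult_S frac_closed)
    show "x \<otimes>\<^bsub>L\<^esub> y = y \<otimes>\<^bsub>L\<^esub> x" using e unfolding xy by (simp add: frac_mult R.m_comm)
  next
    show "\<one>\<^bsub>L\<^esub> \<in> carrier L" using one_S by (simp add: L_simps frac_closed)
  next
    fix x assume "x \<in> carrier L"
    then obtain r s where e: "r \<in> carrier R" "s \<in> S" and x: "x = fr r s" by (metis frac_cases)
    show "\<one>\<^bsub>L\<^esub> \<otimes>\<^bsub>L\<^esub> x = x" using e one_S unfolding x by (simp add: L_simps frac_mult)
  qed
  fix x y z assume "x \<in> carrier L" "y \<in> carrier L" "z \<in> carrier L"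
  then obtain r s r' s' r'' s'' where
    e: "r \<in> carrier R" "s \<in> S" "r' \<in> carrier R" "s' \<in> S" "r'' \<in> carrier R" "s'' \<in> S"
    and xyz: "x = fr r s" "y = fr r' s'" "z = fr r'' s''" by (metis frac_cases)
  show "(x \<oplus>\<^bsub>L\<^esub> y) \<otimes>\<^bsub>L\<^esub> z = x \<otimes>\<^bsub>L\<^esub> z \<oplus>\<^bsub>L\<^esub> y \<otimes>\<^bsub>L\<^esub> z"
    using e unfolding xyz by (simp add: frac_add frac_mult mult_S frac_eq_iff R.l_distr R.r_distr R.m_ac)
qed

lemma frac_one_hom: "(\<lambda>r. fr r \<one>) \<in> ring_hom R L"
  using one_S by (intro ring_hom_memI) (simp_all add: frac_closed frac_mult frac_add L_simps)

lemma frac_one_inj: "inj_on (\<lambda>r. fr r \<one>) (carrier R)"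
  using one_S by (auto simp: inj_on_def frac_eq_iff)

end

text \<open>Finite local freeness and complete intersection are conditions on some cover of the
  spectrum by basic open sets. For the algebras considered here they hold globally, so the cover
  D(1) serves, and localising at 1 gives an isomorphic ring.\<close>

lemma localization_at_one:
  assumes "cring R"
  shows "regular_localization R {\<one>\<^bsub>R\<^esub>}" "powers R \<one>\<^bsub>R\<^esub> = {\<one>\<^bsub>R\<^esub>}"
    "(\<lambda>r. loc_frac R {\<one>\<^bsub>R\<^esub>} r \<one>\<^bsub>R\<^esub>) \<in> ring_iso R (localization R {\<one>\<^bsub>R\<^esub>})"
    "\<And>r. r \<in> carrier R \<Longrightarrow> loc_frac R {\<one>\<^bsub>R\<^esub>} r \<one>\<^bsub>R\<^esub> = {(r, \<one>\<^bsub>R\<^esub>)}"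
proof -
  interpret cring R by fact
  show L: "regular_localization R {\<one>\<^bsub>R\<^esub>}" by unfold_locales auto
  show "powers R \<one>\<^bsub>R\<^esub> = {\<one>\<^bsub>R\<^esub>}" by (auto simp: powers_def)
  interpret L: regular_localization R "{\<one>\<^bsub>R\<^esub>}" by (rule L)
  show "(\<lambda>r. loc_frac R {\<one>\<^bsub>R\<^esub>} r \<one>\<^bsub>R\<^esub>) \<in> ring_iso R (localization R {\<one>\<^bsub>R\<^esub>})"
    unfolding ring_iso_def bij_betw_def
    using L.frac_one_hom L.frac_one_inj by (auto simp: L.carrier_L)
  show "loc_frac R {\<one>\<^bsub>R\<^esub>} r \<one>\<^bsub>R\<^esub> = {(r, \<one>\<^bsub>R\<^esub>)}" if "r \<in> carrier R" for r
    using that L.mem_frac[OF that] by auto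
qed

text \<open>The quotient by a prime is a domain, so its nonzero elements are regular and a nonzero
  fraction r/s has the inverse s/r. The last claim recovers the prime as the kernel of the map to
  its residue field.\<close>

lemma (in primeideal) residue_field:
  shows "field (residue_field R I)" "residue_map R I \<in> ring_hom R (residue_field R I)"
    "\<And>a. a \<in> carrier R \<Longrightarrow> residue_map R I a = \<zero>\<^bsub>residue_field R I\<^esub> \<longleftrightarrow> a \<in> I"
proof -
  let ?D = "R Quot I" and ?S = "carrier (R Quot I) - {\<zero>\<^bsub>R Quot I\<^esub>}"
  interpret D: domain ?D by (rule quotient_is_domain)
  interpret L: regular_localization ?D ?S
    by unfold_locales (auto simp: D.integral_iff)
  have zero: "L.fr r s = \<zero>\<^bsub>L.L\<^esub> \<longleftrightarrow> r = \<zero>\<^bsub>?D\<^esub>" if "r \<in> carrier ?D" "s \<in> ?S" for r s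
    using that L.one_S by (simp add: L.L_simps L.frac_eq_iff)
  show "field (residue_field R I)" unfolding residue_field_def
  proof (rule cring.cring_fieldI2[OF L.cring_L])
    show "\<zero>\<^bsub>L.L\<^esub> \<noteq> \<one>\<^bsub>L.L\<^esub>" using L.one_S by (simp add: L.L_simps L.frac_eq_iff)
    fix x assume x: "x \<in> carrier L.L" "x \<noteq> \<zero>\<^bsub>L.L\<^esub>"
    then obtain r s where rs: "r \<in> carrier ?D" "s \<in> ?S" "x = L.fr r s" by (metis L.frac_cases)
    then have r: "r \<in> ?S" using x(2) zero by auto
    have "x \<otimes>\<^bsub>L.L\<^esub> L.fr s r = \<one>\<^bsub>L.L\<^esub>"
      using rs r L.one_S L.mult_S by (simp add: L.frac_mult L.L_simps L.frac_eq_iff D.m_comm)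
    then show "\<exists>y\<in>carrier L.L. x \<otimes>\<^bsub>L.L\<^esub> y = \<one>\<^bsub>L.L\<^esub>" using L.frac_closed[of s r] rs r by blast
  qed
  have map: "residue_map R I = (\<lambda>r. L.fr r \<one>\<^bsub>?D\<^esub>) \<circ> (+>) I"
    by (simp add: residue_map_def fun_eq_iff)
  show "residue_map R I \<in> ring_hom R (residue_field R I)"
    unfolding map residue_field_def by (rule ring_hom_trans[OF rcos_ring_hom L.frac_one_hom])
  fix a assume a: "a \<in> carrier R"
  have "I +> a \<in> carrier ?D" using ring_hom_closed[OF rcos_ring_hom a] .
  then have "residue_map R I a = \<zero>\<^bsub>residue_field R I\<^esub> \<longleftrightarrow> I +> a = \<zero>\<^bsub>?D\<^esub>"
    unfolding map residue_field_def using zero[of "I +> a" "\<one>\<^bsub>?D\<^esub>"] L.one_S by simp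
  also have "\<dots> \<longleftrightarrow> a \<in> I"
    using a a_rcos_const rcos_const_imp_mem by (auto simp: FactRing_def)
  finally show "residue_map R I a = \<zero>\<^bsub>residue_field R I\<^esub> \<longleftrightarrow> a \<in> I" .
qed

section \<open>Algebras generated by one element\<close>

text \<open>The value at x of the polynomial with coefficients c 0, ..., c (d - 1), the highest term
  being split off first. Coefficient functions are total, but only their values below d are
  read.\<close>

primrec pval where
  "pval S \<phi> x 0 c = \<zero>\<^bsub>S\<^esub>"
| "pval S \<phi> x (Suc d) c = \<phi> (c d) \<otimes>\<^bsub>S\<^esub> x [^]\<^bsub>S\<^esub> d \<oplus>\<^bsub>S\<^esub> pval S \<phi> x d c"

text \<open>An algebra with a marked element that need not generate it. The polynomial ring with its
  variable, its quotients and the base changes are all instances, so arguments by degree are made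
  once for all of them.\<close>

locale pointed_algebra = R: cring R + S?: cring S for R and S (structure) +
  fixes \<phi> x
  assumes \<phi>: "\<phi> \<in> ring_hom R S" and x [simp, intro]: "x \<in> carrier S"
begin

sublocale h: ring_hom_cring R S \<phi>
  using \<phi> R.is_cring S.is_cring by (simp add: ring_hom_cring_def ring_hom_cring_axioms_def)

abbreviation "val \<equiv> pval S \<phi> x"

text \<open>The span of 1, x, ..., x^(d-1). In the polynomial ring with its variable these are the
  polynomials of degree less than d; in a quotient an element may lie in several of these spans for
  reasons invisible from one expression of it.\<close>

definition "below d = {val d c | c. c \<in> UNIV \<rightarrow> carrier R}"

lemma val_closed: "c \<in> UNIV \<rightarrow> carrier R \<Longrightarrow> val d c \<in> carrier S"
  by (induction d) (auto simp: Pi_iff)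

lemma val_cong: "(\<And>i. i < d \<Longrightarrow> c i = b i) \<Longrightarrow> val d c = val d b"
  by (induction d) auto

lemma val_add:
  assumes "c \<in> UNIV \<rightarrow> carrier R" "b \<in> UNIV \<rightarrow> carrier R"
  shows "val d (\<lambda>i. c i \<oplus>\<^bsub>R\<^esub> b i) = val d c \<oplus> val d b"
proof (induction d)
  case (Suc d)
  have "c d \<in> carrier R" "b d \<in> carrier R" using assms by auto
  then show ?case using Suc val_closed[OF assms(1), of d] val_closed[OF assms(2), of d]
    by (simp add: S.l_distr S.a_ac)
qed simp

lemma val_smult:
  assumes "c \<in> UNIV \<rightarrow> carrier R" "r \<in> carrier R"
  shows "val d (\<lambda>i. r \<otimes>\<^bsub>R\<^esub> c i) = \<phi> r \<otimes> val d c"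
proof (induction d)
  case (Suc d)
  have "c d \<in> carrier R" using assms by auto
  then show ?case using Suc val_closed[OF assms(1), of d] assms(2)
    by (simp add: S.r_distr S.m_assoc)
qed (use assms in simp)

lemma val_zero: "(\<And>i. i < d \<Longrightarrow> c i = \<zero>\<^bsub>R\<^esub>) \<Longrightarrow> val d c = \<zero>"
  by (induction d) auto

lemma below_closed: "s \<in> below d \<Longrightarrow> s \<in> carrier S"
  unfolding below_def using val_closed by auto

lemma val_below: "c \<in> UNIV \<rightarrow> carrier R \<Longrightarrow> val d c \<in> below d"
  unfolding below_def by blast

lemma zero_below: "\<zero> \<in> below d"
  using val_below[of "\<lambda>i. \<zero>\<^bsub>R\<^esub>" d] val_zero[of d "\<lambda>i. \<zero>\<^bsub>R\<^esub>"] by auto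

lemma add_below: "s \<in> below d \<Longrightarrow> t \<in> below d \<Longrightarrow> s \<oplus> t \<in> below d"
proof -
  assume "s \<in> below d" "t \<in> below d"
  then obtain c b where cb: "c \<in> UNIV \<rightarrow> carrier R" "s = val d c" "b \<in> UNIV \<rightarrow> carrier R" "t = val d b"
    by (auto simp: below_def)
  have "(\<lambda>i. c i \<oplus>\<^bsub>R\<^esub> b i) \<in> UNIV \<rightarrow> carrier R" using cb by auto
  from val_below[OF this, of d] show ?thesis using val_add[OF cb(1,3), of d] cb by simp
qed

lemma smult_below: "s \<in> below d \<Longrightarrow> r \<in> carrier R \<Longrightarrow> \<phi> r \<otimes> s \<in> below d"
proof -
  assume "s \<in> below d" and r: "r \<in> carrier R"
  then obtain c where c: "c \<in> UNIV \<rightarrow> carrier R" "s = val d c" by (auto simp: below_def)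
  have "(\<lambda>i. r \<otimes>\<^bsub>R\<^esub> c i) \<in> UNIV \<rightarrow> carrier R" using c r by auto
  from val_below[OF this, of d] show ?thesis using val_smult[OF c(1) r, of d] c by simp
qed

lemma neg_below: assumes "s \<in> below d" shows "\<ominus> s \<in> below d"
proof -
  have "\<phi> (\<ominus>\<^bsub>R\<^esub> \<one>\<^bsub>R\<^esub>) \<otimes> s = \<ominus> s" using below_closed[OF assms] by (simp add: S.l_minus)
  then show ?thesis using smult_below[OF assms, of "\<ominus>\<^bsub>R\<^esub> \<one>\<^bsub>R\<^esub>"] by simp
qed

lemma diff_below: "s \<in> below d \<Longrightarrow> t \<in> below d \<Longrightarrow> s \<ominus> t \<in> below d"
  unfolding S.minus_eq by (intro add_below neg_below)

lemma below_Suc: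
  "s \<in> below (Suc d) \<longleftrightarrow> (\<exists>r\<in>carrier R. \<exists>l\<in>below d. s = \<phi> r \<otimes> x [^] d \<oplus> l)"
proof
  assume "s \<in> below (Suc d)"
  then obtain c where c: "c \<in> UNIV \<rightarrow> carrier R" "s = val (Suc d) c" by (auto simp: below_def)
  have "c d \<in> carrier R" using c(1) by auto
  then show "\<exists>r\<in>carrier R. \<exists>l\<in>below d. s = \<phi> r \<otimes> x [^] d \<oplus> l"
    using val_below[OF c(1), of d] c(2) by auto
next
  assume "\<exists>r\<in>carrier R. \<exists>l\<in>below d. s = \<phi> r \<otimes> x [^] d \<oplus> l"
  then obtain r c where r: "r \<in> carrier R" "c \<in> UNIV \<rightarrow> carrier R" "s = \<phi> r \<otimes> x [^] d \<oplus> val d c"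
    by (auto simp: below_def)
  have "val (Suc d) (c(d := r)) = s" using r val_cong[of d "c(d := r)" c] by simp
  moreover have "c(d := r) \<in> UNIV \<rightarrow> carrier R" using r by auto
  ultimately show "s \<in> below (Suc d)" using val_below by metis
qed

lemma below_mono: "d \<le> e \<Longrightarrow> below d \<subseteq> below e"
proof (induction rule: dec_induct)
  case (step e)
  have "s \<in> below (Suc e)" if s: "s \<in> below e" for s
    unfolding below_Suc using s below_closed[OF s]
    by (intro bexI[of _ "\<zero>\<^bsub>R\<^esub>"] bexI[of _ s]) auto
  then show ?case using step by blast
qed simp

lemma times_power_below:
  "s \<in> below d \<Longrightarrow> x [^] k \<otimes> s \<in> below (d + k)"
proof (induction d arbitrary: s)
  case 0
  then show ?case using zero_below by (auto simp: below_def)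
next
  case (Suc d)
  obtain r l where r: "r \<in> carrier R" "l \<in> below d" "s = \<phi> r \<otimes> x [^] d \<oplus> l"
    using Suc.prems unfolding below_Suc by blast
  have "x [^] k \<otimes> s = \<phi> r \<otimes> x [^] (d + k) \<oplus> x [^] k \<otimes> l"
    using r below_closed[OF r(2)] by (simp add: S.r_distr S.m_ac S.nat_pow_mult[symmetric])
  moreover have "x [^] k \<otimes> l \<in> below (d + k)" by (rule Suc.IH[OF r(2)])
  ultimately show ?case unfolding add_Suc below_Suc using r(1) by blast
qed

lemma times_below:
  assumes "t \<in> below e" shows "s \<in> below d \<Longrightarrow> s \<otimes> t \<in> below (d + e)"
proof (induction d arbitrary: s)
  case 0
  then show ?case using zero_below below_closed[OF assms] by (auto simp: below_def)
next
  case (Suc d)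
  obtain r l where r: "r \<in> carrier R" "l \<in> below d" "s = \<phi> r \<otimes> x [^] d \<oplus> l"
    using Suc.prems unfolding below_Suc by blast
  have "s \<otimes> t = \<phi> r \<otimes> (x [^] d \<otimes> t) \<oplus> l \<otimes> t"
    using r below_closed[OF r(2)] below_closed[OF assms] by (simp add: S.l_distr S.m_assoc)
  moreover have "x [^] d \<otimes> t \<in> below (Suc d + e)"
    using times_power_below[OF assms, of d] below_mono[of "e + d" "Suc d + e"] by auto
  moreover have "l \<otimes> t \<in> below (Suc d + e)"
    using Suc.IH[OF r(2)] below_mono[of "d + e" "Suc d + e"] by auto
  ultimately show ?case using r(1) by (simp add: add_below smult_below)
qed

text \<open>Long division by a monic expression: the multiple \<phi> r x^e of the divisor removes
  the top term and leaves something of lower degree. Being stated for values at x, it holds in the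
  polynomial ring and also in every quotient of it.\<close>

lemma division:
  assumes l: "l \<in> below d"
  shows "s \<in> below (d + e) \<Longrightarrow> \<exists>q\<in>below e. \<exists>r\<in>below d. s = (x [^] d \<oplus> l) \<otimes> q \<oplus> r"
proof (induction e arbitrary: s)
  case 0
  then show ?case using zero_below[of 0] below_closed[of s d] below_closed[OF l]
    by (intro bexI[of _ \<zero>] bexI[of _ s]) auto
next
  case (Suc e)
  obtain r t where r: "r \<in> carrier R" "t \<in> below (d + e)" "s = \<phi> r \<otimes> x [^] (d + e) \<oplus> t"
    using Suc.prems unfolding add_Suc_right below_Suc by blast
  have le: "x [^] e \<otimes> l \<in> below (d + e)" using times_power_below[OF l, of e] .
  have t': "t \<ominus> \<phi> r \<otimes> (x [^] e \<otimes> l) \<in> below (d + e)"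
    using r le by (intro diff_below smult_below)
  obtain q u where q: "q \<in> below e" "u \<in> below d"
    "t \<ominus> \<phi> r \<otimes> (x [^] e \<otimes> l) = (x [^] d \<oplus> l) \<otimes> q \<oplus> u"
    using Suc.IH[OF t'] by blast
  note cl = below_closed[OF q(1)] below_closed[OF q(2)] below_closed[OF l] below_closed[OF r(2)]
  \<comment> \<open>The correction term is added and subtracted, so that the first two summands
    become the divisor times \<phi> r x^e and the rest is covered by the induction
    hypothesis.\<close>
  have "s = \<phi> r \<otimes> (x [^] d \<otimes> x [^] e) \<oplus> \<phi> r \<otimes> (x [^] e \<otimes> l) \<oplus> (t \<ominus> \<phi> r \<otimes> (x [^] e \<otimes> l))"
  proof -
    have y: "\<phi> r \<otimes> (x [^] e \<otimes> l) \<in> carrier S" using cl r(1) by simp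
    have "\<phi> r \<otimes> (x [^] e \<otimes> l) \<oplus> (t \<ominus> \<phi> r \<otimes> (x [^] e \<otimes> l)) = t"
      using y cl(4) by (simp add: S.minus_eq S.a_lcomm[of "\<phi> r \<otimes> (x [^] e \<otimes> l)" t] S.r_neg)
    then show ?thesis using r y cl by (simp add: S.nat_pow_mult S.a_assoc)
  qed
  also have "\<dots> = (x [^] d \<oplus> l) \<otimes> (\<phi> r \<otimes> x [^] e \<oplus> q) \<oplus> u"
    unfolding q(3) using cl r(1) by (simp add: S.l_distr S.r_distr S.m_ac S.a_ac)
  finally have "s = (x [^] d \<oplus> l) \<otimes> (\<phi> r \<otimes> x [^] e \<oplus> q) \<oplus> u" .
  moreover have "\<phi> r \<otimes> x [^] e \<oplus> q \<in> below (Suc e)" unfolding below_Suc using r(1) q(1) by blast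
  ultimately show ?case using q(2) by blast
qed

end

text \<open>Evaluation is natural. The map g on coefficients is the identity for maps of R-algebras,
  and the change of base ring for tensor products.\<close>

lemma pointed_algebra_hom:
  assumes "pointed_algebra R S \<phi> x" "pointed_algebra R' S' \<phi>' x'"
    and "f \<in> ring_hom S S'" "g \<in> carrier R \<rightarrow> carrier R'"
    and "\<And>r. r \<in> carrier R \<Longrightarrow> f (\<phi> r) = \<phi>' (g r)" "f x = x'"
    and "c \<in> UNIV \<rightarrow> carrier R"
  shows "f (pval S \<phi> x d c) = pval S' \<phi>' x' d (g \<circ> c)"
proof -
  interpret A: pointed_algebra R S \<phi> x by fact
  interpret B: pointed_algebra R' S' \<phi>' x' by fact
  interpret f: ring_hom_cring S S' f
    using assms(3) A.S.is_cring B.S.is_cring by (simp add: ring_hom_cring_def ring_hom_cring_axioms_def)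
  show ?thesis
  proof (induction d)
    case (Suc d)
    have "c d \<in> carrier R" using assms(7) by auto
    then show ?case using Suc A.val_closed[OF assms(7), of d] assms(5,6) by simp
  qed simp
qed

text \<open>The algebra R[X]/(X^n + a_(n-1) X^(n-1) + ... + a_0), described intrinsically by a root
  whose powers below n form a basis. No construction is mentioned, so the description passes to
  isomorphic copies and to base changes.\<close>

locale monogenic = pointed_algebra +
  fixes n a
  assumes a: "a \<in> UNIV \<rightarrow> carrier R"
    and root: "x [^] n \<oplus> val n a = \<zero>"
    and spanning: "carrier S \<subseteq> below n"
    and independent: "c \<in> UNIV \<rightarrow> carrier R \<Longrightarrow> val n c = \<zero> \<Longrightarrow> i < n \<Longrightarrow> c i = \<zero>\<^bsub>R\<^esub>"
begin

lemma val_inj: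
  assumes "c \<in> UNIV \<rightarrow> carrier R" "b \<in> UNIV \<rightarrow> carrier R" "val n c = val n b" "i < n"
  shows "c i = b i"
proof -
  let ?b = "\<lambda>i. \<ominus>\<^bsub>R\<^esub> \<one>\<^bsub>R\<^esub> \<otimes>\<^bsub>R\<^esub> b i"
  have b: "?b \<in> UNIV \<rightarrow> carrier R" using assms by auto
  have "val n (\<lambda>i. c i \<oplus>\<^bsub>R\<^esub> ?b i) = val n c \<oplus> \<phi> (\<ominus>\<^bsub>R\<^esub> \<one>\<^bsub>R\<^esub>) \<otimes> val n b"
    using val_add[OF assms(1) b] val_smult[OF assms(2), of "\<ominus>\<^bsub>R\<^esub> \<one>\<^bsub>R\<^esub>"] by simp
  also have "\<dots> = \<zero>" using assms(3) val_closed[OF assms(2)] by (simp add: S.l_minus S.r_neg)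
  finally have v: "val n (\<lambda>i. c i \<oplus>\<^bsub>R\<^esub> ?b i) = \<zero>" .
  have "(\<lambda>i. c i \<oplus>\<^bsub>R\<^esub> ?b i) \<in> UNIV \<rightarrow> carrier R" using assms(1) b by auto
  from independent[OF this v assms(4)] have "c i \<oplus>\<^bsub>R\<^esub> ?b i = \<zero>\<^bsub>R\<^esub>" .
  moreover have cb: "c i \<in> carrier R" "b i \<in> carrier R" using assms(1,2) by auto
  ultimately have "c i \<ominus>\<^bsub>R\<^esub> b i = \<zero>\<^bsub>R\<^esub>" by (simp add: R.l_minus R.minus_eq)
  then show ?thesis using cb by simp
qed

end

section \<open>The polynomial ring in one variable\<close>

definition exponent :: "nat \<Rightarrow> nat \<Rightarrow> nat" where "exponent k = (\<lambda>i. if i = 0 then k else 0)"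

definition poly_const where "poly_const R r = monomial R (\<lambda>i::nat. 0::nat) r"

definition poly_var where "poly_var R = monomial R (exponent 1) \<one>\<^bsub>R\<^esub>"

lemma exponents_one: "carrier (exponents 1) = range exponent"
proof -
  have "m \<in> range exponent" if "\<forall>i\<ge>1. m i = (0::nat)" for m
    using that by (intro range_eqI[of _ _ "m 0"]) (auto simp: exponent_def fun_eq_iff)
  then show ?thesis by (auto simp: exponents_def exponent_def)
qed

lemma exponent_zero: "exponent 0 = (\<lambda>i. 0)"
  by (simp add: exponent_def fun_eq_iff)

lemma exponents_simps:
  "\<one>\<^bsub>exponents n\<^esub> = (\<lambda>i. 0)" "m \<otimes>\<^bsub>exponents n\<^esub> m' = (\<lambda>i. m i + m' i)"
  by (simp_all add: exponents_def)

lemma exponent_add: "exponent k \<otimes>\<^bsub>exponents 1\<^esub> exponent l = exponent (k + l)"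
  by (simp add: exponents_def exponent_def fun_eq_iff)

lemma exponent_inj: "exponent k = exponent l \<longleftrightarrow> k = l"
  by (auto simp: exponent_def fun_eq_iff split: if_splits dest: spec[of _ 0])

lemma comm_monoid_exponents: "comm_monoid (exponents n)"
  by (rule comm_monoidI) (auto simp: exponents_def fun_eq_iff)

context
  fixes R :: "('r, 'k) ring_scheme"
  assumes R: "cring R"
begin

declare One_nat_def [simp del]

interpretation R: cring R by (rule R)

interpretation P: monoid_algebra_setup R "exponents 1"
  by (intro monoid_algebra_setup.intro R comm_monoid_exponents)

lemma cring_poly_ring: "cring (poly_ring R 1)"
  unfolding poly_ring_def by (rule P.cring_monoid_algebra)

lemma poly_const_hom: "poly_const R \<in> ring_hom R (poly_ring R 1)"
proof (rule ring_hom_memI)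
  have 0: "(\<lambda>i. 0) \<in> carrier (exponents 1)" by (simp add: exponents_def)
  show "poly_const R r \<in> carrier (poly_ring R 1)" if "r \<in> carrier R" for r
    using P.monomial_closed[OF 0 that] by (simp add: poly_const_def poly_ring_def)
  show "poly_const R (r \<otimes>\<^bsub>R\<^esub> s) = poly_const R r \<otimes>\<^bsub>poly_ring R 1\<^esub> poly_const R s"
    if "r \<in> carrier R" "s \<in> carrier R" for r s
    using P.monomial_mult[OF 0 0 that] by (simp add: poly_const_def poly_ring_def exponents_simps)
  show "poly_const R (r \<oplus>\<^bsub>R\<^esub> s) = poly_const R r \<oplus>\<^bsub>poly_ring R 1\<^esub> poly_const R s"
    if "r \<in> carrier R" "s \<in> carrier R" for r s
    using P.monomial_add[OF that] by (simp add: poly_const_def poly_ring_def)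
  show "poly_const R \<one>\<^bsub>R\<^esub> = \<one>\<^bsub>poly_ring R 1\<^esub>"
    by (simp add: poly_const_def poly_ring_def P.ring_operations exponents_simps)
qed

lemma pointed_poly_ring: "pointed_algebra R (poly_ring R 1) (poly_const R) (poly_var R)"
proof (intro pointed_algebra.intro pointed_algebra_axioms.intro R cring_poly_ring poly_const_hom)
  show "poly_var R \<in> carrier (poly_ring R 1)"
    using P.monomial_closed[of "exponent 1" "\<one>\<^bsub>R\<^esub>"] by (auto simp: poly_var_def poly_ring_def exponents_one)
qed

interpretation P1: pointed_algebra R "poly_ring R 1" "poly_const R" "poly_var R"
  by (rule pointed_poly_ring)

lemma exponent_mem: "exponent k \<in> carrier (exponents 1)"
  by (simp add: exponents_one)

lemma poly_var_pow: "poly_var R [^]\<^bsub>poly_ring R 1\<^esub> k = monomial R (exponent k) \<one>\<^bsub>R\<^esub>"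
proof (induction k)
  case 0
  show ?case by (simp add: poly_ring_def P.ring_operations exponents_simps exponent_zero)
next
  case (Suc k)
  then show ?case
    using P.monomial_mult[OF exponent_mem exponent_mem, of "\<one>\<^bsub>R\<^esub>" "\<one>\<^bsub>R\<^esub>" k 1]
    by (simp add: poly_var_def poly_ring_def exponent_add) (simp add: Suc_eq_plus1)
qed

lemma poly_term:
  assumes "r \<in> carrier R"
  shows "poly_const R r \<otimes>\<^bsub>poly_ring R 1\<^esub> poly_var R [^]\<^bsub>poly_ring R 1\<^esub> k = monomial R (exponent k) r"
  unfolding poly_var_pow poly_const_def exponent_zero[symmetric]
  using P.monomial_mult[OF exponent_mem exponent_mem, of r "\<one>\<^bsub>R\<^esub>" 0 k] assms
  by (simp add: poly_ring_def exponent_add)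

lemma poly_val_coeff:
  assumes "c \<in> UNIV \<rightarrow> carrier R"
  shows "P1.val d c (exponent k) = (if k < d then c k else \<zero>\<^bsub>R\<^esub>)"
proof (induction d)
  case 0
  show ?case by (simp add: poly_ring_def P.ring_operations)
next
  case (Suc d)
  have cR: "c i \<in> carrier R" for i using assms by auto
  have "P1.val (Suc d) c (exponent k) = monomial R (exponent d) (c d) (exponent k) \<oplus>\<^bsub>R\<^esub> P1.val d c (exponent k)"
    using cR by (simp add: poly_term) (simp add: poly_ring_def P.ring_operations)
  then show ?case using Suc cR by (auto simp: monomial_def exponent_inj less_Suc_eq)
qed

lemma poly_below_ex:
  assumes "f \<in> carrier (poly_ring R 1)"
  shows "\<exists>d. f \<in> P1.below d"
  using assms unfolding poly_ring_def
proof (induction rule: P.monomial_induct)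
  case (monomial m r)
  then obtain k where k: "m = exponent k" by (auto simp: exponents_one)
  have "monomial R m r \<in> carrier (poly_ring R 1)"
    using P.monomial_closed[OF monomial] by (simp add: poly_ring_def)
  then have "monomial R m r = poly_const R r \<otimes>\<^bsub>poly_ring R 1\<^esub> poly_var R [^]\<^bsub>poly_ring R 1\<^esub> k
      \<oplus>\<^bsub>poly_ring R 1\<^esub> \<zero>\<^bsub>poly_ring R 1\<^esub>"
    unfolding poly_term[OF monomial(2)] k by (rule P1.S.r_zero[symmetric])
  then have "monomial R m r \<in> P1.below (Suc k)"
    unfolding P1.below_Suc using P1.zero_below[of k] monomial(2) by blast
  then show ?case unfolding poly_ring_def by blast
next
  case (add f g)
  then obtain d e where d: "f \<in> P1.below d" "g \<in> P1.below e" by (auto simp: poly_ring_def)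
  then have "f \<in> P1.below (d + e)" "g \<in> P1.below (d + e)"
    using P1.below_mono[of d "d + e"] P1.below_mono[of e "d + e"] by auto
  then have "f \<oplus>\<^bsub>poly_ring R 1\<^esub> g \<in> P1.below (d + e)" by (rule P1.add_below)
  then show ?case unfolding poly_ring_def by blast
qed

lemma poly_eval:
  assumes S: "pointed_algebra R S \<phi> x"
  shows "\<exists>ev\<in>ring_hom (poly_ring R 1) S. (\<forall>r\<in>carrier R. ev (poly_const R r) = \<phi> r) \<and> ev (poly_var R) = x"
proof -
  interpret S: pointed_algebra R S \<phi> x by (rule S)
  interpret H: monoid_algebra_hom R "exponents 1" S \<phi> "\<lambda>m. x [^]\<^bsub>S\<^esub> (m 0 :: nat)"
    by unfold_locales (auto simp: S.\<phi> exponents_simps S.S.nat_pow_mult)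
  have "H.lift (poly_const R r) = \<phi> r" if "r \<in> carrier R" for r
    using H.lift_monomial[OF exponent_mem[of 0] that] that
    by (simp add: poly_const_def exponent_zero)
  moreover have "H.lift (poly_var R) = x"
    using H.lift_monomial[OF exponent_mem[of 1], of "\<one>\<^bsub>R\<^esub>"] by (simp add: poly_var_def exponent_def)
  ultimately show ?thesis using H.lift_hom unfolding poly_ring_def by blast
qed

text \<open>A monic factor preserves leading coefficients, even in the presence of zero divisors: if
  m is the degree of f and r its top coefficient, then r is the coefficient of the product at m + n.
  A product of degree below n forces r = 0, against the choice of m. This is the source of linear
  independence in the quotient.\<close>

lemma monic_mult_below:
  assumes a: "a \<in> UNIV \<rightarrow> carrier R"
    and f: "f \<in> carrier (poly_ring R 1)"
    and fp: "f \<otimes>\<^bsub>poly_ring R 1\<^esub> (poly_var R [^]\<^bsub>poly_ring R 1\<^esub> n \<oplus>\<^bsub>poly_ring R 1\<^esub> P1.val n a) \<in> P1.below n"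
  shows "f = \<zero>\<^bsub>poly_ring R 1\<^esub>"
proof (rule ccontr)
  let ?P = "poly_ring R 1"
  assume nz: "f \<noteq> \<zero>\<^bsub>?P\<^esub>"
  define d where "d = (LEAST d. f \<in> P1.below d)"
  have fd: "f \<in> P1.below d" unfolding d_def using poly_below_ex[OF f] by (rule LeastI_ex)
  have "d \<noteq> 0" using fd nz by (auto simp: P1.below_def)
  then obtain m where m: "d = Suc m" by (cases d) auto
  obtain r l where r: "r \<in> carrier R" "l \<in> P1.below m"
    "f = poly_const R r \<otimes>\<^bsub>?P\<^esub> poly_var R [^]\<^bsub>?P\<^esub> m \<oplus>\<^bsub>?P\<^esub> l"
    using fd unfolding m P1.below_Suc by blast
  let ?v = "P1.val n a"
  have v: "?v \<in> P1.below n" by (rule P1.val_below[OF a])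
  note cl = P1.below_closed[OF r(2)] P1.below_closed[OF v]
  \<comment> \<open>The rest of the product once the term r X^(m+n) has been split off; all its
    summands have degree below m + n.\<close>
  let ?u = "poly_const R r \<otimes>\<^bsub>?P\<^esub> (poly_var R [^]\<^bsub>?P\<^esub> m \<otimes>\<^bsub>?P\<^esub> ?v) \<oplus>\<^bsub>?P\<^esub>
     (poly_var R [^]\<^bsub>?P\<^esub> n \<otimes>\<^bsub>?P\<^esub> l \<oplus>\<^bsub>?P\<^esub> l \<otimes>\<^bsub>?P\<^esub> ?v)"
  have u: "?u \<in> P1.below (m + n)"
    using P1.times_power_below[OF v, of m] P1.times_power_below[OF r(2), of n] P1.times_below[OF v r(2)] r(1)
    by (intro P1.add_below P1.smult_below) (simp_all add: add.commute)
  have "f \<otimes>\<^bsub>?P\<^esub> (poly_var R [^]\<^bsub>?P\<^esub> n \<oplus>\<^bsub>?P\<^esub> ?v)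
      = poly_const R r \<otimes>\<^bsub>?P\<^esub> poly_var R [^]\<^bsub>?P\<^esub> (m + n) \<oplus>\<^bsub>?P\<^esub> ?u"
    unfolding r(3) using cl r(1)
    by (simp add: P1.S.nat_pow_mult[symmetric] P1.S.l_distr P1.S.r_distr P1.S.m_ac P1.S.a_ac)
  then have "poly_const R r \<otimes>\<^bsub>?P\<^esub> poly_var R [^]\<^bsub>?P\<^esub> (m + n) \<oplus>\<^bsub>?P\<^esub> ?u \<in> P1.below (m + n)"
    using fp P1.below_mono[of n "m + n"] by auto
  from P1.diff_below[OF this u]
  have "poly_const R r \<otimes>\<^bsub>?P\<^esub> poly_var R [^]\<^bsub>?P\<^esub> (m + n) \<in> P1.below (m + n)"
    using P1.below_closed[OF u] r(1) by (simp add: P1.S.minus_eq P1.S.a_assoc P1.S.r_neg)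
  then obtain c where c: "c \<in> UNIV \<rightarrow> carrier R" "monomial R (exponent (m + n)) r = P1.val (m + n) c"
    unfolding poly_term[OF r(1)] by (auto simp: P1.below_def)
  have "r = \<zero>\<^bsub>R\<^esub>"
    using arg_cong[OF c(2), of "\<lambda>f. f (exponent (m + n))"] poly_val_coeff[OF c(1)]
    by (simp add: monomial_def)
  then have "f \<in> P1.below m" using r cl by simp
  then have "d \<le> m" unfolding d_def by (rule Least_le)
  then show False using m by simp
qed

end

lemma (in ideal) a_minus_closed: "a \<in> I \<Longrightarrow> b \<in> I \<Longrightarrow> a \<ominus> b \<in> I"
  unfolding minus_eq by simp

lemma (in ideal) coset_zero_iff:
  assumes "a \<in> carrier R" shows "I +> a = \<zero>\<^bsub>R Quot I\<^esub> \<longleftrightarrow> a \<in> I"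
  using assms a_rcos_const rcos_const_imp_mem by (auto simp: FactRing_def)

lemma (in ideal) coset_surj: "(+>) I ` carrier R = carrier (R Quot I)"
  unfolding FactRing_def A_RCOSETS_def RCOSETS_def a_r_coset_def by auto

text \<open>Zorn's lemma for the ideals that avoid 1: the union of a chain of them still avoids 1,
  and a maximal one is a maximal ideal, hence prime. It supplies the points of nonzero
  fibres.\<close>

lemma (in cring) exists_primeideal:
  assumes "\<one> \<noteq> \<zero>" shows "\<exists>q. primeideal q R"
proof -
  let ?S = "{J. ideal J R \<and> \<one> \<notin> J}"
  have "\<exists>M\<in>?S. \<forall>J\<in>?S. M \<subseteq> J \<longrightarrow> J = M"
  proof (rule subset_Zorn)
    fix K assume K: "subset.chain ?S K"
    show "\<exists>U\<in>?S. \<forall>J\<in>K. J \<subseteq> U"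
    proof (cases "K = {}")
      case True
      have "{\<zero>} \<in> ?S" using zeroideal assms by simp
      then show ?thesis using True by auto
    next
      case False
      have "subset.chain {I. ideal I R} K" using K unfolding pred_on.chain_def by auto
      then have "ideal (\<Union>K) R" using chain_Union_is_ideal[of K] False by simp
      moreover have "\<one> \<notin> \<Union>K" using K unfolding pred_on.chain_def by auto
      ultimately show ?thesis by (intro bexI[of _ "\<Union>K"]) auto
    qed
  qed
  then obtain M where M: "ideal M R" "\<one> \<notin> M" and max: "\<And>J. ideal J R \<Longrightarrow> \<one> \<notin> J \<Longrightarrow> M \<subseteq> J \<Longrightarrow> J = M"
    by auto
  have "maximalideal M R"
  proof (rule maximalidealI[OF M(1)])
    show "carrier R \<noteq> M" using M(2) one_closed by blast
    fix J assume "ideal J R" "M \<subseteq> J" "J \<subseteq> carrier R"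
    then show "J = M \<or> J = carrier R" using max ideal.one_imp_carrier by blast
  qed
  then show ?thesis using maximalideal_prime by blast
qed

text \<open>The image of b is computed on a chosen preimage. Two preimages differ by an element of
  the kernel of e, which h kills, so the choice does not matter and the homomorphism laws
  descend.\<close>

lemma ring_hom_factor:
  assumes "cring P" "cring B" "cring T"
    and e: "e \<in> ring_hom P B" "e ` carrier P = carrier B" and h: "h \<in> ring_hom P T"
    and ker: "\<And>f. f \<in> carrier P \<Longrightarrow> e f = \<zero>\<^bsub>B\<^esub> \<Longrightarrow> h f = \<zero>\<^bsub>T\<^esub>"
  shows "\<exists>\<beta>\<in>ring_hom B T. \<forall>f\<in>carrier P. \<beta> (e f) = h f"
proof -
  interpret e: ring_hom_cring P B e
    using assms by (simp add: ring_hom_cring_def ring_hom_cring_axioms_def)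
  interpret h: ring_hom_cring P T h
    using assms by (simp add: ring_hom_cring_def ring_hom_cring_axioms_def)
  define \<beta> where "\<beta> b = h (SOME f. f \<in> carrier P \<and> e f = b)" for b
  have \<beta>: "\<beta> (e f) = h f" if f: "f \<in> carrier P" for f
  proof -
    let ?g = "SOME g. g \<in> carrier P \<and> e g = e f"
    have g: "?g \<in> carrier P" "e ?g = e f" using someI[of "\<lambda>g. g \<in> carrier P \<and> e g = e f" f] f by auto
    have "e (?g \<ominus>\<^bsub>P\<^esub> f) = \<zero>\<^bsub>B\<^esub>" using g f by (simp add: e.R.minus_eq e.S.r_neg)
    then have "h (?g \<ominus>\<^bsub>P\<^esub> f) = \<zero>\<^bsub>T\<^esub>" using ker g f by simp
    then have "h ?g \<ominus>\<^bsub>T\<^esub> h f = \<zero>\<^bsub>T\<^esub>" using g f by (simp add: e.R.minus_eq h.S.minus_eq)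
    then show ?thesis using g f unfolding \<beta>_def by simp
  qed
  have sur: "\<exists>f\<in>carrier P. e f = b" if "b \<in> carrier B" for b using that e(2) by (metis imageE)
  have "\<beta> \<in> ring_hom B T"
  proof (rule ring_hom_memI)
    fix b assume "b \<in> carrier B"
    then obtain f where "f \<in> carrier P" "e f = b" using sur by blast
    then show "\<beta> b \<in> carrier T" using \<beta>[of f] by simp
  next
    fix b c assume "b \<in> carrier B" "c \<in> carrier B"
    then obtain f g where fg: "f \<in> carrier P" "e f = b" "g \<in> carrier P" "e g = c" using sur by metis
    show "\<beta> (b \<otimes>\<^bsub>B\<^esub> c) = \<beta> b \<otimes>\<^bsub>T\<^esub> \<beta> c"
      using \<beta>[of f] \<beta>[of g] \<beta>[of "f \<otimes>\<^bsub>P\<^esub> g"] fg by simp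
    show "\<beta> (b \<oplus>\<^bsub>B\<^esub> c) = \<beta> b \<oplus>\<^bsub>T\<^esub> \<beta> c"
      using \<beta>[of f] \<beta>[of g] \<beta>[of "f \<oplus>\<^bsub>P\<^esub> g"] fg by simp
  next
    show "\<beta> \<one>\<^bsub>B\<^esub> = \<one>\<^bsub>T\<^esub>" using \<beta>[of "\<one>\<^bsub>P\<^esub>"] by simp
  qed
  then show ?thesis using \<beta> by blast
qed

section \<open>Existence, presentation and universal_property property of monogenic algebras\<close>

declare One_nat_def [simp del]

definition monic_poly where
  "monic_poly R n a = poly_var R [^]\<^bsub>poly_ring R 1\<^esub> n \<oplus>\<^bsub>poly_ring R 1\<^esub>
     pval (poly_ring R 1) (poly_const R) (poly_var R) n a"

context
  fixes R :: "('r, 'k) ring_scheme" and a :: "nat \<Rightarrow> 'r" and n :: nat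
  assumes R: "cring R" and a: "a \<in> UNIV \<rightarrow> carrier R"
begin

interpretation P: pointed_algebra R "poly_ring R 1" "poly_const R" "poly_var R"
  by (rule pointed_poly_ring[OF R])

abbreviation (input) "PP \<equiv> poly_ring R 1"

lemma monic_poly_closed: "monic_poly R n a \<in> carrier PP"
  unfolding monic_poly_def using P.val_closed[OF a] by (intro P.S.a_closed P.S.nat_pow_closed) auto

lemma ideal_monic_poly: "ideal (Idl\<^bsub>PP\<^esub> {monic_poly R n a}) PP"
  using monic_poly_closed by (intro P.S.genideal_ideal) auto

lemma poly_remainder:
  assumes "f \<in> carrier PP"
  shows "\<exists>g\<in>carrier PP. \<exists>c\<in>UNIV \<rightarrow> carrier R. f = monic_poly R n a \<otimes>\<^bsub>PP\<^esub> g \<oplus>\<^bsub>PP\<^esub> P.val n c"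
proof -
  obtain d where "f \<in> P.below d" using poly_below_ex[OF R assms] by blast
  then have f: "f \<in> P.below (n + d)" using P.below_mono[of d "n + d"] by auto
  obtain q r where "q \<in> P.below d" "r \<in> P.below n" "f = monic_poly R n a \<otimes>\<^bsub>PP\<^esub> q \<oplus>\<^bsub>PP\<^esub> r"
    using P.division[OF P.val_below[OF a] f] unfolding monic_poly_def by blast
  moreover then obtain c where "c \<in> UNIV \<rightarrow> carrier R" "r = P.val n c" by (auto simp: P.below_def)
  ultimately show ?thesis using P.below_closed[of q d] by blast
qed

lemma multiple_in_ideal:
  assumes "g \<in> carrier PP" shows "monic_poly R n a \<otimes>\<^bsub>PP\<^esub> g \<in> Idl\<^bsub>PP\<^esub> {monic_poly R n a}"
  using ideal.I_r_closed[OF ideal_monic_poly P.S.genideal_self'[OF monic_poly_closed] assms] .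

text \<open>Division with remainder shows that the powers below n span the quotient. A relation
  between them would be a polynomial of degree below n that is a multiple of the monic one, hence
  zero by \<open>monic_mult_below\<close>.\<close>

lemma monogenic_exists:
  defines "I \<equiv> Idl\<^bsub>PP\<^esub> {monic_poly R n a}"
  shows "monogenic R (PP Quot I) (\<lambda>r. I +>\<^bsub>PP\<^esub> poly_const R r) (I +>\<^bsub>PP\<^esub> poly_var R) n a"
proof -
  interpret I: ideal I PP unfolding I_def by (rule ideal_monic_poly)
  interpret T: cring "PP Quot I" by (rule I.quotient_is_cring[OF P.S.is_cring])
  let ?q = "(+>\<^bsub>PP\<^esub>) I"
  have q: "?q \<in> ring_hom PP (PP Quot I)" by (rule I.rcos_ring_hom)
  interpret q: ring_hom_cring PP "PP Quot I" ?q
    using q P.S.is_cring T.is_cring by (simp add: ring_hom_cring_def ring_hom_cring_axioms_def)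
  have pt: "pointed_algebra R (PP Quot I) (\<lambda>r. I +>\<^bsub>PP\<^esub> poly_const R r) (I +>\<^bsub>PP\<^esub> poly_var R)"
    using ring_hom_trans[OF poly_const_hom[OF R] q]
    by (intro pointed_algebra.intro pointed_algebra_axioms.intro R T.is_cring) (simp_all add: o_def)
  interpret A: pointed_algebra R "PP Quot I" "\<lambda>r. I +>\<^bsub>PP\<^esub> poly_const R r" "I +>\<^bsub>PP\<^esub> poly_var R"
    by (rule pt)
  have qval: "?q (P.val d c) = A.val d c" if "c \<in> UNIV \<rightarrow> carrier R" for c d
    using pointed_algebra_hom[OF pointed_poly_ring[OF R] pt q, of id c d] that by simp
  have pI: "?q (monic_poly R n a) = \<zero>\<^bsub>PP Quot I\<^esub>"
    using I.coset_zero_iff[OF monic_poly_closed] P.S.genideal_self'[OF monic_poly_closed] by (simp add: I_def)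
  show ?thesis
  proof (intro monogenic.intro monogenic_axioms.intro pt a)
    show "(I +>\<^bsub>PP\<^esub> poly_var R) [^]\<^bsub>PP Quot I\<^esub> n \<oplus>\<^bsub>PP Quot I\<^esub> A.val n a = \<zero>\<^bsub>PP Quot I\<^esub>"
      using pI P.val_closed[OF a] qval[OF a] unfolding monic_poly_def by simp
    show "carrier (PP Quot I) \<subseteq> A.below n"
    proof
      fix t assume "t \<in> carrier (PP Quot I)"
      then obtain f where f: "f \<in> carrier PP" "t = ?q f" using I.coset_surj by (metis imageE)
      obtain g c where gc: "g \<in> carrier PP" "c \<in> UNIV \<rightarrow> carrier R"
        "f = monic_poly R n a \<otimes>\<^bsub>PP\<^esub> g \<oplus>\<^bsub>PP\<^esub> P.val n c" using poly_remainder[OF f(1)] by blast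
      have "t = A.val n c"
        unfolding f(2) gc(3) using gc(1) monic_poly_closed P.val_closed[OF gc(2)] qval[OF gc(2)] pI
          A.val_closed[OF gc(2)] by simp
      then show "t \<in> A.below n" using A.val_below[OF gc(2)] by simp
    qed
    fix c i assume c: "c \<in> UNIV \<rightarrow> carrier R" "A.val n c = \<zero>\<^bsub>PP Quot I\<^esub>" "i < n"
    have "P.val n c \<in> I" using I.coset_zero_iff[OF P.val_closed[OF c(1)]] qval[OF c(1)] c(2) by simp
    then have "P.val n c \<in> PIdl\<^bsub>PP\<^esub> (monic_poly R n a)"
      unfolding I_def P.S.cgenideal_eq_genideal[OF monic_poly_closed] .
    then obtain h where h: "h \<in> carrier PP" "P.val n c = h \<otimes>\<^bsub>PP\<^esub> monic_poly R n a"
      unfolding cgenideal_def by blast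
    have "h = \<zero>\<^bsub>PP\<^esub>"
      using monic_mult_below[OF R a h(1), of n] P.val_below[OF c(1), of n] h(2)
      unfolding monic_poly_def by simp
    then have "P.val n c = \<zero>\<^bsub>PP\<^esub>" using h(2) monic_poly_closed by simp
    then have "(if i < n then c i else \<zero>\<^bsub>R\<^esub>) = \<zero>\<^bsub>PP\<^esub> (exponent i)"
      using poly_val_coeff[OF R c(1), of n i] by simp
    then show "c i = \<zero>\<^bsub>R\<^esub>" using c(3) by (simp add: poly_ring_def monoid_algebra_def)
  qed
qed

end

context monogenic
begin

interpretation P: pointed_algebra R "poly_ring R 1" "poly_const R" "poly_var R"
  by (rule pointed_poly_ring[OF R.is_cring])

text \<open>The kernel is no larger than the ideal: an element of the kernel has a remainder of
  degree below n with value 0, and independence makes all coefficients of this remainder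
  vanish.\<close>

lemma evaluation:
  obtains ev where "ev \<in> ring_hom (poly_ring R 1) S" "\<And>r. r \<in> carrier R \<Longrightarrow> ev (poly_const R r) = \<phi> r"
    "ev (poly_var R) = x" "ev ` carrier (poly_ring R 1) = carrier S"
    "a_kernel (poly_ring R 1) S ev = Idl\<^bsub>poly_ring R 1\<^esub> {monic_poly R n a}"
proof -
  let ?P = "poly_ring R 1"
  obtain ev where ev: "ev \<in> ring_hom ?P S" "\<And>r. r \<in> carrier R \<Longrightarrow> ev (poly_const R r) = \<phi> r"
    "ev (poly_var R) = x" using poly_eval[OF R.is_cring pointed_algebra_axioms] by blast
  interpret e: ring_hom_cring ?P S ev
    using ev(1) P.S.is_cring S.is_cring by (simp add: ring_hom_cring_def ring_hom_cring_axioms_def)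
  have val: "ev (P.val d c) = val d c" if "c \<in> UNIV \<rightarrow> carrier R" for c d
    using pointed_algebra_hom[OF pointed_poly_ring[OF R.is_cring] pointed_algebra_axioms ev(1), of id c d] that ev(2,3)
    by simp
  have surj: "ev ` carrier ?P = carrier S"
  proof (rule subset_antisym)
    show "ev ` carrier ?P \<subseteq> carrier S" by auto
    show "carrier S \<subseteq> ev ` carrier ?P"
    proof
      fix s assume "s \<in> carrier S"
      then obtain c where c: "c \<in> UNIV \<rightarrow> carrier R" "s = val n c" using spanning by (auto simp: below_def)
      then show "s \<in> ev ` carrier ?P" using val[OF c(1), of n] P.val_closed[OF c(1), of n] by (metis imageI)
    qed
  qed
  note mp = monic_poly_closed[OF R.is_cring a, of n]
  have p: "ev (monic_poly R n a) = \<zero>"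
    unfolding monic_poly_def using P.val_closed[OF a] val[OF a] root ev(3) by simp
  have ker: "a_kernel ?P S ev = Idl\<^bsub>?P\<^esub> {monic_poly R n a}"
  proof (rule subset_antisym)
    have "ring_hom_ring ?P S ev"
      by (intro ring_hom_ringI2 ev(1) cring.axioms(1)[OF P.S.is_cring] cring.axioms(1)[OF S.is_cring])
    then have "ideal (a_kernel ?P S ev) ?P" by (rule ring_hom_ring.kernel_is_ideal)
    moreover have "{monic_poly R n a} \<subseteq> a_kernel ?P S ev" unfolding a_kernel_def' using p mp by simp
    ultimately show "Idl\<^bsub>?P\<^esub> {monic_poly R n a} \<subseteq> a_kernel ?P S ev" by (rule P.S.genideal_minimal)
    show "a_kernel ?P S ev \<subseteq> Idl\<^bsub>?P\<^esub> {monic_poly R n a}"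
    proof
      fix f assume "f \<in> a_kernel ?P S ev"
      then have f: "f \<in> carrier ?P" "ev f = \<zero>" unfolding a_kernel_def' by simp_all
      obtain g c where gc: "g \<in> carrier ?P" "c \<in> UNIV \<rightarrow> carrier R"
        "f = monic_poly R n a \<otimes>\<^bsub>?P\<^esub> g \<oplus>\<^bsub>?P\<^esub> P.val n c" using poly_remainder[OF R.is_cring a f(1)] by blast
      have "val n c = \<zero>"
        using f(2) gc(1) mp p P.val_closed[OF gc(2), of n] val[OF gc(2), of n] val_closed[OF gc(2), of n]
        unfolding gc(3) by simp
      then have "P.val n c = \<zero>\<^bsub>?P\<^esub>" using independent[OF gc(2)] by (intro P.val_zero) auto
      then have "f = monic_poly R n a \<otimes>\<^bsub>?P\<^esub> g" using gc(1,3) mp by simp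
      then show "f \<in> Idl\<^bsub>?P\<^esub> {monic_poly R n a}" using multiple_in_ideal[OF R.is_cring a gc(1)] by simp
    qed
  qed
  show thesis by (rule that[OF ev surj ker])
qed

lemma presentation: "has_presentation R \<phi> S 1 [monic_poly R n a]"
proof -
  let ?P = "poly_ring R 1"
  let ?I = "Idl\<^bsub>?P\<^esub> {monic_poly R n a}"
  obtain ev where ev: "ev \<in> ring_hom ?P S" "\<And>r. r \<in> carrier R \<Longrightarrow> ev (poly_const R r) = \<phi> r"
    "ev (poly_var R) = x" "ev ` carrier ?P = carrier S" "a_kernel ?P S ev = ?I"
    using evaluation by metis
  interpret e: ring_hom_ring ?P S ev
    by (intro ring_hom_ringI2 ev(1) cring.axioms(1)[OF P.S.is_cring] cring.axioms(1)[OF S.is_cring])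
  have "(\<lambda>U. the_elem (ev ` U)) \<in> ring_iso (?P Quot ?I) S"
    using e.FactRing_iso_set[OF ev(4)] unfolding ev(5) .
  moreover have "the_elem (ev ` (?I +>\<^bsub>?P\<^esub> monomial R (\<lambda>i. 0) r)) = \<phi> r" if "r \<in> carrier R" for r
    using e.the_elem_simp[OF P.h.hom_closed[OF that]] ev(2)[OF that] unfolding ev(5) poly_const_def by simp
  moreover have "monic_poly R n a \<in> carrier ?P" by (rule monic_poly_closed[OF R.is_cring a])
  ultimately show ?thesis unfolding has_presentation_def Let_def
    by (auto intro!: bexI[of _ "\<lambda>U. the_elem (ev ` U)"])
qed

text \<open>Evaluation at the root y kills the monic polynomial, hence the whole kernel of
  evaluation at x. It therefore factors through the surjection onto \<open>S\<close>.\<close>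

lemma universal_property:
  assumes T: "pointed_algebra R T \<psi> y" and rootT: "y [^]\<^bsub>T\<^esub> n \<oplus>\<^bsub>T\<^esub> pval T \<psi> y n a = \<zero>\<^bsub>T\<^esub>"
  shows "\<exists>\<beta>\<in>ring_hom S T. (\<forall>r\<in>carrier R. \<beta> (\<phi> r) = \<psi> r) \<and> \<beta> x = y"
proof -
  let ?P = "poly_ring R 1"
  interpret T: pointed_algebra R T \<psi> y by (rule T)
  obtain ev where ev: "ev \<in> ring_hom ?P S" "\<And>r. r \<in> carrier R \<Longrightarrow> ev (poly_const R r) = \<phi> r"
    "ev (poly_var R) = x" "ev ` carrier ?P = carrier S"
    "a_kernel ?P S ev = Idl\<^bsub>?P\<^esub> {monic_poly R n a}" using evaluation by metis
  obtain h where h: "h \<in> ring_hom ?P T" "\<And>r. r \<in> carrier R \<Longrightarrow> h (poly_const R r) = \<psi> r"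
    "h (poly_var R) = y" using poly_eval[OF R.is_cring T] by blast
  interpret h: ring_hom_cring ?P T h
    using h(1) P.S.is_cring T.S.is_cring by (simp add: ring_hom_cring_def ring_hom_cring_axioms_def)
  note mp = monic_poly_closed[OF R.is_cring a, of n]
  have "h (P.val n a) = T.val n a"
    using pointed_algebra_hom[OF pointed_poly_ring[OF R.is_cring] T h(1), of id a n] a h(2,3) by simp
  then have p: "h (monic_poly R n a) = \<zero>\<^bsub>T\<^esub>"
    unfolding monic_poly_def using P.val_closed[OF a] rootT h(3) by simp
  have "ring_hom_ring ?P T h"
    by (intro ring_hom_ringI2 h(1) cring.axioms(1)[OF P.S.is_cring] cring.axioms(1)[OF T.S.is_cring])
  then have "ideal (a_kernel ?P T h) ?P" by (rule ring_hom_ring.kernel_is_ideal)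
  moreover have "{monic_poly R n a} \<subseteq> a_kernel ?P T h" unfolding a_kernel_def' using p mp by simp
  ultimately have "Idl\<^bsub>?P\<^esub> {monic_poly R n a} \<subseteq> a_kernel ?P T h" by (rule P.S.genideal_minimal)
  then have "h f = \<zero>\<^bsub>T\<^esub>" if "f \<in> carrier ?P" "ev f = \<zero>" for f
    using that unfolding ev(5)[symmetric] a_kernel_def' by blast
  then obtain \<beta> where \<beta>: "\<beta> \<in> ring_hom S T" "\<And>f. f \<in> carrier ?P \<Longrightarrow> \<beta> (ev f) = h f"
    using ring_hom_factor[OF P.S.is_cring S.is_cring T.S.is_cring ev(1,4) h(1)] by blast
  have "\<beta> (\<phi> r) = \<psi> r" if "r \<in> carrier R" for r
    using \<beta>(2)[OF P.h.hom_closed[OF that]] ev(2)[OF that] h(2)[OF that] by simp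
  moreover have "\<beta> x = y" using \<beta>(2)[OF P.x] ev(3) h(3) by simp
  ultimately show ?thesis using \<beta>(1) by blast
qed

lemma finite_free: "finite_free R \<phi> S"
proof -
  have fs: "(\<Oplus>i\<in>{..<d}. \<phi> (c i) \<otimes> x [^] i) = val d c" if "c \<in> {..<d} \<rightarrow> carrier R" for c d
    using that by (induction d) (auto simp: lessThan_Suc Pi_iff)
  \<comment> \<open>\<open>finite_free\<close> counts coefficient functions that are undefined
    outside the indices below n, while \<open>pval\<close> takes total functions into
    \<open>R\<close>. Extension by zero mediates between the two.\<close>
  let ?ext = "\<lambda>c i. if i < n then c i else \<zero>\<^bsub>R\<^esub>"
  have ext: "?ext c \<in> UNIV \<rightarrow> carrier R" if "c \<in> {..<n} \<rightarrow>\<^sub>E carrier R" for c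
    using that by (auto simp: PiE_iff)
  have vext: "val n (?ext c) = (\<Oplus>i\<in>{..<n}. \<phi> (c i) \<otimes> x [^] i)" if "c \<in> {..<n} \<rightarrow>\<^sub>E carrier R" for c
    using fs[of c n] val_cong[of n "?ext c" c] that by (auto simp: PiE_iff)
  have ex1: "\<exists>!c. c \<in> {..<n} \<rightarrow>\<^sub>E carrier R \<and> s = (\<Oplus>i\<in>{..<n}. \<phi> (c i) \<otimes> x [^] i)"
    if s: "s \<in> carrier S" for s
  proof (rule ex_ex1I)
    obtain c where c: "c \<in> UNIV \<rightarrow> carrier R" "s = val n c" using spanning s by (auto simp: below_def)
    have c': "restrict c {..<n} \<in> {..<n} \<rightarrow>\<^sub>E carrier R" using c(1) by auto
    have "s = (\<Oplus>i\<in>{..<n}. \<phi> (restrict c {..<n} i) \<otimes> x [^] i)"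
      unfolding c(2) vext[OF c', symmetric] by (intro val_cong) auto
    then show "\<exists>c. c \<in> {..<n} \<rightarrow>\<^sub>E carrier R \<and> s = (\<Oplus>i\<in>{..<n}. \<phi> (c i) \<otimes> x [^] i)" using c' by blast
    fix b c assume b: "b \<in> {..<n} \<rightarrow>\<^sub>E carrier R \<and> s = (\<Oplus>i\<in>{..<n}. \<phi> (b i) \<otimes> x [^] i)"
      and c: "c \<in> {..<n} \<rightarrow>\<^sub>E carrier R \<and> s = (\<Oplus>i\<in>{..<n}. \<phi> (c i) \<otimes> x [^] i)"
    have "b i = c i" if "i < n" for i
      using val_inj[OF ext ext _ that, of b c] b c vext[of b] vext[of c] that by simp
    then show "b = c" using b c by (intro PiE_ext[of b "{..<n}" _ c]) auto
  qed
  then show ?thesis unfolding finite_free_def by (intro exI[of _ n] exI[of _ "\<lambda>i. x [^] i"]) auto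
qed

end

section \<open>Transport of monogenic algebras along isomorphisms\<close>

lemma monogenic_iso:
  assumes "monogenic R S \<phi> x n a" "f \<in> ring_iso S S'" "cring S'"
  shows "monogenic R S' (f \<circ> \<phi>) (f x) n a"
proof -
  interpret A: monogenic R S \<phi> x n a by fact
  interpret S': cring S' by fact
  have f: "f \<in> ring_hom S S'" "f ` carrier S = carrier S'" "inj_on f (carrier S)"
    using assms(2) by (auto simp: ring_iso_def bij_betw_def)
  interpret f: ring_hom_cring S S' f
    using f A.S.is_cring S'.is_cring by (simp add: ring_hom_cring_def ring_hom_cring_axioms_def)
  have pt: "pointed_algebra R S' (f \<circ> \<phi>) (f x)"
    by (intro pointed_algebra.intro pointed_algebra_axioms.intro A.R.is_cring S'.is_cring
        ring_hom_trans[OF A.\<phi> f(1)]) simp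
  interpret B: pointed_algebra R S' "f \<circ> \<phi>" "f x" by (rule pt)
  have val: "f (A.val d c) = B.val d c" if "c \<in> UNIV \<rightarrow> carrier R" for c d
    using pointed_algebra_hom[OF A.pointed_algebra_axioms pt f(1), of id c d] that by simp
  show ?thesis
  proof (intro monogenic.intro monogenic_axioms.intro pt A.a)
    show "f x [^]\<^bsub>S'\<^esub> n \<oplus>\<^bsub>S'\<^esub> B.val n a = \<zero>\<^bsub>S'\<^esub>"
      using arg_cong[OF A.root, of f] val[OF A.a] A.val_closed[OF A.a] by simp
    show "carrier S' \<subseteq> B.below n"
    proof
      fix t assume "t \<in> carrier S'"
      then obtain s where s: "s \<in> carrier S" "t = f s" using f(2) by (metis imageE)
      then obtain c where c: "c \<in> UNIV \<rightarrow> carrier R" "s = A.val n c" using A.spanning by (auto simp: A.below_def)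
      then show "t \<in> B.below n" using s val[OF c(1)] B.val_below[OF c(1)] by simp
    qed
    fix c i assume c: "c \<in> UNIV \<rightarrow> carrier R" "B.val n c = \<zero>\<^bsub>S'\<^esub>" "i < n"
    have "f (A.val n c) = f \<zero>\<^bsub>S\<^esub>" using val[OF c(1)] c(2) by simp
    then have "A.val n c = \<zero>\<^bsub>S\<^esub>" using inj_onD[OF f(3)] A.val_closed[OF c(1)] by simp
    then show "c i = \<zero>\<^bsub>R\<^esub>" using A.independent[OF c(1) _ c(3)] by simp
  qed
qed

text \<open>Only the values of \<phi>' on the image of g are assumed, and g is surjective, so that
  \<phi>' is a homomorphism is a consequence. This suits maps that are given by a choice of
  representatives, such as \<open>localization_map\<close>, and also the restriction of a
  homomorphism to the carrier.\<close>

lemma monogenic_base_iso: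
  assumes "monogenic R S \<phi> x n a" "g \<in> ring_iso R R'" "cring R'"
    and \<phi>': "\<And>r. r \<in> carrier R \<Longrightarrow> \<phi>' (g r) = \<phi> r"
  shows "monogenic R' S \<phi>' x n (g \<circ> a)"
proof -
  interpret A: monogenic R S \<phi> x n a by fact
  interpret R': cring R' by fact
  have g: "g \<in> ring_hom R R'" "g ` carrier R = carrier R'" "inj_on g (carrier R)"
    using assms(2) by (auto simp: ring_iso_def bij_betw_def)
  interpret g: ring_hom_cring R R' g
    using g A.R.is_cring R'.is_cring by (simp add: ring_hom_cring_def ring_hom_cring_axioms_def)
  have sur: "\<exists>r\<in>carrier R. g r = t" if "t \<in> carrier R'" for t using that g(2) by (metis imageE)
  have hom: "\<phi>' \<in> ring_hom R' S"
  proof (rule ring_hom_memI)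
    fix b assume "b \<in> carrier R'"
    then obtain f where "f \<in> carrier R" "g f = b" using sur by blast
    then show "\<phi>' b \<in> carrier S" using \<phi>'[of f] by simp
  next
    fix b c assume "b \<in> carrier R'" "c \<in> carrier R'"
    then obtain r s where fg: "r \<in> carrier R" "g r = b" "s \<in> carrier R" "g s = c" using sur by metis
    show "\<phi>' (b \<otimes>\<^bsub>R'\<^esub> c) = \<phi>' b \<otimes>\<^bsub>S\<^esub> \<phi>' c"
      using \<phi>'[of r] \<phi>'[of s] \<phi>'[of "r \<otimes>\<^bsub>R\<^esub> s"] fg by simp
    show "\<phi>' (b \<oplus>\<^bsub>R'\<^esub> c) = \<phi>' b \<oplus>\<^bsub>S\<^esub> \<phi>' c"
      using \<phi>'[of r] \<phi>'[of s] \<phi>'[of "r \<oplus>\<^bsub>R\<^esub> s"] fg by simp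
  next
    show "\<phi>' \<one>\<^bsub>R'\<^esub> = \<one>\<^bsub>S\<^esub>" using \<phi>'[of "\<one>\<^bsub>R\<^esub>"] by simp
  qed
  have pt: "pointed_algebra R' S \<phi>' x"
    by (intro pointed_algebra.intro pointed_algebra_axioms.intro A.S.is_cring R'.is_cring hom A.x)
  interpret B: pointed_algebra R' S \<phi>' x by (rule pt)
  have val: "A.val d c = B.val d (g \<circ> c)" if "c \<in> UNIV \<rightarrow> carrier R" for c d
    using pointed_algebra_hom[OF A.pointed_algebra_axioms pt _ _ _ _ that, of id g d] \<phi>' g(1)
    by (auto simp: ring_hom_def)
  have lift: "\<exists>b\<in>UNIV \<rightarrow> carrier R. c = g \<circ> b" if "c \<in> UNIV \<rightarrow> carrier R'" for c :: "nat \<Rightarrow> _"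
  proof -
    have "\<forall>i. \<exists>r. r \<in> carrier R \<and> g r = c i" using sur that by blast
    then obtain b where "\<forall>i. b i \<in> carrier R \<and> g (b i) = c i" by metis
    then show ?thesis by (intro bexI[of _ b]) (auto simp: fun_eq_iff)
  qed
  show ?thesis
  proof (intro monogenic.intro monogenic_axioms.intro pt)
    show "g \<circ> a \<in> UNIV \<rightarrow> carrier R'" using A.a by (auto simp: Pi_iff)
    show "x [^]\<^bsub>S\<^esub> n \<oplus>\<^bsub>S\<^esub> B.val n (g \<circ> a) = \<zero>\<^bsub>S\<^esub>" using A.root val[OF A.a] by simp
    show "carrier S \<subseteq> B.below n"
    proof
      fix s assume "s \<in> carrier S"
      then obtain c where c: "c \<in> UNIV \<rightarrow> carrier R" "s = A.val n c" using A.spanning by (auto simp: A.below_def)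
      have "g \<circ> c \<in> UNIV \<rightarrow> carrier R'" using c(1) by (auto simp: Pi_iff)
      from B.val_below[OF this, of n] show "s \<in> B.below n" using val[OF c(1)] c(2) by simp
    qed
    fix c i assume c: "c \<in> UNIV \<rightarrow> carrier R'" "B.val n c = \<zero>\<^bsub>S\<^esub>" "i < n"
    obtain b where b: "b \<in> UNIV \<rightarrow> carrier R" "c = g \<circ> b" using lift[OF c(1)] by blast
    have "A.val n b = \<zero>\<^bsub>S\<^esub>" using val[OF b(1)] c(2) b(2) by simp
    then have "b i = \<zero>\<^bsub>R\<^esub>" by (rule A.independent[OF b(1) _ c(3)])
    then show "c i = \<zero>\<^bsub>R'\<^esub>" using b(2) by simp
  qed
qed

declare One_nat_def [simp]

section \<open>Finiteness properties of monogenic algebras\<close>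

lemma (in abelian_group) add_minus_exchange:
  assumes "t \<in> carrier G" "u \<in> carrier G" "y \<in> carrier G"
  shows "(t \<ominus> u) \<oplus> (y \<oplus> u) = y \<oplus> t"
proof -
  have "(t \<oplus> v) \<oplus> (y \<oplus> u) = (y \<oplus> t) \<oplus> (v \<oplus> u)" if "v \<in> carrier G" for v
    using assms that by (simp add: a_ac)
  from this[of "\<ominus> u"] show ?thesis using assms by (simp add: minus_eq l_neg)
qed

context pointed_algebra
begin

text \<open>As in Hilbert's basis theorem: the ideal of leading coefficients of the elements of \<open>J\<close> of
  degree \<open>d\<close>.\<close>

definition "leading J d = {r \<in> carrier R. \<exists>l\<in>below d. \<phi> r \<otimes> x [^] d \<oplus> l \<in> J}"

lemma leadingI:
  "r \<in> carrier R \<Longrightarrow> l \<in> below d \<Longrightarrow> \<phi> r \<otimes> x [^] d \<oplus> l \<in> J \<Longrightarrow> r \<in> leading J d"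
  unfolding leading_def by auto

lemma leading_ideal:
  assumes "ideal J S" shows "ideal (leading J d) R"
proof -
  interpret J: ideal J S by fact
  have add: "r \<oplus>\<^bsub>R\<^esub> s \<in> leading J d" if rs: "r \<in> leading J d" "s \<in> leading J d" for r s
  proof -
    obtain l m where lm: "r \<in> carrier R" "l \<in> below d" "\<phi> r \<otimes> x [^] d \<oplus> l \<in> J"
      "s \<in> carrier R" "m \<in> below d" "\<phi> s \<otimes> x [^] d \<oplus> m \<in> J" using rs by (auto simp: leading_def)
    have "\<phi> (r \<oplus>\<^bsub>R\<^esub> s) \<otimes> x [^] d \<oplus> (l \<oplus> m)
        = (\<phi> r \<otimes> x [^] d \<oplus> l) \<oplus> (\<phi> s \<otimes> x [^] d \<oplus> m)"
      using lm(1,4) below_closed[OF lm(2)] below_closed[OF lm(5)] by (simp add: S.l_distr S.a_ac)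
    also have "\<dots> \<in> J" using lm(3,6) by (rule J.a_closed)
    finally show ?thesis using lm by (intro leadingI[OF _ add_below[OF lm(2,5)]]) auto
  qed
  have mult: "r \<otimes>\<^bsub>R\<^esub> s \<in> leading J d" if rs: "r \<in> carrier R" "s \<in> leading J d" for r s
  proof -
    obtain m where m: "s \<in> carrier R" "m \<in> below d" "\<phi> s \<otimes> x [^] d \<oplus> m \<in> J"
      using rs by (auto simp: leading_def)
    have "\<phi> (r \<otimes>\<^bsub>R\<^esub> s) \<otimes> x [^] d \<oplus> \<phi> r \<otimes> m = \<phi> r \<otimes> (\<phi> s \<otimes> x [^] d \<oplus> m)"
      using rs(1) m(1) below_closed[OF m(2)] by (simp add: S.r_distr S.m_assoc)
    also have "\<dots> \<in> J" using m(3) rs(1) by (intro J.I_l_closed) auto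
    finally show ?thesis using m rs(1) by (intro leadingI[OF _ smult_below[OF m(2) rs(1)]]) auto
  qed
  have sub: "leading J d \<subseteq> carrier R" by (auto simp: leading_def)
  have zero: "\<zero>\<^bsub>R\<^esub> \<in> leading J d"
    by (rule leadingI[OF R.zero_closed zero_below[of d]]) simp
  have neg: "\<ominus>\<^bsub>R\<^esub> r \<in> leading J d" if "r \<in> leading J d" for r
    using mult[OF _ that, of "\<ominus>\<^bsub>R\<^esub> \<one>\<^bsub>R\<^esub>"] subsetD[OF sub that] by (simp add: R.l_minus)
  have "subgroup (leading J d) (add_monoid R)"
    using sub zero add neg
    by (intro group.subgroupI[OF R.a_group]) (auto simp: a_inv_def[symmetric])
  moreover have "s \<otimes>\<^bsub>R\<^esub> r \<in> leading J d" if "r \<in> carrier R" "s \<in> leading J d" for r s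
    using mult[OF that] R.m_comm[OF that(1) subsetD[OF sub that(2)]] by simp
  ultimately show ?thesis using mult by (intro idealI R.ring_axioms)
qed

text \<open>An element of \<open>J\<close> of degree at most d has a leading coefficient that also
  occurs, in degree d, in the ideal generated by \<open>?F\<close>. Subtracting the corresponding
  element leaves something in \<open>J\<close> of degree below d, which the previous generators
  produce.\<close>

lemma noetherian_below:
  assumes noeth: "noetherian_ring R" and J: "ideal J S"
  shows "\<exists>F\<subseteq>J. finite F \<and> J \<inter> below d \<subseteq> Idl F"
proof (induction d)
  interpret J: ideal J S by fact
  case 0
  have "below 0 = {\<zero>}" using zero_below[of 0] by (auto simp: below_def)
  moreover have "\<zero> \<in> Idl {}" using S.genideal_ideal[of "{}"] by (simp add: additive_subgroup.zero_closed ideal.axioms(1))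
  ultimately show ?case by (intro exI[of _ "{}"]) auto
next
  interpret J: ideal J S by fact
  case (Suc d)
  then obtain F where F: "F \<subseteq> J" "finite F" "J \<inter> below d \<subseteq> Idl F" by blast
  obtain G where G: "G \<subseteq> carrier R" "finite G" "leading J d = Idl\<^bsub>R\<^esub> G"
    using noetherian_ring.finetely_gen[OF noeth leading_ideal[OF J]] by metis
  have "G \<subseteq> leading J d" unfolding G(3) by (rule R.genideal_self[OF G(1)])
  then have "\<forall>r\<in>G. \<exists>l. l \<in> below d \<and> \<phi> r \<otimes> x [^] d \<oplus> l \<in> J" by (auto simp: leading_def)
  from bchoice[OF this] obtain l where l: "\<forall>r\<in>G. l r \<in> below d \<and> \<phi> r \<otimes> x [^] d \<oplus> l r \<in> J" by blast
  let ?F = "F \<union> (\<lambda>r. \<phi> r \<otimes> x [^] d \<oplus> l r) ` G"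
  have FJ: "?F \<subseteq> J" using F(1) l by auto
  have FS: "?F \<subseteq> carrier S" using FJ J.a_subset by blast
  interpret K: ideal "Idl ?F" S by (rule S.genideal_ideal[OF FS])
  have KJ: "Idl ?F \<subseteq> J" by (rule S.genideal_minimal[OF J FJ])
  have selfK: "?F \<subseteq> Idl ?F" by (rule S.genideal_self[OF FS])
  have FK: "Idl F \<subseteq> Idl ?F" using selfK by (intro S.genideal_minimal[OF K.is_ideal]) auto
  have "G \<subseteq> leading (Idl ?F) d"
  proof
    fix r assume r: "r \<in> G"
    then have "\<phi> r \<otimes> x [^] d \<oplus> l r \<in> Idl ?F" using selfK by auto
    then show "r \<in> leading (Idl ?F) d" using r l G(1) by (intro leadingI[of r "l r"]) auto
  qed
  then have lead: "leading J d \<subseteq> leading (Idl ?F) d"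
    unfolding G(3) by (rule R.genideal_minimal[OF leading_ideal[OF K.is_ideal]])
  have "s \<in> Idl ?F" if s: "s \<in> J" "s \<in> below (Suc d)" for s
  proof -
    obtain r t where r: "r \<in> carrier R" "t \<in> below d" "s = \<phi> r \<otimes> x [^] d \<oplus> t"
      using s(2) unfolding below_Suc by blast
    have "r \<in> leading J d" using s(1) r by (intro leadingI[of r t]) auto
    then have "r \<in> leading (Idl ?F) d" using lead by blast
    then obtain u where u: "u \<in> below d" "\<phi> r \<otimes> x [^] d \<oplus> u \<in> Idl ?F" by (auto simp: leading_def)
    have tu: "t \<in> carrier S" "u \<in> carrier S" using below_closed r(2) u(1) by auto
    have y: "\<phi> r \<otimes> x [^] d \<in> carrier S" using r(1) by simp
    have shifted: "(t \<ominus> u) \<oplus> (\<phi> r \<otimes> x [^] d \<oplus> u) = s"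
      unfolding r(3) by (rule S.add_minus_exchange[OF tu y])
    have eq: "s \<ominus> (\<phi> r \<otimes> x [^] d \<oplus> u) = t \<ominus> u"
    proof -
      have w: "\<phi> r \<otimes> x [^] d \<oplus> u \<in> carrier S" "t \<ominus> u \<in> carrier S" using y tu by auto
      have "((t \<ominus> u) \<oplus> (\<phi> r \<otimes> x [^] d \<oplus> u)) \<oplus> \<ominus> (\<phi> r \<otimes> x [^] d \<oplus> u) = t \<ominus> u"
        using w by (simp only: S.a_assoc S.a_inv_closed S.r_neg S.r_zero)
      then show ?thesis unfolding shifted S.minus_eq[of s] .
    qed
    have "s \<ominus> (\<phi> r \<otimes> x [^] d \<oplus> u) \<in> J" using s(1) u(2) KJ by (intro J.a_minus_closed) auto
    then have "t \<ominus> u \<in> J \<inter> below d" unfolding eq using r(2) u(1) by (auto intro: diff_below)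
    then have "t \<ominus> u \<in> Idl ?F" using F(3) FK by blast
    then have "(t \<ominus> u) \<oplus> (\<phi> r \<otimes> x [^] d \<oplus> u) \<in> Idl ?F" using u(2) by (rule K.a_closed)
    then show ?thesis unfolding shifted .
  qed
  then show ?case using FJ F(2) G(2) by (intro exI[of _ ?F]) auto
qed

end

context monogenic
begin

text \<open>The covering ring stays among the Noetherian ones. As \<open>S\<close> is spanned by
  powers below n, the filtration of an ideal by degree ends after n steps, so finitely many leading
  ideals have to be generated.\<close>

lemma noetherian:
  assumes "noetherian_ring R" shows "noetherian_ring S"
proof (rule S.noetherian_ringI)
  fix J assume J: "ideal J S"
  interpret J: ideal J S by fact
  obtain F where F: "F \<subseteq> J" "finite F" "J \<inter> below n \<subseteq> Idl F" using noetherian_below[OF assms J] by blast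
  have "J \<subseteq> Idl F" using F(3) spanning J.a_subset by blast
  moreover have "Idl F \<subseteq> J" by (rule S.genideal_minimal[OF J F(1)])
  ultimately show "\<exists>A\<subseteq>carrier S. finite A \<and> J = Idl A"
    using F(1,2) J.a_subset by (intro exI[of _ F]) auto
qed

text \<open>First the algebra and then the base ring are replaced by their localisations at 1, both
  times along an isomorphism.\<close>

lemma finite_free_localization:
  shows "finite_free (localization R {\<one>\<^bsub>R\<^esub>}) (localization_map \<phi> S {\<one>}) (localization S {\<one>})"
proof -
  note LS = localization_at_one[OF S.is_cring] and LR = localization_at_one[OF R.is_cring]
  have m: "monogenic R (localization S {\<one>}) ((\<lambda>r. loc_frac S {\<one>} r \<one>) \<circ> \<phi>) (loc_frac S {\<one>} x \<one>) n a"
    by (rule monogenic_iso[OF monogenic_axioms LS(3) regular_localization.cring_L[OF LS(1)]])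
  have map: "localization_map \<phi> S {\<one>} (loc_frac R {\<one>\<^bsub>R\<^esub>} r \<one>\<^bsub>R\<^esub>) = ((\<lambda>r. loc_frac S {\<one>} r \<one>) \<circ> \<phi>) r"
    if "r \<in> carrier R" for r
    using that by (simp add: LR(4) localization_map_def)
  have "monogenic (localization R {\<one>\<^bsub>R\<^esub>}) (localization S {\<one>}) (localization_map \<phi> S {\<one>})
      (loc_frac S {\<one>} x \<one>) n ((\<lambda>r. loc_frac R {\<one>\<^bsub>R\<^esub>} r \<one>\<^bsub>R\<^esub>) \<circ> a)"
    by (rule monogenic_base_iso[OF m LR(3) regular_localization.cring_L[OF LR(1)] map])
  then show ?thesis by (rule monogenic.finite_free)
qed

end

lemma (in cring) spec_cover_one: "spec_cover R {\<one>}"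
proof -
  have "\<one> \<notin> p" if "primeideal p R" for p
    using that primeideal.I_notcarr[OF that] ideal.one_imp_carrier[of p R]
    by (auto simp: primeideal_def)
  then show ?thesis by (auto simp: spec_cover_def)
qed

lemma monogenic_finite_locally_free:
  assumes "monogenic A B \<phi> x n a" shows "finite_locally_free A \<phi> B"
proof -
  interpret monogenic A B \<phi> x n a by fact
  show ?thesis unfolding finite_locally_free_def
    using R.spec_cover_one finite_free_localization localization_at_one(2)[OF R.is_cring]
      localization_at_one(2)[OF S.is_cring]
    by (intro exI[of _ "{\<one>\<^bsub>A\<^esub>}"]) simp
qed

section \<open>Monogenic algebras over a field have dimension zero\<close>

locale monogenic_field = monogenic + R: field R +
  assumes positive: "0 < n"
begin

text \<open>With 0 < n the index 0 has a uniquely determined coefficient. In the zero ring the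
  constant coefficient function 1 would have value 0, whence 1 = 0 in the field.\<close>

lemma nontrivial: "\<one> \<noteq> \<zero>"
proof
  assume one: "\<one> = \<zero>"
  have "val n (\<lambda>i. \<one>\<^bsub>R\<^esub>) \<in> carrier S" by (rule val_closed) auto
  then have "val n (\<lambda>i. \<one>\<^bsub>R\<^esub>) = \<zero>" using one by (metis S.l_null S.l_one)
  from independent[OF _ this positive] show False by simp
qed

definition "degree_set J = {d. \<exists>l\<in>below d. x [^] d \<oplus> l \<in> J}"

text \<open>The degree of the monic generator of the preimage of \<open>J\<close> in the polynomial
  ring over the field \<open>R\<close>; the defining equation of x bounds it by n.\<close>

definition "least_degree J = (LEAST d. d \<in> degree_set J)"

lemma least_degree:
  assumes "ideal J S"
  shows "\<exists>l\<in>below (least_degree J). x [^] least_degree J \<oplus> l \<in> J"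
    and "d \<in> degree_set J \<Longrightarrow> least_degree J \<le> d"
    and "least_degree J \<le> n"
proof -
  have n: "n \<in> degree_set J"
    unfolding degree_set_def using val_below[OF a, of n] root
      additive_subgroup.zero_closed[OF ideal.axioms(1)[OF assms]]
    by (intro CollectI bexI[of _ "val n a"]) auto
  then have "least_degree J \<in> degree_set J" unfolding least_degree_def by (rule LeastI)
  then show "\<exists>l\<in>below (least_degree J). x [^] least_degree J \<oplus> l \<in> J" by (simp add: degree_set_def)
  show "d \<in> degree_set J \<Longrightarrow> least_degree J \<le> d" unfolding least_degree_def by (rule Least_le)
  then show "least_degree J \<le> n" using n unfolding least_degree_def by (simp add: Least_le)
qed

text \<open>Over a field a nonzero leading coefficient can be scaled to 1. A nonzero element of
  \<open>J\<close> of too small degree would thus produce a monic one, against minimality.\<close>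

lemma below_least_degree:
  assumes J: "ideal J S"
  shows "d \<le> least_degree J \<Longrightarrow> s \<in> below d \<Longrightarrow> s \<in> J \<Longrightarrow> s = \<zero>"
proof (induction d arbitrary: s)
  case 0 then show ?case by (auto simp: below_def)
next
  case (Suc d)
  interpret J: ideal J S by (rule J)
  obtain r l where r: "r \<in> carrier R" "l \<in> below d" "s = \<phi> r \<otimes> x [^] d \<oplus> l"
    using Suc.prems(2) unfolding below_Suc by blast
  have "r = \<zero>\<^bsub>R\<^esub>"
  proof (rule ccontr)
    assume "r \<noteq> \<zero>\<^bsub>R\<^esub>"
    then have u: "r \<in> Units R" using r(1) by (simp add: R.field_Units)
    then have inv: "inv\<^bsub>R\<^esub> r \<in> carrier R" "inv\<^bsub>R\<^esub> r \<otimes>\<^bsub>R\<^esub> r = \<one>\<^bsub>R\<^esub>" by simp_all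
    have "\<phi> (inv\<^bsub>R\<^esub> r) \<otimes> s = \<phi> (inv\<^bsub>R\<^esub> r \<otimes>\<^bsub>R\<^esub> r) \<otimes> x [^] d \<oplus> \<phi> (inv\<^bsub>R\<^esub> r) \<otimes> l"
      unfolding r(3) using inv(1) r(1) below_closed[OF r(2)] by (simp add: S.r_distr S.m_assoc)
    also have "\<dots> = x [^] d \<oplus> \<phi> (inv\<^bsub>R\<^esub> r) \<otimes> l" using inv(2) by simp
    finally have "x [^] d \<oplus> \<phi> (inv\<^bsub>R\<^esub> r) \<otimes> l \<in> J"
      using J.I_l_closed[OF Suc.prems(3), of "\<phi> (inv\<^bsub>R\<^esub> r)"] inv(1) by simp
    then have "d \<in> degree_set J" unfolding degree_set_def using smult_below[OF r(2) inv(1)] by blast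
    then show False using least_degree(2)[OF J] Suc.prems(1) by force
  qed
  then have "s = l" using r below_closed[OF r(2)] by simp
  then show ?case using Suc.IH[of l] Suc.prems r(2) by simp
qed

text \<open>Let \<open>f\<close> and \<open>g\<close> be monic of least degree in \<open>q\<close> and in \<open>q'\<close>. Division gives \<open>f = g h\<close> with \<open>h\<close> monic;
  if \<open>g\<close> has smaller degree than \<open>f\<close>, then \<open>g\<close> and \<open>h\<close> cannot be in \<open>q\<close> unless \<open>g = 1\<close>.\<close>

lemma primes_incomparable:
  assumes q: "primeideal q S" and q': "primeideal q' S" and sub: "q \<subseteq> q'"
  shows "q = q'"
proof (rule ccontr)
  assume ne: "q \<noteq> q'"
  interpret Q: primeideal q S by (rule q)
  interpret Q': primeideal q' S by (rule q')
  let ?D = "least_degree q" and ?D' = "least_degree q'"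
  obtain l where l: "l \<in> below ?D" "x [^] ?D \<oplus> l \<in> q" using least_degree(1)[OF Q.is_ideal] by blast
  obtain l' where l': "l' \<in> below ?D'" "x [^] ?D' \<oplus> l' \<in> q'" using least_degree(1)[OF Q'.is_ideal] by blast
  note cl = below_closed[OF l(1)] below_closed[OF l'(1)]
  have le: "?D' \<le> ?D"
    using least_degree(2)[OF Q'.is_ideal] l sub unfolding degree_set_def by blast
  have minus_q': "b \<in> q'" if "a = b' \<oplus> b" "a \<in> q'" "b' \<in> q'" "b \<in> carrier S" for a b' b
  proof -
    have b': "b' \<in> carrier S" using that(3) Q'.Icarr by blast
    have "a \<ominus> b' = b" unfolding that(1) S.a_comm[OF b' that(4)] using that(4) b'
      by (simp add: S.minus_eq S.a_assoc S.r_neg)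
    then show ?thesis using Q'.a_minus_closed[OF that(2,3)] by simp
  qed
  show False
  proof (cases "?D' = ?D")
    \<comment> \<open>Equal degrees: an element y of q' is divided by the monic f in q. The
      remainder lies in q' and has degree below the least one, so it vanishes and y lies in
      q.\<close>
    case True
    obtain y where y: "y \<in> q'" "y \<notin> q" using ne sub by blast
    have "y \<in> below n" using spanning Q'.Icarr[OF y(1)] by blast
    then have "y \<in> below (?D + n)" using below_mono[of n "?D + n"] by auto
    then obtain h r where h: "h \<in> below n" "r \<in> below ?D" "y = (x [^] ?D \<oplus> l) \<otimes> h \<oplus> r"
      using division[OF l(1)] by blast
    have fh: "(x [^] ?D \<oplus> l) \<otimes> h \<in> q" using Q.I_r_closed[OF l(2) below_closed[OF h(1)]] .
    have "r \<in> q'" by (rule minus_q'[OF h(3) y(1) subsetD[OF sub fh] below_closed[OF h(2)]])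
    then have "r = \<zero>" using below_least_degree[OF Q'.is_ideal _ h(2)] True by simp
    then have "y = (x [^] ?D \<oplus> l) \<otimes> h" using h(3) Q.Icarr[OF fh] by simp
    then show False using fh y(2) by simp
  next
    case False
    define e where "e = ?D - ?D'"
    have De: "?D = ?D' + e" using le by (simp add: e_def)
    have xl: "x [^] e \<otimes> l' \<in> below ?D" using times_power_below[OF l'(1), of e] De by simp
    have "l \<ominus> x [^] e \<otimes> l' \<in> below (?D' + e)" using diff_below[OF l(1) xl] De by simp
    then obtain h0 r where h: "h0 \<in> below e" "r \<in> below ?D'"
      "l \<ominus> x [^] e \<otimes> l' = (x [^] ?D' \<oplus> l') \<otimes> h0 \<oplus> r"
      using division[OF l'(1)] by blast
    note hc = below_closed[OF h(1)] below_closed[OF h(2)]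
    have f: "x [^] ?D \<oplus> l = (x [^] ?D' \<oplus> l') \<otimes> (x [^] e \<oplus> h0) \<oplus> r"
    proof -
      have xl': "x [^] e \<otimes> l' \<in> carrier S" using cl by simp
      have "x [^] e \<otimes> l' \<oplus> (l \<ominus> x [^] e \<otimes> l') = l"
        using xl' cl by (simp add: S.minus_eq S.a_lcomm[of "x [^] e \<otimes> l'" l] S.r_neg)
      then have "x [^] ?D \<oplus> l = x [^] ?D' \<otimes> x [^] e \<oplus> (x [^] e \<otimes> l' \<oplus> (l \<ominus> x [^] e \<otimes> l'))"
        using De by (simp add: S.nat_pow_mult)
      also have "\<dots> = (x [^] ?D' \<oplus> l') \<otimes> (x [^] e \<oplus> h0) \<oplus> r"
        unfolding h(3) using cl hc by (simp add: S.l_distr S.r_distr S.m_ac S.a_ac)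
      finally show ?thesis .
    qed
    have gh: "(x [^] ?D' \<oplus> l') \<otimes> (x [^] e \<oplus> h0) \<in> q'"
      using Q'.I_r_closed[OF l'(2), of "x [^] e \<oplus> h0"] hc by simp
    have "r \<in> q'" by (rule minus_q'[OF f subsetD[OF sub l(2)] gh hc(2)])
    then have "r = \<zero>" using below_least_degree[OF Q'.is_ideal _ h(2)] by simp
    then have "(x [^] ?D' \<oplus> l') \<otimes> (x [^] e \<oplus> h0) \<in> q" using l(2) f Q'.Icarr[OF gh] by simp
    then consider "x [^] ?D' \<oplus> l' \<in> q" | "x [^] e \<oplus> h0 \<in> q"
      using Q.I_prime[of "x [^] ?D' \<oplus> l'" "x [^] e \<oplus> h0"] cl hc by auto
    then show False
    proof cases
      case 1
      then have "?D \<le> ?D'" using least_degree(2)[OF Q.is_ideal] l'(1) unfolding degree_set_def by blast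
      then show False using le False by simp
    next
      \<comment> \<open>The cofactor is monic of degree e, so e is at least the least degree of q,
        which is the least degree of q' plus e. The latter degree is then 0, and the monic element
        of q' is 1.\<close>
      case 2
      then have "?D \<le> e" using least_degree(2)[OF Q.is_ideal] h(1) unfolding degree_set_def by blast
      then have "?D' = 0" using De by simp
      then have "l' = \<zero>" using l'(1) by (auto simp: below_def)
      then have "\<one> \<in> q'" using l'(2) \<open>?D' = 0\<close> by simp
      then show False using Q'.one_imp_carrier Q'.I_notcarr by blast
    qed
  qed
qed

lemma krull_dim_zero: "has_krull_dim S 0"
proof -
  have "prime_chain S 0"
    using S.exists_primeideal[OF nontrivial] unfolding prime_chain_def by auto
  moreover have "m = 0" if chain: "prime_chain S m" for m
  proof (rule ccontr)
    assume m: "m \<noteq> 0"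
    obtain P where P: "\<forall>i\<le>m. primeideal (P i) S" "\<forall>i<m. P i \<subset> P (Suc i)"
      using chain unfolding prime_chain_def by blast
    have "P 0 = P (Suc 0)" using P m by (intro primes_incomparable) auto
    moreover have "P 0 \<subset> P (Suc 0)" using P(2) m by blast
    ultimately show False by blast
  qed
  ultimately show ?thesis unfolding has_krull_dim_def by auto
qed

text \<open>The whole spectrum is already a global complete intersection: one variable, one
  equation, dimension 1 - 1 = 0. The cover by D(1) brings in a localisation, for which presentation
  and dimension are taken from the isomorphic monogenic algebra.\<close>

lemma local_complete_intersection: "local_complete_intersection R \<phi> S"
proof -
  note LS = localization_at_one[OF S.is_cring]
  have m: "monogenic R (localization S {\<one>}) ((\<lambda>r. loc_frac S {\<one>} r \<one>) \<circ> \<phi>) (loc_frac S {\<one>} x \<one>) n a"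
    by (rule monogenic_iso[OF monogenic_axioms LS(3) regular_localization.cring_L[OF LS(1)]])
  then interpret L: monogenic_field R "localization S {\<one>}" "(\<lambda>r. loc_frac S {\<one>} r \<one>) \<circ> \<phi>"
    "loc_frac S {\<one>} x \<one>" n a
    by (intro monogenic_field.intro monogenic_field_axioms.intro positive R.field_axioms)
  have "global_complete_intersection R (\<lambda>r. loc_frac S (powers S \<one>) (\<phi> r) \<one>) (localization S (powers S \<one>))"
    unfolding global_complete_intersection_def LS(2)
    using L.presentation L.krull_dim_zero
    by (intro exI[of _ 1] exI[of _ "[monic_poly R n a]"]) (simp add: o_def)
  then show ?thesis unfolding local_complete_intersection_def
    using S.spec_cover_one by (intro exI[of _ "{\<one>}"]) simp
qed

end

section \<open>Flatness of monogenic algebras\<close>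

definition tensor_generators ::
    "('r, 'k) ring_scheme \<Rightarrow> ('r, 'm, 'l) module_scheme \<Rightarrow> ('r, 'n, 'o) module_scheme \<Rightarrow>
     ('m \<times> 'n \<Rightarrow>\<^sub>0 int) set" where
  "tensor_generators R M N =
      ({frag_of (m \<oplus>\<^bsub>M\<^esub> m', n) - (frag_of (m, n) + frag_of (m', n)) | m m' n.
          m \<in> carrier M \<and> m' \<in> carrier M \<and> n \<in> carrier N} \<union>
       {frag_of (m, n \<oplus>\<^bsub>N\<^esub> n') - (frag_of (m, n) + frag_of (m, n')) | m n n'.
          m \<in> carrier M \<and> n \<in> carrier N \<and> n' \<in> carrier N} \<union>
       {frag_of (r \<odot>\<^bsub>M\<^esub> m, n) - frag_of (m, r \<odot>\<^bsub>N\<^esub> n) | r m n.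
          r \<in> carrier R \<and> m \<in> carrier M \<and> n \<in> carrier N})"

lemma module_tensor_relations_eq:
  "module_tensor_relations R M N
     = generate (free_Abelian_group (carrier M \<times> carrier N)) (tensor_generators R M N)"
  by (simp add: module_tensor_relations_def tensor_generators_def)

lemma tensor_generators_cases:
  assumes "z \<in> tensor_generators R M N"
  obtains m m' n where "m \<in> carrier M" "m' \<in> carrier M" "n \<in> carrier N"
      "z = frag_of (m \<oplus>\<^bsub>M\<^esub> m', n) - (frag_of (m, n) + frag_of (m', n))"
    | m n n' where "m \<in> carrier M" "n \<in> carrier N" "n' \<in> carrier N"
      "z = frag_of (m, n \<oplus>\<^bsub>N\<^esub> n') - (frag_of (m, n) + frag_of (m, n'))"
    | r m n where "r \<in> carrier R" "m \<in> carrier M" "n \<in> carrier N"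
      "z = frag_of (r \<odot>\<^bsub>M\<^esub> m, n) - frag_of (m, r \<odot>\<^bsub>N\<^esub> n)"
  using assms unfolding tensor_generators_def by (elim UnE CollectE exE conjE) auto

lemma frag_induct [consumes 1, case_names zero diff generator]:
  assumes "Poly_Mapping.keys c \<subseteq> S" "P 0"
    "\<And>c d. Poly_Mapping.keys c \<subseteq> S \<Longrightarrow> Poly_Mapping.keys d \<subseteq> S \<Longrightarrow> P c \<Longrightarrow> P d \<Longrightarrow> P (c - d)"
    "\<And>z. z \<in> S \<Longrightarrow> P (frag_of z)"
  shows "P c"
  using assms by (rule free_Abelian_group_induct)

locale two_modules = M: module R M + N: module R N for R and M and N
begin

abbreviation "free \<equiv> free_Abelian_group (carrier M \<times> carrier N)"
abbreviation "relations \<equiv> module_tensor_relations R M N"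

lemma keys_diff_subset: "Poly_Mapping.keys a \<subseteq> A \<Longrightarrow> Poly_Mapping.keys b \<subseteq> A \<Longrightarrow> Poly_Mapping.keys (a - b) \<subseteq> A"
  using keys_diff[of a b] by blast

lemma keys_add_subset: "Poly_Mapping.keys a \<subseteq> A \<Longrightarrow> Poly_Mapping.keys b \<subseteq> A \<Longrightarrow>
    Poly_Mapping.keys (a + b) \<subseteq> A"
  using keys_add[of a b] by blast

lemma generators_free: "tensor_generators R M N \<subseteq> carrier free"
proof
  fix z assume "z \<in> tensor_generators R M N"
  then show "z \<in> carrier free"
  proof (cases rule: tensor_generators_cases)
    case (1 m m' n)
    show ?thesis unfolding 1(4) carrier_free_Abelian_group_iff
      by (intro keys_diff_subset keys_add_subset) (simp_all add: 1)
  next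
    case (2 m n n')
    show ?thesis unfolding 2(4) carrier_free_Abelian_group_iff
      by (intro keys_diff_subset keys_add_subset) (simp_all add: 2)
  next
    case (3 r m n)
    show ?thesis unfolding 3(4) carrier_free_Abelian_group_iff
      by (intro keys_diff_subset) (simp_all add: 3)
  qed
qed

lemma relations_subgroup: "subgroup relations free"
  unfolding module_tensor_relations_eq
  by (rule group.generate_is_subgroup[OF group_free_Abelian_group generators_free])

lemma relations_keys: "c \<in> relations \<Longrightarrow> Poly_Mapping.keys c \<subseteq> carrier M \<times> carrier N"
  using subsetD[OF subgroup.subset[OF relations_subgroup]] by (simp only: carrier_free_Abelian_group_iff)

lemma relations_zero: "0 \<in> relations"
  using subgroup.one_closed[OF relations_subgroup] by simp

lemma relations_add: "c \<in> relations \<Longrightarrow> d \<in> relations \<Longrightarrow> c + d \<in> relations"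
  using subgroup.m_closed[OF relations_subgroup] by simp

lemma relations_minus: "c \<in> relations \<Longrightarrow> - c \<in> relations"
  using subgroup.m_inv_closed[OF relations_subgroup] relations_keys by simp

lemma relations_diff: "c \<in> relations \<Longrightarrow> d \<in> relations \<Longrightarrow> c - d \<in> relations"
  using relations_add[OF _ relations_minus] by simp

lemma generator_relation: "z \<in> tensor_generators R M N \<Longrightarrow> z \<in> relations"
  unfolding module_tensor_relations_eq by (rule generate.incl)

lemma relation_left:
  assumes "m \<in> carrier M" "m' \<in> carrier M" "n \<in> carrier N"
  shows "frag_of (m \<oplus>\<^bsub>M\<^esub> m', n) - (frag_of (m, n) + frag_of (m', n)) \<in> relations"
  using assms by (intro generator_relation) (unfold tensor_generators_def, blast)

lemma relation_right:
  assumes "m \<in> carrier M" "n \<in> carrier N" "n' \<in> carrier N"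
  shows "frag_of (m, n \<oplus>\<^bsub>N\<^esub> n') - (frag_of (m, n) + frag_of (m, n')) \<in> relations"
  using assms by (intro generator_relation) (unfold tensor_generators_def, blast)

lemma relation_smult:
  assumes "r \<in> carrier R" "m \<in> carrier M" "n \<in> carrier N"
  shows "frag_of (r \<odot>\<^bsub>M\<^esub> m, n) - frag_of (m, r \<odot>\<^bsub>N\<^esub> n) \<in> relations"
  using assms by (intro generator_relation) (unfold tensor_generators_def, blast)

lemma relation_zero_left: "n \<in> carrier N \<Longrightarrow> frag_of (\<zero>\<^bsub>M\<^esub>, n) \<in> relations"
  using relations_minus[OF relation_left[of "\<zero>\<^bsub>M\<^esub>" "\<zero>\<^bsub>M\<^esub>" n]] by simp

lemma relation_zero_right: "m \<in> carrier M \<Longrightarrow> frag_of (m, \<zero>\<^bsub>N\<^esub>) \<in> relations"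
  using relations_minus[OF relation_right[of m "\<zero>\<^bsub>N\<^esub>" "\<zero>\<^bsub>N\<^esub>"]] by simp

lemma relation_right_diff:
  assumes "m \<in> carrier M" "n \<in> carrier N" "n' \<in> carrier N"
  shows "frag_of (m, n \<ominus>\<^bsub>N\<^esub> n') - (frag_of (m, n) - frag_of (m, n')) \<in> relations"
proof -
  have "(n \<ominus>\<^bsub>N\<^esub> n') \<oplus>\<^bsub>N\<^esub> n' = n"
    using assms by (simp add: N.M.minus_eq N.M.a_assoc N.M.l_neg)
  then have "frag_of (m, n) - (frag_of (m, n \<ominus>\<^bsub>N\<^esub> n') + frag_of (m, n')) \<in> relations"
    using relation_right[OF assms(1) _ assms(3), of "n \<ominus>\<^bsub>N\<^esub> n'"] assms by simp
  from relations_minus[OF this] show ?thesis by (simp add: algebra_simps)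
qed

lemma coset_eq_iff:
  assumes "Poly_Mapping.keys c \<subseteq> carrier M \<times> carrier N" "Poly_Mapping.keys d \<subseteq> carrier M \<times> carrier N"
  shows "relations #>\<^bsub>free\<^esub> c = relations #>\<^bsub>free\<^esub> d \<longleftrightarrow> c - d \<in> relations"
proof
  have coset: "relations #>\<^bsub>free\<^esub> c = (\<lambda>h. h + c) ` relations" for c
    by (auto simp: r_coset_def)
  assume "relations #>\<^bsub>free\<^esub> c = relations #>\<^bsub>free\<^esub> d"
  moreover have "c \<in> relations #>\<^bsub>free\<^esub> c" unfolding coset using relations_zero by force
  ultimately obtain h where "h \<in> relations" "c = h + d" unfolding coset by blast
  then show "c - d \<in> relations" by simp
next
  have coset: "relations #>\<^bsub>free\<^esub> c = (\<lambda>h. h + c) ` relations" for c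
    by (auto simp: r_coset_def)
  have sub: "relations #>\<^bsub>free\<^esub> c \<subseteq> relations #>\<^bsub>free\<^esub> d" if "c - d \<in> relations" for c d
  proof
    fix z assume "z \<in> relations #>\<^bsub>free\<^esub> c"
    then obtain h where "h \<in> relations" "z = h + c" unfolding coset by blast
    then have "z = (h + (c - d)) + d" "h + (c - d) \<in> relations" using relations_add that by auto
    then show "z \<in> relations #>\<^bsub>free\<^esub> d" unfolding coset by blast
  qed
  assume cd: "c - d \<in> relations"
  then have "d - c \<in> relations" using relations_minus[OF cd] by simp
  then show "relations #>\<^bsub>free\<^esub> c = relations #>\<^bsub>free\<^esub> d" using sub cd by blast
qed

lemma carrier_tensor:
  "carrier (module_tensor R M N)
     = {relations #>\<^bsub>free\<^esub> c | c. Poly_Mapping.keys c \<subseteq> carrier M \<times> carrier N}"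
  unfolding module_tensor_def FactGroup_def RCOSETS_def by auto

lemma mem_coset:
  "d \<in> relations #>\<^bsub>free\<^esub> c \<longleftrightarrow> d - c \<in> relations"
  by (auto simp: r_coset_def) (metis diff_add_cancel)

end

lemma tensor_map_relations:
  assumes "two_modules R M N" "two_modules R M N'" "linear_map R N N' g"
    and c: "c \<in> module_tensor_relations R M N"
  shows "frag_extend (\<lambda>(m, n). frag_of (m, g n)) c \<in> module_tensor_relations R M N'"
proof -
  interpret A: two_modules R M N by fact
  interpret B: two_modules R M N' by fact
  let ?F = "frag_extend (\<lambda>(m, n). frag_of (m, g n))"
  have g: "n \<in> carrier N \<Longrightarrow> g n \<in> carrier N'"
    "n \<in> carrier N \<Longrightarrow> n' \<in> carrier N \<Longrightarrow> g (n \<oplus>\<^bsub>N\<^esub> n') = g n \<oplus>\<^bsub>N'\<^esub> g n'"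
    "r \<in> carrier R \<Longrightarrow> n \<in> carrier N \<Longrightarrow> g (r \<odot>\<^bsub>N\<^esub> n) = r \<odot>\<^bsub>N'\<^esub> g n" for n n' r
    using assms(3) by (auto simp: linear_map_def)
  have gen: "?F z \<in> B.relations" if "z \<in> tensor_generators R M N" for z
    using that
  proof (cases rule: tensor_generators_cases)
    case (1 m m' n)
    then show ?thesis using B.relation_left[of m m' "g n"] g by (simp add: frag_extend_diff frag_extend_add)
  next
    case (2 m n n')
    then show ?thesis using B.relation_right[of m "g n" "g n'"] g by (simp add: frag_extend_diff frag_extend_add)
  next
    case (3 r m n)
    then show ?thesis using B.relation_smult[of r m "g n"] g by (simp add: frag_extend_diff frag_extend_add)
  qed
  show ?thesis using c unfolding module_tensor_relations_eq[of R M N]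
  proof (induction rule: generate.induct)
    case one then show ?case using B.relations_zero by simp
  next
    case (incl h) then show ?case by (rule gen)
  next
    case (inv h)
    then have "inv\<^bsub>A.free\<^esub> h = - h" using subsetD[OF A.generators_free] by simp
    then show ?case using B.relations_minus[OF gen[OF inv]] by (simp add: frag_extend_minus)
  next
    case (eng h1 h2)
    then show ?case using B.relations_add by (simp add: frag_extend_add)
  qed
qed

text \<open>The induced map is defined as the sole element of an image of a coset. Relations go to
  relations, so it can be computed on any representative.\<close>

lemma tensor_map_coset:
  assumes "two_modules R M N" "two_modules R M N'" "linear_map R N N' g"
    and c: "Poly_Mapping.keys c \<subseteq> carrier M \<times> carrier N"
  defines "F \<equiv> frag_extend (\<lambda>(m, n). frag_of (m, g n))"
  shows "module_tensor_map R M N' g (module_tensor_relations R M N #>\<^bsub>free_Abelian_group (carrier M \<times> carrier N)\<^esub> c)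
    = module_tensor_relations R M N' #>\<^bsub>free_Abelian_group (carrier M \<times> carrier N')\<^esub> F c"
    and "Poly_Mapping.keys (F c) \<subseteq> carrier M \<times> carrier N'"
proof -
  interpret A: two_modules R M N by fact
  interpret B: two_modules R M N' by fact
  have g: "n \<in> carrier N \<Longrightarrow> g n \<in> carrier N'" for n using assms(3) by (auto simp: linear_map_def)
  have keys: "Poly_Mapping.keys (F c) \<subseteq> carrier M \<times> carrier N'"
    if "Poly_Mapping.keys c \<subseteq> carrier M \<times> carrier N" for c
  proof -
    have "Poly_Mapping.keys (F c) \<subseteq> (\<Union>z\<in>Poly_Mapping.keys c. Poly_Mapping.keys (case z of (m, n) \<Rightarrow> frag_of (m, g n)))"
      unfolding F_def by (rule keys_frag_extend)
    also have "\<dots> \<subseteq> carrier M \<times> carrier N'" using that g by (auto split: prod.splits)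
    finally show ?thesis .
  qed
  show "Poly_Mapping.keys (F c) \<subseteq> carrier M \<times> carrier N'" by (rule keys[OF c])
  let ?h = "\<lambda>c. B.relations #>\<^bsub>B.free\<^esub> F c"
  have "?h d = ?h c" if d: "d \<in> A.relations #>\<^bsub>A.free\<^esub> c" for d
  proof -
    have dc: "d - c \<in> A.relations" using d A.mem_coset by simp
    have "Poly_Mapping.keys d \<subseteq> carrier M \<times> carrier N"
      using A.keys_add_subset[OF A.relations_keys[OF dc] c] by simp
    moreover have "F d - F c \<in> B.relations"
      using tensor_map_relations[OF assms(1-3) dc] by (simp add: F_def frag_extend_diff)
    ultimately show ?thesis using B.coset_eq_iff keys c by simp
  qed
  then have "?h ` (A.relations #>\<^bsub>A.free\<^esub> c) \<subseteq> {?h c}" by (intro image_subsetI singletonI[THEN back_subst[of "\<lambda>z. z \<in> _"]]) simp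
  moreover have "c \<in> A.relations #>\<^bsub>A.free\<^esub> c" using A.mem_coset A.relations_zero by simp
  ultimately have "?h ` (A.relations #>\<^bsub>A.free\<^esub> c) = {?h c}" by blast
  then show "module_tensor_map R M N' g (A.relations #>\<^bsub>A.free\<^esub> c) = ?h c"
    unfolding module_tensor_map_def F_def by simp
qed

text \<open>As \<open>B\<close> is free on the powers of x, its tensor product with \<open>N\<close>
  is N^n. The coordinate maps send b \<otimes> m to b_i m, and the aim is to show that the relations
  are exactly their common kernel.\<close>

locale monogenic_module = monogenic A B \<phi> x n a + N: module A N
  for A :: "'r ring" and B :: "'s ring" (structure) and \<phi> x n a and N :: "('r, 'q) module"
begin

abbreviation "MB \<equiv> restrict_scalars \<phi> B"

lemma MB_simps [simp]:
  "carrier MB = carrier B" "b \<oplus>\<^bsub>MB\<^esub> c = b \<oplus> c" "r \<odot>\<^bsub>MB\<^esub> b = \<phi> r \<otimes> b" "\<zero>\<^bsub>MB\<^esub> = \<zero>"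
  by (simp_all add: restrict_scalars_def)

lemma module_MB: "module A MB"
proof (rule moduleI[OF R.is_cring])
  show "abelian_group MB"
  proof (rule abelian_groupI)
    fix b assume "b \<in> carrier MB"
    then show "\<exists>c\<in>carrier MB. c \<oplus>\<^bsub>MB\<^esub> b = \<zero>\<^bsub>MB\<^esub>"
      by (intro bexI[of _ "\<ominus> b"]) (simp_all add: S.l_neg)
  qed (simp_all add: S.a_assoc, simp add: S.a_comm)
qed (auto simp: S.l_distr S.r_distr S.m_assoc)

sublocale T: two_modules A MB N
  by (intro two_modules.intro module_MB N.module_axioms)

text \<open>Only the coordinates with index below n are determined by b. The others are arbitrary
  elements of \<open>A\<close>, left over from the choice.\<close>

definition coord :: "'s \<Rightarrow> nat \<Rightarrow> 'r" where
  "coord b = (SOME c. c \<in> UNIV \<rightarrow> carrier A \<and> b = val n c)"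

lemma coord:
  assumes "b \<in> carrier B"
  shows "coord b \<in> UNIV \<rightarrow> carrier A" "val n (coord b) = b" "coord b i \<in> carrier A"
proof -
  have "\<exists>c. c \<in> UNIV \<rightarrow> carrier A \<and> b = val n c" using spanning assms by (auto simp: below_def)
  from someI_ex[OF this] show *: "coord b \<in> UNIV \<rightarrow> carrier A" "val n (coord b) = b"
    unfolding coord_def by auto
  then show "coord b i \<in> carrier A" by auto
qed

lemma coord_unique:
  assumes "c \<in> UNIV \<rightarrow> carrier A" "i < n" shows "coord (val n c) i = c i"
  using coord[OF val_closed[OF assms(1)]] assms by (intro val_inj) auto

lemma coord_add:
  assumes "b \<in> carrier B" "c \<in> carrier B" "i < n"
  shows "coord (b \<oplus> c) i = coord b i \<oplus>\<^bsub>A\<^esub> coord c i"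
proof -
  have "(\<lambda>i. coord b i \<oplus>\<^bsub>A\<^esub> coord c i) \<in> UNIV \<rightarrow> carrier A" using coord(3) assms by auto
  from coord_unique[OF this assms(3)] show ?thesis
    using val_add[OF coord(1)[OF assms(1)] coord(1)[OF assms(2)], of n] coord(2) assms by simp
qed

lemma coord_smult:
  assumes "b \<in> carrier B" "r \<in> carrier A" "i < n"
  shows "coord (\<phi> r \<otimes> b) i = r \<otimes>\<^bsub>A\<^esub> coord b i"
proof -
  have "(\<lambda>i. r \<otimes>\<^bsub>A\<^esub> coord b i) \<in> UNIV \<rightarrow> carrier A" using coord(3) assms by auto
  from coord_unique[OF this assms(3)] show ?thesis
    using val_smult[OF coord(1)[OF assms(1)] assms(2), of n] coord(2) assms by simp
qed

definition coord_hom :: "nat \<Rightarrow> ('s \<times> 'q \<Rightarrow>\<^sub>0 int) \<Rightarrow> 'q" where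
  "coord_hom i = (SOME h. h \<in> hom T.free (add_monoid N) \<and>
     (\<forall>z\<in>carrier B \<times> carrier N. h (frag_of z) = coord (fst z) i \<odot>\<^bsub>N\<^esub> snd z))"

lemma coord_hom:
  "coord_hom i \<in> hom T.free (add_monoid N)"
  "b \<in> carrier B \<Longrightarrow> m \<in> carrier N \<Longrightarrow> coord_hom i (frag_of (b, m)) = coord b i \<odot>\<^bsub>N\<^esub> m"
proof -
  have "(\<lambda>z. coord (fst z) i \<odot>\<^bsub>N\<^esub> snd z) ` (carrier B \<times> carrier N) \<subseteq> carrier (add_monoid N)"
    using coord(3) by auto
  from comm_group.free_Abelian_group_universal[OF N.M.a_comm_group this]
  obtain h where "h \<in> hom (free_Abelian_group (carrier B \<times> carrier N)) (add_monoid N)"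
    "\<And>z. z \<in> carrier B \<times> carrier N \<Longrightarrow> h (frag_of z) = coord (fst z) i \<odot>\<^bsub>N\<^esub> snd z" by metis
  then have "\<exists>h. h \<in> hom T.free (add_monoid N) \<and>
     (\<forall>z\<in>carrier B \<times> carrier N. h (frag_of z) = coord (fst z) i \<odot>\<^bsub>N\<^esub> snd z)" by auto
  from someI_ex[OF this] show "coord_hom i \<in> hom T.free (add_monoid N)"
    "b \<in> carrier B \<Longrightarrow> m \<in> carrier N \<Longrightarrow> coord_hom i (frag_of (b, m)) = coord b i \<odot>\<^bsub>N\<^esub> m"
    unfolding coord_hom_def by auto
qed

lemma coord_hom_simps:
  assumes "Poly_Mapping.keys c \<subseteq> carrier B \<times> carrier N" "Poly_Mapping.keys d \<subseteq> carrier B \<times> carrier N"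
  shows "coord_hom i c \<in> carrier N" "coord_hom i (c + d) = coord_hom i c \<oplus>\<^bsub>N\<^esub> coord_hom i d"
    "coord_hom i (c - d) = coord_hom i c \<ominus>\<^bsub>N\<^esub> coord_hom i d" "coord_hom i 0 = \<zero>\<^bsub>N\<^esub>"
proof -
  interpret h: group_hom T.free "add_monoid N" "coord_hom i"
    using coord_hom(1) by (simp add: group_hom_def group_hom_axioms_def N.M.a_group)
  have cl: "c \<in> carrier T.free" "d \<in> carrier T.free" using assms by auto
  show "coord_hom i c \<in> carrier N" using h.hom_closed[OF cl(1)] by simp
  show "coord_hom i (c + d) = coord_hom i c \<oplus>\<^bsub>N\<^esub> coord_hom i d" using h.hom_mult[OF cl] by simp
  have "inv\<^bsub>T.free\<^esub> d = - d" using assms(2) by simp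
  then have "coord_hom i (- d) = \<ominus>\<^bsub>N\<^esub> coord_hom i d" using h.hom_inv[OF cl(2)] by (simp add: a_inv_def)
  moreover have "- d \<in> carrier T.free" using assms(2) by (simp add: keys_minus)
  ultimately show "coord_hom i (c - d) = coord_hom i c \<ominus>\<^bsub>N\<^esub> coord_hom i d"
    using h.hom_mult[OF cl(1), of "- d"] by (simp add: N.M.minus_eq)
  show "coord_hom i 0 = \<zero>\<^bsub>N\<^esub>" using h.hom_one by simp
qed

lemma coord_hom_relations:
  assumes i: "i < n" and c: "c \<in> T.relations" shows "coord_hom i c = \<zero>\<^bsub>N\<^esub>"
proof -
  interpret h: group_hom T.free "add_monoid N" "coord_hom i"
    using coord_hom(1) by (simp add: group_hom_def group_hom_axioms_def N.M.a_group)
  have gen: "coord_hom i z = \<zero>\<^bsub>N\<^esub>" if "z \<in> tensor_generators A MB N" for z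
    using that
  proof (cases rule: tensor_generators_cases)
    case (1 b b' m)
    then show ?thesis using i coord(3)
      by (simp add: coord_hom_simps coord_hom(2) coord_add N.smult_l_distr N.M.r_neg N.M.minus_eq T.keys_add_subset)
  next
    case (2 b m m')
    then show ?thesis using i coord(3)
      by (simp add: coord_hom_simps coord_hom(2) N.smult_r_distr N.M.r_neg N.M.minus_eq T.keys_add_subset)
  next
    case (3 r b m)
    have "coord (\<phi> r \<otimes> b) i \<odot>\<^bsub>N\<^esub> m = coord b i \<odot>\<^bsub>N\<^esub> (r \<odot>\<^bsub>N\<^esub> m)"
      using 3 i coord(3) by (simp add: coord_smult N.smult_assoc1[symmetric] R.m_comm)
    then show ?thesis using 3 i coord(3) by (simp add: coord_hom_simps coord_hom(2) N.M.r_neg N.M.minus_eq)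
  qed
  show ?thesis using c unfolding module_tensor_relations_eq
  proof (induction rule: generate.induct)
    case one then show ?case using h.hom_one by simp
  next
    case (incl z) then show ?case by (rule gen)
  next
    case (inv z)
    then have "z \<in> carrier T.free" by (rule subsetD[OF T.generators_free])
    then show ?case using gen[OF inv] h.hom_inv[of z] monoid.inv_one[OF group.is_monoid[OF N.M.a_group]] by simp
  next
    case (eng z w)
    then have "z \<in> carrier T.free" "w \<in> carrier T.free"
      by (fold module_tensor_relations_eq) (simp_all only: carrier_free_Abelian_group_iff T.relations_keys)
    then show ?case using eng.IH h.hom_mult[of z w] by simp
  qed
qed

text \<open>The formal sum of the x^i \<otimes> v i over the i below d, kept in the free abelian
  group so that congruence modulo the relations can be spoken of.\<close>

primrec normal_form :: "nat \<Rightarrow> (nat \<Rightarrow> 'q) \<Rightarrow> ('s \<times> 'q \<Rightarrow>\<^sub>0 int)" where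
  "normal_form 0 v = 0"
| "normal_form (Suc d) v = frag_of (x [^] d, v d) + normal_form d v"

lemma normal_form_cong: "(\<And>i. i < d \<Longrightarrow> v i = w i) \<Longrightarrow> normal_form d v = normal_form d w"
  by (induction d) auto

lemma normal_form_diff:
  assumes "v \<in> UNIV \<rightarrow> carrier N" "w \<in> UNIV \<rightarrow> carrier N"
  shows "normal_form d (\<lambda>i. v i \<ominus>\<^bsub>N\<^esub> w i) - (normal_form d v - normal_form d w) \<in> T.relations"
proof (induction d)
  case 0 show ?case using T.relations_zero by simp
next
  case (Suc d)
  have "frag_of (x [^] d, v d \<ominus>\<^bsub>N\<^esub> w d) - (frag_of (x [^] d, v d) - frag_of (x [^] d, w d)) \<in> T.relations"
    using assms by (intro T.relation_right_diff) auto
  from T.relations_add[OF this Suc] show ?case by (simp add: algebra_simps)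
qed

lemma normal_form_pure:
  assumes "c \<in> UNIV \<rightarrow> carrier A" "m \<in> carrier N"
  shows "frag_of (val d c, m) - normal_form d (\<lambda>i. c i \<odot>\<^bsub>N\<^esub> m) \<in> T.relations"
proof (induction d)
  case 0 show ?case using T.relation_zero_left[OF assms(2)] by simp
next
  case (Suc d)
  have cd: "c d \<in> carrier A" using assms by auto
  have 1: "frag_of (\<phi> (c d) \<otimes> x [^] d \<oplus> val d c, m)
      - (frag_of (\<phi> (c d) \<otimes> x [^] d, m) + frag_of (val d c, m)) \<in> T.relations"
    using T.relation_left[of "\<phi> (c d) \<otimes> x [^] d" "val d c" m] cd assms(2) val_closed[OF assms(1)] by simp
  have 2: "frag_of (\<phi> (c d) \<otimes> x [^] d, m) - frag_of (x [^] d, c d \<odot>\<^bsub>N\<^esub> m) \<in> T.relations"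
    using T.relation_smult[of "c d" "x [^] d" m] cd assms(2) by simp
  from T.relations_add[OF T.relations_add[OF 1 2] Suc] show ?case by (simp add: algebra_simps)
qed

text \<open>Induction over the free group. For a pure tensor, b is expanded in powers of x and the
  scalars are moved across to \<open>N\<close>; differences are handled by additivity in the right
  factor.\<close>

lemma normal_form:
  assumes "Poly_Mapping.keys c \<subseteq> carrier B \<times> carrier N"
  shows "c - normal_form n (\<lambda>i. coord_hom i c) \<in> T.relations"
  using assms
proof (induction rule: frag_induct)
  case zero
  have z: "normal_form d (\<lambda>i. \<zero>\<^bsub>N\<^esub>) \<in> T.relations" for d
    by (induction d) (auto intro!: T.relations_zero T.relations_add T.relation_zero_right)
  have "normal_form n (\<lambda>i. coord_hom i 0) = normal_form n (\<lambda>i. \<zero>\<^bsub>N\<^esub>)"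
    using coord_hom_simps(4)[of 0 0] by (intro normal_form_cong) simp
  then show ?case using T.relations_minus[OF z[of n]] by simp
next
  case (diff c d)
  let ?nc = "normal_form n (\<lambda>i. coord_hom i c)" and ?nd = "normal_form n (\<lambda>i. coord_hom i d)"
  have eq: "normal_form n (\<lambda>i. coord_hom i (c - d)) = normal_form n (\<lambda>i. coord_hom i c \<ominus>\<^bsub>N\<^esub> coord_hom i d)"
    using coord_hom_simps(3)[OF diff(1,2)] by (intro normal_form_cong) simp
  have "normal_form n (\<lambda>i. coord_hom i c \<ominus>\<^bsub>N\<^esub> coord_hom i d) - (?nc - ?nd) \<in> T.relations"
    using coord_hom_simps(1)[OF diff(1,2)] coord_hom_simps(1)[OF diff(2,1)] by (intro normal_form_diff) auto
  from T.relations_diff[OF T.relations_diff[OF diff(3,4)] this]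
  show ?case unfolding eq by (simp add: algebra_simps)
next
  case (generator z)
  obtain b m where z: "z = (b, m)" "b \<in> carrier B" "m \<in> carrier N" using generator by (cases z) auto
  have "normal_form n (\<lambda>i. coord_hom i (frag_of z)) = normal_form n (\<lambda>i. coord b i \<odot>\<^bsub>N\<^esub> m)"
    using coord_hom(2)[OF z(2,3)] z(1) by (intro normal_form_cong) simp
  then show ?case using normal_form_pure[OF coord(1)[OF z(2)] z(3), of n] coord(2)[OF z(2)] z(1) by simp
qed

text \<open>Coordinates respect the relations; conversely, if all coordinates vanish, the normal
  form is a sum of terms x^i \<otimes> 0, which are relations.\<close>

lemma relations_iff:
  assumes "Poly_Mapping.keys c \<subseteq> carrier B \<times> carrier N"
  shows "c \<in> T.relations \<longleftrightarrow> (\<forall>i<n. coord_hom i c = \<zero>\<^bsub>N\<^esub>)"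
proof
  assume "\<forall>i<n. coord_hom i c = \<zero>\<^bsub>N\<^esub>"
  then have "normal_form n (\<lambda>i. coord_hom i c) = normal_form n (\<lambda>i. \<zero>\<^bsub>N\<^esub>)"
    by (intro normal_form_cong) simp
  moreover have "normal_form d (\<lambda>i. \<zero>\<^bsub>N\<^esub>) \<in> T.relations" for d
    by (induction d) (auto intro!: T.relations_zero T.relations_add T.relation_zero_right)
  ultimately have "normal_form n (\<lambda>i. coord_hom i c) \<in> T.relations" by simp
  from T.relations_add[OF normal_form[OF assms] this] show "c \<in> T.relations" by simp
qed (use coord_hom_relations in blast)

end

text \<open>In coordinates id \<otimes> g is g applied n times side by side, so it is injective when
  g is.\<close>

lemma monogenic_flat:
  fixes A :: "'r ring" and B :: "'s ring"
  assumes "monogenic A B \<phi> x n a"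
  shows "flat A \<phi> B"
proof -
  interpret monogenic A B \<phi> x n a by fact
  let ?M = "restrict_scalars \<phi> B"
  \<comment> \<open>The lemma \<open>module_MB\<close> lives in a context that fixes some module
    \<open>N\<close>; \<open>A\<close> over itself serves as that module.\<close>
  have self: "module A (\<lparr>carrier = carrier A, monoid.mult = monoid.mult A, one = \<one>\<^bsub>A\<^esub>, ring.zero = \<zero>\<^bsub>A\<^esub>,
     add = add A, smult = monoid.mult A\<rparr>)" (is "module A ?A")
  proof (rule moduleI[OF R.is_cring])
    show "abelian_group ?A"
    proof (rule abelian_groupI)
      fix b assume "b \<in> carrier ?A"
      then show "\<exists>c\<in>carrier ?A. c \<oplus>\<^bsub>?A\<^esub> b = \<zero>\<^bsub>?A\<^esub>"
        by (intro bexI[of _ "\<ominus>\<^bsub>A\<^esub> b"]) (simp_all add: R.l_neg)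
    qed (simp_all add: R.a_assoc, simp add: R.a_comm)
  qed (auto simp: R.l_distr R.r_distr R.m_assoc)
  have "module A ?M"
    using monogenic_module.module_MB[of A B \<phi> x n a ?A] self monogenic_axioms
    by (simp add: monogenic_module_def)
  moreover have "inj_on (module_tensor_map A ?M N' g) (carrier (module_tensor A ?M N))"
    if N: "module A N" "module A N'" and g: "linear_map A N N' g" and inj: "inj_on g (carrier N)"
    for N N' :: "('r, 'r) module" and g
  proof (rule inj_onI)
    interpret K: monogenic_module A B \<phi> x n a N
      using monogenic_axioms N(1) by (simp add: monogenic_module_def)
    interpret L: monogenic_module A B \<phi> x n a N'
      using monogenic_axioms N(2) by (simp add: monogenic_module_def)
    let ?F = "frag_extend (\<lambda>(m, n). frag_of (m, g n))"
    have gN: "m \<in> carrier N \<Longrightarrow> g m \<in> carrier N'"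
      "m \<in> carrier N \<Longrightarrow> m' \<in> carrier N \<Longrightarrow> g (m \<oplus>\<^bsub>N\<^esub> m') = g m \<oplus>\<^bsub>N'\<^esub> g m'"
      "r \<in> carrier A \<Longrightarrow> m \<in> carrier N \<Longrightarrow> g (r \<odot>\<^bsub>N\<^esub> m) = r \<odot>\<^bsub>N'\<^esub> g m" for m m' r
      using g by (auto simp: linear_map_def)
    have g0: "g \<zero>\<^bsub>N\<^esub> = \<zero>\<^bsub>N'\<^esub>"
      using gN(3)[of "\<zero>\<^bsub>A\<^esub>" "\<zero>\<^bsub>N\<^esub>"] gN(1)[of "\<zero>\<^bsub>N\<^esub>"] by simp
    have gminus: "g (m \<ominus>\<^bsub>N\<^esub> m') = g m \<ominus>\<^bsub>N'\<^esub> g m'" if "m \<in> carrier N" "m' \<in> carrier N" for m m'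
    proof -
      have "g m = g (m \<ominus>\<^bsub>N\<^esub> m') \<oplus>\<^bsub>N'\<^esub> g m'"
        using gN(2)[of "m \<ominus>\<^bsub>N\<^esub> m'" m'] that by (simp add: K.N.M.minus_eq K.N.M.a_assoc K.N.M.l_neg)
      then show ?thesis using that gN(1)[of m'] gN(1)[of "m \<ominus>\<^bsub>N\<^esub> m'"]
        by (simp add: L.N.M.minus_eq L.N.M.a_assoc L.N.M.r_neg)
    qed
    note Fkeys = tensor_map_coset(2)[OF K.T.two_modules_axioms L.T.two_modules_axioms g,
      unfolded K.MB_simps]
    have comm: "L.coord_hom i (?F c) = g (K.coord_hom i c)"
      if "Poly_Mapping.keys c \<subseteq> carrier B \<times> carrier N" for c i
      using that
    proof (induction rule: frag_induct)
      case zero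
      then show ?case using K.coord_hom_simps(4)[of 0 0] L.coord_hom_simps(4)[of 0 0] g0 by simp
    next
      case (diff c d)
      then show ?case
        using K.coord_hom_simps[OF diff(1,2)] K.coord_hom_simps(1)[OF diff(2,1)] gminus
          L.coord_hom_simps(3)[OF Fkeys Fkeys, of c d] by (simp add: frag_extend_diff)
    next
      case (generator z)
      then obtain b m where "z = (b, m)" "b \<in> carrier B" "m \<in> carrier N" by (cases z) auto
      \<comment> \<open>The coordinates of b do not depend on the second module, so both contexts
        use the same choice and the claim becomes linearity of g.\<close>
      then show ?case using gN K.coord_hom(2)[of b m] L.coord_hom(2)[of b "g m"] K.coord L.coord
        by (simp add: K.coord_def L.coord_def)
    qed
    fix U V assume U: "U \<in> carrier (module_tensor A ?M N)" and V: "V \<in> carrier (module_tensor A ?M N)"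
      and eq: "module_tensor_map A ?M N' g U = module_tensor_map A ?M N' g V"
    obtain c where c: "Poly_Mapping.keys c \<subseteq> carrier B \<times> carrier N" "U = K.T.relations #>\<^bsub>K.T.free\<^esub> c"
      using U unfolding K.T.carrier_tensor by auto
    obtain d where d: "Poly_Mapping.keys d \<subseteq> carrier B \<times> carrier N" "V = K.T.relations #>\<^bsub>K.T.free\<^esub> d"
      using V unfolding K.T.carrier_tensor by auto
    note mapc = tensor_map_coset(1)[OF K.T.two_modules_axioms L.T.two_modules_axioms g]
    have cd: "Poly_Mapping.keys (c - d) \<subseteq> carrier B \<times> carrier N" by (rule K.T.keys_diff_subset[OF c(1) d(1)])
    have "?F c - ?F d \<in> L.T.relations"
      using eq mapc[of c] mapc[of d] c d Fkeys[of c] Fkeys[of d] L.T.coset_eq_iff[of "?F c" "?F d"] by simp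
    then have "?F (c - d) \<in> L.T.relations" by (simp add: frag_extend_diff)
    then have "\<forall>i<n. g (K.coord_hom i (c - d)) = \<zero>\<^bsub>N'\<^esub>"
      using L.relations_iff[of "?F (c - d)"] Fkeys[of "c - d"] comm[OF cd] cd by simp
    then have "\<forall>i<n. K.coord_hom i (c - d) = \<zero>\<^bsub>N\<^esub>"
      using inj_onD[OF inj] K.coord_hom_simps(1)[OF cd cd] g0 by simp
    then have "c - d \<in> K.T.relations" using K.relations_iff[OF cd] by simp
    then show "U = V" unfolding c(2) d(2) using K.T.coset_eq_iff c(1) d(1) by simp
  qed
  ultimately show ?thesis unfolding flat_def flat_module_def by blast
qed

section \<open>Base change of monogenic algebras\<close>

lemma int_multiple_hom:
  assumes "ring T" shows "(\<lambda>m::int. add_pow T m \<one>\<^bsub>T\<^esub>) \<in> ring_hom \<Z> T"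
proof -
  interpret ring T by fact
  show ?thesis
  proof (rule ring_hom_memI)
    fix m k :: int
    show "add_pow T m \<one>\<^bsub>T\<^esub> \<in> carrier T" by simp
    show "add_pow T (m \<oplus>\<^bsub>\<Z>\<^esub> k) \<one>\<^bsub>T\<^esub> = add_pow T m \<one>\<^bsub>T\<^esub> \<oplus>\<^bsub>T\<^esub> add_pow T k \<one>\<^bsub>T\<^esub>"
      by (simp add: add.int_pow_mult)
    have "add_pow T m \<one>\<^bsub>T\<^esub> \<otimes>\<^bsub>T\<^esub> add_pow T k \<one>\<^bsub>T\<^esub> = add_pow T m (add_pow T k \<one>\<^bsub>T\<^esub>)"
      by (simp add: add_pow_ldistr_int)
    also have "\<dots> = add_pow T (k * m) \<one>\<^bsub>T\<^esub>" by (simp add: add.int_pow_pow)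
    finally show "add_pow T (m \<otimes>\<^bsub>\<Z>\<^esub> k) \<one>\<^bsub>T\<^esub> = add_pow T m \<one>\<^bsub>T\<^esub> \<otimes>\<^bsub>T\<^esub> add_pow T k \<one>\<^bsub>T\<^esub>"
      by (simp add: mult.commute)
  qed simp
qed

lemma comm_monoid_DirProd:
  assumes "cring B" "cring K" shows "comm_monoid (B \<times>\<times> K)"
proof -
  interpret B: cring B by fact
  interpret K: cring K by fact
  show ?thesis
    by (rule comm_monoidI) (auto simp: DirProd_def B.m_assoc K.m_assoc intro: B.m_comm K.m_comm)
qed

section \<open>The tensor product of rings and maps out of it\<close>

locale tensor_setup = A: cring A + B: cring B + K: cring K
  for A :: "('r, 'k) ring_scheme" and B :: "('s, 'l) ring_scheme" and K :: "('c, 'm) ring_scheme" +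
  fixes \<phi> \<psi>
  assumes \<phi>: "\<phi> \<in> ring_hom A B" and \<psi>: "\<psi> \<in> ring_hom A K"
begin

sublocale Z: monoid_algebra_setup \<Z> "B \<times>\<times> K"
  by (intro monoid_algebra_setup.intro int_is_cring comm_monoid_DirProd B.is_cring K.is_cring)

abbreviation "ZZ \<equiv> monoid_algebra \<Z> (B \<times>\<times> K)"
abbreviation "e b k \<equiv> monomial \<Z> (b, k) (1::int)"
abbreviation "rel \<equiv> tensor_relations A B \<phi> K \<psi>"
abbreviation "I \<equiv> Idl\<^bsub>ZZ\<^esub> rel"
abbreviation "S \<equiv> ring_tensor A B \<phi> K \<psi>"
abbreviation "t \<equiv> pure_tensor A B \<phi> K \<psi>"

sublocale ZZ: cring ZZ by (rule Z.cring_monoid_algebra)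

lemma e_closed: "b \<in> carrier B \<Longrightarrow> k \<in> carrier K \<Longrightarrow> e b k \<in> carrier ZZ"
  by (rule Z.monomial_closed) auto

lemma rel_cases:
  assumes "z \<in> rel"
  obtains b b' k where "b \<in> carrier B" "b' \<in> carrier B" "k \<in> carrier K"
      "z = e (b \<oplus>\<^bsub>B\<^esub> b') k \<ominus>\<^bsub>ZZ\<^esub> (e b k \<oplus>\<^bsub>ZZ\<^esub> e b' k)"
    | b k k' where "b \<in> carrier B" "k \<in> carrier K" "k' \<in> carrier K"
      "z = e b (k \<oplus>\<^bsub>K\<^esub> k') \<ominus>\<^bsub>ZZ\<^esub> (e b k \<oplus>\<^bsub>ZZ\<^esub> e b k')"
    | r b k where "r \<in> carrier A" "b \<in> carrier B" "k \<in> carrier K"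
      "z = e (\<phi> r \<otimes>\<^bsub>B\<^esub> b) k \<ominus>\<^bsub>ZZ\<^esub> e b (\<psi> r \<otimes>\<^bsub>K\<^esub> k)"
  using assms unfolding tensor_relations_def Let_def by (elim UnE CollectE exE conjE) auto

lemma hom_closed [simp]: "r \<in> carrier A \<Longrightarrow> \<phi> r \<in> carrier B" "r \<in> carrier A \<Longrightarrow> \<psi> r \<in> carrier K"
  using ring_hom_closed[OF \<phi>] ring_hom_closed[OF \<psi>] by auto

lemma rel_closed: "rel \<subseteq> carrier ZZ"
proof
  fix z assume "z \<in> rel"
  then show "z \<in> carrier ZZ"
    by (cases rule: rel_cases) (simp_all add: e_closed)
qed

sublocale I: ideal I ZZ by (rule ZZ.genideal_ideal[OF rel_closed])

lemma S_eq: "S = ZZ Quot I" by (simp add: ring_tensor_def)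

sublocale S: cring S unfolding S_eq by (rule I.quotient_is_cring[OF ZZ.is_cring])

abbreviation "q \<equiv> (+>\<^bsub>ZZ\<^esub>) I"

lemma q_hom: "q \<in> ring_hom ZZ S" unfolding S_eq by (rule I.rcos_ring_hom)

sublocale q: ring_hom_cring ZZ S q
  using q_hom ZZ.is_cring S.is_cring by (simp add: ring_hom_cring_def ring_hom_cring_axioms_def)

lemma q_surj: "q ` carrier ZZ = carrier S" unfolding S_eq by (rule I.coset_surj)

lemma q_eq:
  assumes "u \<ominus>\<^bsub>ZZ\<^esub> v \<in> rel" "u \<in> carrier ZZ" "v \<in> carrier ZZ" shows "q u = q v"
proof -
  have "u \<ominus>\<^bsub>ZZ\<^esub> v \<in> I" using ZZ.genideal_self[OF rel_closed] assms(1) by blast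
  then have "q (u \<ominus>\<^bsub>ZZ\<^esub> v) = \<zero>\<^bsub>S\<^esub>" unfolding S_eq using I.coset_zero_iff[of "u \<ominus>\<^bsub>ZZ\<^esub> v"] assms by simp
  then have "q u \<ominus>\<^bsub>S\<^esub> q v = \<zero>\<^bsub>S\<^esub>" using assms by (simp add: ZZ.minus_eq S.minus_eq)
  then show ?thesis using assms by simp
qed

lemma t_eq: "t b k = q (e b k)" by (simp add: pure_tensor_def)

lemma t_closed: "b \<in> carrier B \<Longrightarrow> k \<in> carrier K \<Longrightarrow> t b k \<in> carrier S"
  unfolding t_eq by (intro q.hom_closed e_closed)

lemma t_add_left:
  assumes "b \<in> carrier B" "b' \<in> carrier B" "k \<in> carrier K"
  shows "t (b \<oplus>\<^bsub>B\<^esub> b') k = t b k \<oplus>\<^bsub>S\<^esub> t b' k"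
proof -
  have "e (b \<oplus>\<^bsub>B\<^esub> b') k \<ominus>\<^bsub>ZZ\<^esub> (e b k \<oplus>\<^bsub>ZZ\<^esub> e b' k) \<in> rel"
    unfolding tensor_relations_def Let_def using assms by blast
  from q_eq[OF this] show ?thesis using assms by (simp add: t_eq e_closed)
qed

lemma t_add_right:
  assumes "b \<in> carrier B" "k \<in> carrier K" "k' \<in> carrier K"
  shows "t b (k \<oplus>\<^bsub>K\<^esub> k') = t b k \<oplus>\<^bsub>S\<^esub> t b k'"
proof -
  have "e b (k \<oplus>\<^bsub>K\<^esub> k') \<ominus>\<^bsub>ZZ\<^esub> (e b k \<oplus>\<^bsub>ZZ\<^esub> e b k') \<in> rel"
    unfolding tensor_relations_def Let_def using assms by blast
  from q_eq[OF this] show ?thesis using assms by (simp add: t_eq e_closed)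
qed

lemma t_balanced:
  assumes "r \<in> carrier A" shows "t (\<phi> r) \<one>\<^bsub>K\<^esub> = t \<one>\<^bsub>B\<^esub> (\<psi> r)"
proof -
  have "e (\<phi> r \<otimes>\<^bsub>B\<^esub> \<one>\<^bsub>B\<^esub>) \<one>\<^bsub>K\<^esub> \<ominus>\<^bsub>ZZ\<^esub> e \<one>\<^bsub>B\<^esub> (\<psi> r \<otimes>\<^bsub>K\<^esub> \<one>\<^bsub>K\<^esub>) \<in> rel"
    unfolding tensor_relations_def Let_def using assms B.one_closed K.one_closed by blast
  from q_eq[OF this] show ?thesis using assms by (simp add: t_eq e_closed)
qed

lemma t_mult:
  assumes "b \<in> carrier B" "b' \<in> carrier B" "k \<in> carrier K" "k' \<in> carrier K"
  shows "t (b \<otimes>\<^bsub>B\<^esub> b') (k \<otimes>\<^bsub>K\<^esub> k') = t b k \<otimes>\<^bsub>S\<^esub> t b' k'"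
proof -
  have "e b k \<otimes>\<^bsub>ZZ\<^esub> e b' k' = e (b \<otimes>\<^bsub>B\<^esub> b') (k \<otimes>\<^bsub>K\<^esub> k')"
    using Z.monomial_mult[of "(b, k)" "(b', k')" 1 1] assms by (simp add: DirProd_def)
  then show ?thesis using q.hom_mult[of "e b k" "e b' k'"] assms by (simp add: t_eq e_closed)
qed

lemma t_one: "t \<one>\<^bsub>B\<^esub> \<one>\<^bsub>K\<^esub> = \<one>\<^bsub>S\<^esub>"
proof -
  have "e \<one>\<^bsub>B\<^esub> \<one>\<^bsub>K\<^esub> = \<one>\<^bsub>ZZ\<^esub>" using Z.ring_operations(3) by (simp add: DirProd_def)
  then show ?thesis by (simp add: t_eq)
qed

lemma t_left_hom: "(\<lambda>b. t b \<one>\<^bsub>K\<^esub>) \<in> ring_hom B S"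
  using t_mult[of _ _ "\<one>\<^bsub>K\<^esub>" "\<one>\<^bsub>K\<^esub>"]
  by (intro ring_hom_memI) (simp_all add: t_closed t_add_left t_one)

lemma t_right_hom: "t \<one>\<^bsub>B\<^esub> \<in> ring_hom K S"
  using t_mult[of "\<one>\<^bsub>B\<^esub>" "\<one>\<^bsub>B\<^esub>"]
  by (intro ring_hom_memI) (simp_all add: t_closed t_add_right t_one)

lemma t_split: "b \<in> carrier B \<Longrightarrow> k \<in> carrier K \<Longrightarrow> t b k = t \<one>\<^bsub>B\<^esub> k \<otimes>\<^bsub>S\<^esub> t b \<one>\<^bsub>K\<^esub>"
  using t_mult[of "\<one>\<^bsub>B\<^esub>" b k "\<one>\<^bsub>K\<^esub>"] by simp

text \<open>Elements of the monoid ring are sums of integral multiples of pairs. Nonnegative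
  multiples are repeated sums of pure tensors, negative ones are their opposites.\<close>

lemma spanned_by_pure:
  assumes zero: "\<zero>\<^bsub>S\<^esub> \<in> U" and add: "\<And>u v. u \<in> U \<Longrightarrow> v \<in> U \<Longrightarrow> u \<oplus>\<^bsub>S\<^esub> v \<in> U"
    and neg: "\<And>u. u \<in> U \<Longrightarrow> \<ominus>\<^bsub>S\<^esub> u \<in> U"
    and pure: "\<And>b k. b \<in> carrier B \<Longrightarrow> k \<in> carrier K \<Longrightarrow> t b k \<in> U"
  shows "carrier S \<subseteq> U"
proof
  fix s assume "s \<in> carrier S"
  then have "s \<in> q ` carrier ZZ" unfolding q_surj .
  then obtain f where f: "f \<in> carrier ZZ" "s = q f" by (elim imageE)
  have "q f \<in> U" using f(1)
  proof (induction rule: Z.monomial_induct)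
    case (monomial m r)
    obtain b k where m: "m = (b, k)" "b \<in> carrier B" "k \<in> carrier K" using monomial(1) by (cases m) auto
    have cl: "monomial \<Z> m r \<in> carrier ZZ" for r by (rule Z.monomial_closed[OF monomial(1)]) simp
    have sum: "q (monomial \<Z> m (r + r')) = q (monomial \<Z> m r) \<oplus>\<^bsub>S\<^esub> q (monomial \<Z> m r')" for r r'
      using q.hom_add[OF cl[of r] cl[of r']] Z.monomial_add[of r r' m] by simp
    have z: "q (monomial \<Z> m 0) = \<zero>\<^bsub>S\<^esub>" using Z.monomial_zero[of m] by simp
    have pos: "q (monomial \<Z> m (int i)) \<in> U" for i
    proof (induction i)
      case 0 then show ?case using z zero by simp
    next
      case (Suc i)
      have "q (monomial \<Z> m 1) \<in> U" using pure[OF m(2,3)] m(1) by (simp add: t_eq)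
      then show ?case using sum[of 1 "int i"] add[OF _ Suc] by simp
    qed
    show ?case
    proof (cases "r \<ge> 0")
      case True then show ?thesis using pos[of "nat r"] by simp
    next
      case False
      then have r: "q (monomial \<Z> m (- r)) \<in> U" using pos[of "nat (- r)"] by simp
      have "q (monomial \<Z> m r) \<oplus>\<^bsub>S\<^esub> q (monomial \<Z> m (- r)) = \<zero>\<^bsub>S\<^esub>" using sum[of r "- r"] z by simp
      then have "\<ominus>\<^bsub>S\<^esub> q (monomial \<Z> m (- r)) = q (monomial \<Z> m r)"
        using cl by (intro S.minus_equality) auto
      then show ?thesis using neg[OF r] by simp
    qed
  next
    case (add f g)
    then show ?case using assms(2)[of "q f" "q g"] by simp
  qed
  then show "s \<in> U" using f(2) by simp
qed

text \<open>The pairs (b, k) multiply componentwise, so \<beta> b \<gamma> k extends to a ring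
  homomorphism on the monoid ring. It kills the three kinds of relations, hence the ideal they
  generate, and descends to the quotient.\<close>

lemma tensor_hom:
  assumes T: "cring T" and \<beta>: "\<beta> \<in> ring_hom B T" and \<gamma>: "\<gamma> \<in> ring_hom K T"
    and comm: "\<And>r. r \<in> carrier A \<Longrightarrow> \<beta> (\<phi> r) = \<gamma> (\<psi> r)"
  shows "\<exists>h\<in>ring_hom S T. \<forall>b\<in>carrier B. \<forall>k\<in>carrier K. h (t b k) = \<beta> b \<otimes>\<^bsub>T\<^esub> \<gamma> k"
proof -
  interpret T: cring T by fact
  interpret \<beta>: ring_hom_cring B T \<beta>
    using \<beta> B.is_cring T.is_cring by (simp add: ring_hom_cring_def ring_hom_cring_axioms_def)
  interpret \<gamma>: ring_hom_cring K T \<gamma>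
    using \<gamma> K.is_cring T.is_cring by (simp add: ring_hom_cring_def ring_hom_cring_axioms_def)
  interpret H: monoid_algebra_hom \<Z> "B \<times>\<times> K" T "\<lambda>m::int. add_pow T m \<one>\<^bsub>T\<^esub>" "\<lambda>w. \<beta> (fst w) \<otimes>\<^bsub>T\<^esub> \<gamma> (snd w)"
    by (unfold_locales) (auto simp: int_multiple_hom[OF T.ring_axioms] DirProd_def T.m_ac)
  interpret L: ring_hom_cring ZZ T H.lift
    using H.lift_hom ZZ.is_cring T.is_cring by (simp add: ring_hom_cring_def ring_hom_cring_axioms_def)
  have Le: "H.lift (e b k) = \<beta> b \<otimes>\<^bsub>T\<^esub> \<gamma> k" if "b \<in> carrier B" "k \<in> carrier K" for b k
    using H.lift_monomial[of "(b, k)" 1] that by (simp add: T.add.int_pow_1)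
  have diff: "H.lift (u \<ominus>\<^bsub>ZZ\<^esub> v) = \<zero>\<^bsub>T\<^esub>" if "u \<in> carrier ZZ" "v \<in> carrier ZZ" "H.lift u = H.lift v" for u v
    using that by (simp add: ZZ.minus_eq T.r_neg)
  have rel0: "H.lift z = \<zero>\<^bsub>T\<^esub>" if "z \<in> rel" for z
    using that
  proof (cases rule: rel_cases)
    case (1 b b' k)
    show ?thesis unfolding 1(4) using 1(1-3) by (intro diff) (simp_all add: e_closed Le T.l_distr)
  next
    case (2 b k k')
    show ?thesis unfolding 2(4) using 2(1-3) by (intro diff) (simp_all add: e_closed Le T.r_distr)
  next
    case (3 r b k)
    show ?thesis unfolding 3(4) using 3(1-3) comm[OF 3(1)]
      by (intro diff) (simp_all add: e_closed Le T.m_ac)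
  qed
  have "ring_hom_ring ZZ T H.lift"
    by (intro ring_hom_ringI2 H.lift_hom ZZ.ring_axioms T.ring_axioms)
  then have "ideal (a_kernel ZZ T H.lift) ZZ" by (rule ring_hom_ring.kernel_is_ideal)
  moreover have "rel \<subseteq> a_kernel ZZ T H.lift" unfolding a_kernel_def' using rel0 rel_closed by blast
  ultimately have IK: "I \<subseteq> a_kernel ZZ T H.lift" by (rule ZZ.genideal_minimal)
  have "H.lift f = \<zero>\<^bsub>T\<^esub>" if f: "f \<in> carrier ZZ" "q f = \<zero>\<^bsub>S\<^esub>" for f
  proof -
    have "f \<in> I" using I.coset_zero_iff[OF f(1)] f(2) unfolding S_eq by simp
    then show ?thesis using IK unfolding a_kernel_def' by blast
  qed
  from ring_hom_factor[OF ZZ.is_cring S.is_cring T q_hom q_surj H.lift_hom this]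
  obtain h where h: "h \<in> ring_hom S T" "\<And>f. f \<in> carrier ZZ \<Longrightarrow> h (q f) = H.lift f" by blast
  have "h (t b k) = \<beta> b \<otimes>\<^bsub>T\<^esub> \<gamma> k" if "b \<in> carrier B" "k \<in> carrier K" for b k
    unfolding t_eq using h(2)[OF e_closed[OF that]] Le[OF that] by simp
  then show ?thesis using h(1) by blast
qed

end

lemma pval_comp: "pval S (\<gamma> \<circ> \<psi>) x d c = pval S \<gamma> x d (\<psi> \<circ> c)"
  by (induction d) auto

text \<open>A concrete model of the base change: the quotient of K[X] by the image of the equation,
  with a map from \<open>S\<close> supplied by the universal property. It is used to detect
  independence in the tensor product and to find primes in the fibres.\<close>

lemma (in monogenic) extend_scalars:
  fixes K :: "('kk, 'km) ring_scheme"
  assumes K: "cring K" and \<psi>: "\<psi> \<in> ring_hom R K"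
  obtains T :: "((nat \<Rightarrow> nat) \<Rightarrow> 'kk) set ring" and \<gamma> y \<beta>
  where "monogenic K T \<gamma> y n (\<psi> \<circ> a)" "\<beta> \<in> ring_hom S T" "\<beta> x = y"
    "\<And>r. r \<in> carrier R \<Longrightarrow> \<beta> (\<phi> r) = \<gamma> (\<psi> r)"
proof -
  have \<psi>a: "\<psi> \<circ> a \<in> UNIV \<rightarrow> carrier K" using a \<psi> by (auto simp: ring_hom_def Pi_iff)
  obtain T :: "((nat \<Rightarrow> nat) \<Rightarrow> 'kk) set ring" and \<gamma> y where T: "monogenic K T \<gamma> y n (\<psi> \<circ> a)"
    using monogenic_exists[OF K \<psi>a] by blast
  interpret T: monogenic K T \<gamma> y n "\<psi> \<circ> a" by (rule T)
  have pt: "pointed_algebra R T (\<gamma> \<circ> \<psi>) y"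
    by (intro pointed_algebra.intro pointed_algebra_axioms.intro R.is_cring T.S.is_cring
        ring_hom_trans[OF \<psi> T.\<phi>]) simp
  have "y [^]\<^bsub>T\<^esub> n \<oplus>\<^bsub>T\<^esub> pval T (\<gamma> \<circ> \<psi>) y n a = \<zero>\<^bsub>T\<^esub>" unfolding pval_comp by (rule T.root)
  then obtain \<beta> where "\<beta> \<in> ring_hom S T" "\<forall>r\<in>carrier R. \<beta> (\<phi> r) = (\<gamma> \<circ> \<psi>) r" "\<beta> x = y"
    using universal_property[OF pt] by blast
  then show thesis using that[OF T] by simp
qed

text \<open>Pure tensors show that the powers of x \<otimes> 1 span. Independence is not visible
  from generators and relations; it is seen after mapping the tensor product to the concrete model,
  where the powers of y are independent over \<open>K\<close>.\<close>

lemma monogenic_base_change: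
  fixes K :: "('c, 'm) ring_scheme"
  assumes "monogenic A B \<phi> x n a" "cring K" "\<psi> \<in> ring_hom A K"
  shows "monogenic K (ring_tensor A B \<phi> K \<psi>) (pure_tensor A B \<phi> K \<psi> \<one>\<^bsub>B\<^esub>)
           (pure_tensor A B \<phi> K \<psi> x \<one>\<^bsub>K\<^esub>) n (\<psi> \<circ> a)"
proof -
  interpret M: monogenic A B \<phi> x n a by fact
  interpret X: tensor_setup A B K \<phi> \<psi>
    by (intro tensor_setup.intro tensor_setup_axioms.intro M.R.is_cring M.S.is_cring assms(2,3) M.\<phi>)
  have pt: "pointed_algebra K X.S (X.t \<one>\<^bsub>B\<^esub>) (X.t x \<one>\<^bsub>K\<^esub>)"
    by (intro pointed_algebra.intro pointed_algebra_axioms.intro assms(2) X.S.is_cring X.t_right_hom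
        X.t_closed M.x X.K.one_closed)
  interpret P: pointed_algebra K X.S "X.t \<one>\<^bsub>B\<^esub>" "X.t x \<one>\<^bsub>K\<^esub>" by (rule pt)
  have \<psi>c: "\<psi> \<circ> c \<in> UNIV \<rightarrow> carrier K" if "c \<in> UNIV \<rightarrow> carrier A" for c :: "nat \<Rightarrow> _"
    using that X.hom_closed(2) by (auto simp: Pi_iff)
  have \<psi>fun: "\<psi> \<in> carrier A \<rightarrow> carrier K" by auto
  have val: "X.t (M.val d c) \<one>\<^bsub>K\<^esub> = P.val d (\<psi> \<circ> c)" if "c \<in> UNIV \<rightarrow> carrier A" for c d
    using pointed_algebra_hom[OF M.pointed_algebra_axioms pt X.t_left_hom \<psi>fun X.t_balanced refl that] .
  interpret tl: ring_hom_cring B X.S "\<lambda>b. X.t b \<one>\<^bsub>K\<^esub>"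
    using X.t_left_hom M.S.is_cring X.S.is_cring by (simp add: ring_hom_cring_def ring_hom_cring_axioms_def)
  show ?thesis
  proof (intro monogenic.intro monogenic_axioms.intro pt \<psi>c M.a)
    show "X.t x \<one>\<^bsub>K\<^esub> [^]\<^bsub>X.S\<^esub> n \<oplus>\<^bsub>X.S\<^esub> P.val n (\<psi> \<circ> a) = \<zero>\<^bsub>X.S\<^esub>"
      using arg_cong[OF M.root, of "\<lambda>b. X.t b \<one>\<^bsub>K\<^esub>"] val[OF M.a] M.val_closed[OF M.a] by simp
    have pure: "X.t b k \<in> P.below n" if b: "b \<in> carrier B" and k: "k \<in> carrier K" for b k
    proof -
      obtain c where c: "c \<in> UNIV \<rightarrow> carrier A" "b = M.val n c"
        using M.spanning b by (auto simp: M.below_def)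
      have "X.t b \<one>\<^bsub>K\<^esub> \<in> P.below n" unfolding c(2) val[OF c(1)] by (rule P.val_below[OF \<psi>c[OF c(1)]])
      then show ?thesis unfolding X.t_split[OF b k] by (rule P.smult_below[OF _ k])
    qed
    show "carrier X.S \<subseteq> P.below n"
      by (rule X.spanned_by_pure) (simp_all add: P.zero_below P.add_below P.neg_below pure)
    fix c i assume c: "c \<in> UNIV \<rightarrow> carrier K" "P.val n c = \<zero>\<^bsub>X.S\<^esub>" "i < n"
    obtain T :: "((nat \<Rightarrow> nat) \<Rightarrow> 'c) set ring" and \<gamma> y \<beta> where T: "monogenic K T \<gamma> y n (\<psi> \<circ> a)"
      "\<beta> \<in> ring_hom B T" "\<beta> x = y" "\<And>r. r \<in> carrier A \<Longrightarrow> \<beta> (\<phi> r) = \<gamma> (\<psi> r)"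
      using M.extend_scalars[OF assms(2,3)] by metis
    interpret T: monogenic K T \<gamma> y n "\<psi> \<circ> a" by (rule T(1))
    obtain h where h: "h \<in> ring_hom X.S T" "\<forall>b\<in>carrier B. \<forall>k\<in>carrier K. h (X.t b k) = \<beta> b \<otimes>\<^bsub>T\<^esub> \<gamma> k"
      using X.tensor_hom[OF T.S.is_cring T(2) T.\<phi> T(4)] by blast
    interpret h: ring_hom_cring X.S T h
      using h(1) X.S.is_cring T.S.is_cring by (simp add: ring_hom_cring_def ring_hom_cring_axioms_def)
    have "h (X.t \<one>\<^bsub>B\<^esub> k) = \<gamma> k" if "k \<in> carrier K" for k
      using h(2) that ring_hom_one[OF T(2)] by simp
    moreover have "h (X.t x \<one>\<^bsub>K\<^esub>) = y" using h(2) T(3) T.x by simp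
    ultimately have "h (P.val n c) = T.val n c"
      using pointed_algebra_hom[OF pt T.pointed_algebra_axioms h(1), of id c n] c(1) by simp
    then have "T.val n c = \<zero>\<^bsub>T\<^esub>" using c(2) by simp
    then show "c i = \<zero>\<^bsub>K\<^esub>" by (rule T.independent[OF c(1) _ c(3)])
  qed
qed

lemma monogenic_syntomic:
  fixes A :: "'r ring" and B :: "'s ring"
  assumes M: "monogenic A B \<phi> x n a" and n: "0 < n"
  shows "syntomic A \<phi> B"
  unfolding syntomic_def
proof (intro conjI allI impI)
  interpret M: monogenic A B \<phi> x n a by (rule M)
  show "flat A \<phi> B" by (rule monogenic_flat[OF M])
  show "finitely_presented A \<phi> B" unfolding finitely_presented_def using M.presentation by blast
  fix p assume p: "primeideal p A"
  let ?K = "residue_field A p" and ?\<psi> = "residue_map A p"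
  interpret K: field ?K by (rule primeideal.residue_field(1)[OF p])
  have "monogenic ?K (ring_tensor A B \<phi> ?K ?\<psi>) (pure_tensor A B \<phi> ?K ?\<psi> \<one>\<^bsub>B\<^esub>)
      (pure_tensor A B \<phi> ?K ?\<psi> x \<one>\<^bsub>?K\<^esub>) n (?\<psi> \<circ> a)"
    by (rule monogenic_base_change[OF M K.is_cring primeideal.residue_field(2)[OF p]])
  then have "monogenic_field ?K (ring_tensor A B \<phi> ?K ?\<psi>) (pure_tensor A B \<phi> ?K ?\<psi> \<one>\<^bsub>B\<^esub>)
      (pure_tensor A B \<phi> ?K ?\<psi> x \<one>\<^bsub>?K\<^esub>) n (?\<psi> \<circ> a)"
    by (intro monogenic_field.intro monogenic_field_axioms.intro K.field_axioms n)
  then show "local_complete_intersection ?K (pure_tensor A B \<phi> ?K ?\<psi> \<one>\<^bsub>B\<^esub>) (ring_tensor A B \<phi> ?K ?\<psi>)"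
    by (rule monogenic_field.local_complete_intersection)
qed

text \<open>Over the residue field of p the extended algebra is nonzero because 0 < n, so it has a
  prime \<open>Q\<close>. Pulled back to \<open>B\<close>, this prime lies over p: elements of p map
  to 0, and elements outside p become units.\<close>

lemma monogenic_faithfully_flat:
  fixes A :: "'r ring" and B :: "'s ring"
  assumes M: "monogenic A B \<phi> x n a" and n: "0 < n"
  shows "faithfully_flat A \<phi> B"
  unfolding faithfully_flat_def
proof (intro conjI allI impI)
  interpret M: monogenic A B \<phi> x n a by (rule M)
  show "flat A \<phi> B" by (rule monogenic_flat[OF M])
  fix p assume p: "primeideal p A"
  let ?K = "residue_field A p" and ?\<psi> = "residue_map A p"
  interpret p: primeideal p A by (rule p)
  interpret K: field ?K by (rule p.residue_field(1))
  have \<psi>: "?\<psi> \<in> ring_hom A ?K" by (rule p.residue_field(2))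
  obtain T :: "((nat \<Rightarrow> nat) \<Rightarrow> ('r set \<times> 'r set) set) set ring" and \<gamma> y \<beta>
    where T: "monogenic ?K T \<gamma> y n (?\<psi> \<circ> a)" "\<beta> \<in> ring_hom B T" "\<beta> x = y"
      "\<And>r. r \<in> carrier A \<Longrightarrow> \<beta> (\<phi> r) = \<gamma> (?\<psi> r)"
    using M.extend_scalars[OF K.is_cring \<psi>] by metis
  interpret T: monogenic_field ?K T \<gamma> y n "?\<psi> \<circ> a"
    by (intro monogenic_field.intro monogenic_field_axioms.intro K.field_axioms n T(1))
  obtain Q where Q: "primeideal Q T" using T.S.exists_primeideal[OF T.nontrivial] by blast
  interpret Q: primeideal Q T by (rule Q)
  interpret \<beta>: ring_hom_ring B T \<beta>
    by (intro ring_hom_ringI2 T(2) M.S.ring_axioms T.S.ring_axioms)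
  have "primeideal {b \<in> carrier B. \<beta> b \<in> Q} B" by (rule \<beta>.primeideal_vimage[OF M.S.is_cring Q])
  moreover have "p = {r \<in> carrier A. \<phi> r \<in> {b \<in> carrier B. \<beta> b \<in> Q}}"
  proof -
    have "r \<in> p \<longleftrightarrow> \<beta> (\<phi> r) \<in> Q" if r: "r \<in> carrier A" for r
    proof
      assume "r \<in> p"
      then have "?\<psi> r = \<zero>\<^bsub>?K\<^esub>" using p.residue_field(3)[OF r] by simp
      then show "\<beta> (\<phi> r) \<in> Q" using T(4)[OF r] by simp
    next
      assume rQ: "\<beta> (\<phi> r) \<in> Q"
      show "r \<in> p"
      proof (rule ccontr)
        assume "r \<notin> p"
        then have "?\<psi> r \<noteq> \<zero>\<^bsub>?K\<^esub>" using p.residue_field(3)[OF r] by simp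
        then have u: "?\<psi> r \<in> Units ?K" using ring_hom_closed[OF \<psi> r] by (simp add: K.field_Units)
        have "\<gamma> (inv\<^bsub>?K\<^esub> (?\<psi> r)) \<otimes>\<^bsub>T\<^esub> \<gamma> (?\<psi> r) = \<gamma> (inv\<^bsub>?K\<^esub> (?\<psi> r) \<otimes>\<^bsub>?K\<^esub> ?\<psi> r)"
          using T.h.hom_mult[OF K.Units_inv_closed[OF u] K.Units_closed[OF u]] by simp
        also have "\<dots> = \<one>\<^bsub>T\<^esub>" using u by (simp add: K.Units_l_inv)
        finally have "\<one>\<^bsub>T\<^esub> \<in> Q"
          using Q.I_l_closed[OF rQ, of "\<gamma> (inv\<^bsub>?K\<^esub> (?\<psi> r))"] T(4)[OF r] u by simp
        then show False using Q.one_imp_carrier Q.I_notcarr by blast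
      qed
    qed
    then show ?thesis using p.a_subset by auto
  qed
  ultimately show "\<exists>Q. primeideal Q B \<and> p = {a \<in> carrier A. \<phi> a \<in> Q}" by blast
qed

section \<open>Transport to a given infinite type\<close>

lemma infinite_pairing:
  assumes "infinite (UNIV :: 'u set)"
  obtains p :: "'u \<times> 'u \<Rightarrow> 'u" where "inj p"
proof -
  have "|(UNIV :: 'u set) \<times> (UNIV :: 'u set)| =o |UNIV :: 'u set|"
    by (rule card_of_Times_same_infinite[OF assms])
  then obtain p where "bij_betw p ((UNIV :: 'u set) \<times> (UNIV :: 'u set)) (UNIV :: 'u set)"
    using card_of_ordIso by blast
  then show thesis using that[of p] by (simp add: bij_betw_def)
qed

text \<open>An injection of pairs, iterated n times, encodes the first n entries of a sequence in a
  single element. Later entries are ignored, so for n = 0 any map will do.\<close>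

lemma infinite_tuples:
  assumes "infinite (UNIV :: 'u set)"
  shows "\<exists>g :: (nat \<Rightarrow> 'u) \<Rightarrow> 'u. \<forall>c b. g c = g b \<longrightarrow> (\<forall>i<n. c i = b i)"
proof (induction n)
  case (Suc n)
  then obtain g :: "(nat \<Rightarrow> 'u) \<Rightarrow> 'u" where g: "\<And>c b i. g c = g b \<Longrightarrow> i < n \<Longrightarrow> c i = b i" by metis
  obtain p :: "'u \<times> 'u \<Rightarrow> 'u" where p: "inj p" using infinite_pairing[OF assms] by blast
  have "c i = b i" if "p (g c, c n) = p (g b, b n)" "i < Suc n" for c b i
    using injD[OF p that(1)] g[of c b i] that(2) by (auto simp: less_Suc_eq)
  then show ?case by (intro exI[of _ "\<lambda>c. p (g c, c n)"]) blast
qed simp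

text \<open>The algebra is constructed in a larger type. Its elements are determined by n
  coefficients, so they can be encoded in the infinite type \<open>'u\<close>, and the ring
  structure is carried over to the image.\<close>

lemma monogenic_in_type:
  fixes A :: "'u ring"
  assumes inf: "infinite (UNIV :: 'u set)" and A: "cring A" and a: "a \<in> UNIV \<rightarrow> carrier A"
  obtains B :: "'u ring" and \<phi> x where "\<phi> \<in> mor A B" "monogenic A B \<phi> x n a"
proof -
  obtain T :: "((nat \<Rightarrow> nat) \<Rightarrow> 'u) set ring" and \<gamma> y where T: "monogenic A T \<gamma> y n a"
    using monogenic_exists[OF A a] by blast
  interpret T: monogenic A T \<gamma> y n a by (rule T)
  obtain g :: "(nat \<Rightarrow> 'u) \<Rightarrow> 'u" where g: "\<And>c b i. g c = g b \<Longrightarrow> i < n \<Longrightarrow> c i = b i"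
    using infinite_tuples[OF inf, of n] by metis
  define f where "f t = g (SOME c. t = T.val n c)" for t
  have "inj_on f (carrier T)"
  proof (rule inj_onI)
    have ex: "t = T.val n (SOME c. t = T.val n c)" if "t \<in> carrier T" for t
    proof -
      have "\<exists>c. t = T.val n c" using that T.spanning by (auto simp: T.below_def)
      then show ?thesis by (rule someI_ex)
    qed
    fix t s assume t: "t \<in> carrier T" and s: "s \<in> carrier T" and eq: "f t = f s"
    have "T.val n (SOME c. t = T.val n c) = T.val n (SOME c. s = T.val n c)"
      by (rule T.val_cong) (use g eq in \<open>simp add: f_def\<close>)
    then show "t = s" using ex[OF t] ex[OF s] by simp
  qed
  then have iso: "f \<in> ring_iso T (image_ring f T)" by (rule inj_imp_image_ring_iso)
  have "cring ((image_ring f T)\<lparr>ring.zero := f \<zero>\<^bsub>T\<^esub>\<rparr>)" by (rule T.S.ring_iso_imp_img_cring[OF iso])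
  then have B: "cring (image_ring f T)" by (simp add: image_ring_def image_group_def monoid.defs)
  \<comment> \<open>Morphisms are required to be extensional on the carrier, hence the
    restriction.\<close>
  let ?\<phi> = "restrict (f \<circ> \<gamma>) (carrier A)"
  have "monogenic A (image_ring f T) (f \<circ> \<gamma>) (f y) n a" by (rule monogenic_iso[OF T iso B])
  from monogenic_base_iso[OF this ring_iso_set_refl A, of ?\<phi>]
  have M: "monogenic A (image_ring f T) ?\<phi> (f y) n a" by simp
  then have "?\<phi> \<in> mor A (image_ring f T)"
    using pointed_algebra.\<phi>[OF monogenic.axioms(1)[OF M]] by (simp add: mor_def)
  then show thesis using M by (rule that)
qed

section \<open>Splitting off a root\<close>

context pointed_algebra
begin

lemma val_Suc_shift:
  assumes "c \<in> UNIV \<rightarrow> carrier R"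
  shows "val (Suc d) c = \<phi> (c 0) \<oplus> x \<otimes> val d (\<lambda>i. c (Suc i))"
proof (induction d)
  case 0
  have "c 0 \<in> carrier R" using assms by auto
  then show ?case by simp
next
  case (Suc d)
  have c: "c i \<in> carrier R" for i using assms by auto
  have v: "val d (\<lambda>i. c (Suc i)) \<in> carrier S" using c by (intro val_closed) auto
  have "val (Suc (Suc d)) c = \<phi> (c (Suc d)) \<otimes> x [^] Suc d \<oplus> (\<phi> (c 0) \<oplus> x \<otimes> val d (\<lambda>i. c (Suc i)))"
    unfolding pval.simps(2)[of _ _ _ "Suc d"] Suc ..
  also have "\<dots> = \<phi> (c 0) \<oplus> x \<otimes> val (Suc d) (\<lambda>i. c (Suc i))"
    using c v by (simp add: S.r_distr S.m_ac S.a_ac)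
  finally show ?case .
qed

text \<open>The coefficients of \<open>P / (1 - x T)\<close>.\<close>

primrec quotient_coeff :: "(nat \<Rightarrow> 'a) \<Rightarrow> nat \<Rightarrow> 'c" where
  "quotient_coeff P 0 = \<one>"
| "quotient_coeff P (Suc k) = \<phi> (P (Suc k)) \<oplus> x \<otimes> quotient_coeff P k"

text \<open>Horner's scheme: the k-th coefficient of P / (1 - x T) is x^k + P_1 x^(k-1) + ... + P_k.
  For k = n this is the left side of the equation satisfied by x.\<close>

lemma quotient_coeff_eq:
  assumes "P \<in> UNIV \<rightarrow> carrier R"
  shows "quotient_coeff P k = x [^] k \<oplus> val k (\<lambda>i. P (k - i))"
proof (induction k)
  case (Suc k)
  have P: "P i \<in> carrier R" for i using assms by auto
  have v: "val k (\<lambda>i. P (k - i)) \<in> carrier S" using P by (intro val_closed) auto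
  have "val (Suc k) (\<lambda>i. P (Suc k - i)) = \<phi> (P (Suc k)) \<oplus> x \<otimes> val k (\<lambda>i. P (k - i))"
    using val_Suc_shift[of "\<lambda>i. P (Suc k - i)" k] P by simp
  then show ?case using Suc P v by (simp add: S.r_distr S.m_ac S.a_ac del: pval.simps)
qed simp

end

text \<open>The coefficients of P / (1 - x T) obey Q_(k+1) = P_(k+1) + x Q_k. The equation of x says
  that Q_(d+1) = 0, and beyond this index \<open>P\<close> vanishes, so the recursion stays at 0.
  Thus the quotient is a polynomial, and the degree bound has dropped by one.\<close>

lemma split_root:
  fixes A B :: "'u ring"
  assumes M: "monogenic A B \<phi> x (Suc d) (\<lambda>i. P (Suc d - i))"
    and P: "P \<in> unit_polynomials A" "\<And>k. Suc d < k \<Longrightarrow> P k = \<zero>\<^bsub>A\<^esub>"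
  shows "\<exists>Q\<in>unit_polynomials B. (\<forall>k>d. Q k = \<zero>\<^bsub>B\<^esub>) \<and> \<phi> \<circ> P = series_mult B (teich B x) Q"
proof -
  interpret M: monogenic A B \<phi> x "Suc d" "\<lambda>i. P (Suc d - i)" by (rule M)
  have PA: "P \<in> UNIV \<rightarrow> carrier A" and P0: "P 0 = \<one>\<^bsub>A\<^esub>"
    using P(1) by (auto simp: unit_polynomials_def UP_def up_def)
  define Q where "Q = M.quotient_coeff P"
  have QB: "Q k \<in> carrier B" for k
    unfolding Q_def by (induction k) (use PA in auto)
  have Qd: "Q (Suc d) = \<zero>\<^bsub>B\<^esub>" unfolding Q_def M.quotient_coeff_eq[OF PA] by (rule M.root)
  have Q_zero: "Q (Suc d + j) = \<zero>\<^bsub>B\<^esub>" for j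
  proof (induction j)
    case (Suc j)
    have "Q (Suc d + Suc j) = \<phi> (P (Suc (Suc d + j))) \<oplus>\<^bsub>B\<^esub> x \<otimes>\<^bsub>B\<^esub> Q (Suc d + j)" by (simp add: Q_def)
    then show ?case using Suc P(2)[of "Suc (Suc d + j)"] by simp
  qed (use Qd in simp)
  then have Qz: "Q k = \<zero>\<^bsub>B\<^esub>" if "d < k" for k using that by (metis less_iff_Suc_add add_Suc)
  have "Q \<in> unit_polynomials B"
    using QB Qz by (auto simp: unit_polynomials_def UP_def up_def bound_def Q_def intro!: exI[of _ d])
  moreover have "(\<phi> \<circ> P) k = series_mult B (teich B x) Q k" for k
  proof (cases k)
    case 0
    then show ?thesis using P0 by (simp add: series_mult_def teich_def Q_def)
  next
    case (Suc k)
    have t: "teich B x i \<in> carrier B" for i by (auto simp: teich_def)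
    have "series_mult B (teich B x) Q (Suc k)
        = (\<Oplus>\<^bsub>B\<^esub>i\<in>{..k}. teich B x (Suc i) \<otimes>\<^bsub>B\<^esub> Q (k - i)) \<oplus>\<^bsub>B\<^esub> Q (Suc k)"
      unfolding series_mult_def
      using M.S.finsum_Suc2[of "\<lambda>i. teich B x i \<otimes>\<^bsub>B\<^esub> Q (Suc k - i)" k] t QB
      by (simp add: Pi_iff) (simp add: teich_def QB)
    \<comment> \<open>The constant term of 1 - x T has been split off; of the shifted coefficients
      only the one at i = 0, namely -x, survives.\<close>
    also have "(\<Oplus>\<^bsub>B\<^esub>i\<in>{..k}. teich B x (Suc i) \<otimes>\<^bsub>B\<^esub> Q (k - i))
        = (\<Oplus>\<^bsub>B\<^esub>i\<in>{..k}. if 0 = i then \<ominus>\<^bsub>B\<^esub> x \<otimes>\<^bsub>B\<^esub> Q (k - i) else \<zero>\<^bsub>B\<^esub>)"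
      using QB by (intro M.S.finsum_cong') (auto simp: teich_def)
    also have "\<dots> = \<ominus>\<^bsub>B\<^esub> x \<otimes>\<^bsub>B\<^esub> Q k"
      using M.S.finsum_singleton[of 0 "{..k}" "\<lambda>i. \<ominus>\<^bsub>B\<^esub> x \<otimes>\<^bsub>B\<^esub> Q (k - i)"] QB by (auto simp: Pi_iff)
    also have "\<ominus>\<^bsub>B\<^esub> x \<otimes>\<^bsub>B\<^esub> Q k \<oplus>\<^bsub>B\<^esub> Q (Suc k) = \<phi> (P (Suc k))"
    proof -
      have "P (Suc k) \<in> carrier A" using PA by auto
      then have p: "\<phi> (P (Suc k)) \<in> carrier B" by simp
      have xq: "x \<otimes>\<^bsub>B\<^esub> Q k \<in> carrier B" using QB by simp
      have "Q (Suc k) = \<phi> (P (Suc k)) \<oplus>\<^bsub>B\<^esub> x \<otimes>\<^bsub>B\<^esub> Q k" by (simp add: Q_def)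
      then have "Q (Suc k) = x \<otimes>\<^bsub>B\<^esub> Q k \<oplus>\<^bsub>B\<^esub> \<phi> (P (Suc k))" using p xq by (simp add: M.S.a_comm)
      then show ?thesis using p xq QB by (simp add: M.S.l_minus M.S.r_neg1)
    qed
    finally show ?thesis using Suc by simp
  qed
  ultimately show ?thesis using Qz by (intro bexI[of _ Q]) (auto simp: fun_eq_iff)
qed

section \<open>Local surjectivity of \<open>\<omega>\<close>\<close>

lemma presheaf_on_reduced_monoid:
  assumes "\<And>A. A \<in> C \<Longrightarrow> cring A" shows "presheaf_on C reduced_monoid_presheaf"
  unfolding presheaf_on_def
proof (intro conjI ballI funcsetI)
  fix A B \<phi> s assume A: "A \<in> C" and B: "B \<in> C" "\<phi> \<in> mor A B" and s: "s \<in> sections reduced_monoid_presheaf A"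
  note cA = assms[OF A] and cB = assms[OF B(1)]
  obtain f where f: "f \<in> carrier (monoid_ring A)" "s = reduced_class A f"
    using s unfolding reduced_monoid_sections[OF cA] by blast
  note g = monoid_ring_map_closed[OF f(1) B(2)]
  show "restr reduced_monoid_presheaf A B \<phi> s \<in> sections reduced_monoid_presheaf B"
    unfolding f(2) restr_reduced_class[OF cA cB B(2) f(1)] reduced_monoid_sections[OF cB]
    using g by (rule imageI)
  fix D \<chi> assume D: "D \<in> C" "\<chi> \<in> mor B D"
  note cD = assms[OF D(1)]
  have "compose (carrier A) \<chi> \<phi> \<in> mor A D"
    using mor_compose[OF cring.axioms(1)[OF cA] B(2) D(2)] .
  then show "restr reduced_monoid_presheaf A D (compose (carrier A) \<chi> \<phi>) s
      = restr reduced_monoid_presheaf B D \<chi> (restr reduced_monoid_presheaf A B \<phi> s)"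
    unfolding f(2) restr_reduced_class[OF cA cB B(2) f(1)] restr_reduced_class[OF cB cD D(2) g]
    using restr_reduced_class[OF cA cD _ f(1)] monoid_ring_map_compose[OF f(1) B(2) D(2)] by simp
qed

lemma rational_witt_fun:
  assumes "cring A" "f \<in> carrier (rational_witt_group A)"
  shows "f \<in> UNIV \<rightarrow> carrier A"
  using subsetD[OF subgroup.subset[OF rational_witt_subgroup[OF assms(1)]] assms(2)]
  by (auto simp: witt_group_def witt_carrier_def)

lemma compose_comp:
  assumes "f \<in> UNIV \<rightarrow> S" shows "compose S \<chi> \<phi> \<circ> f = \<chi> \<circ> (\<phi> \<circ> f)"
  using assms by (auto simp: compose_def fun_eq_iff Pi_iff)

lemma presheaf_on_rational_witt:
  assumes "\<And>A. A \<in> C \<Longrightarrow> cring A" shows "presheaf_on C rational_witt_presheaf"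
  unfolding presheaf_on_def
proof (intro conjI ballI funcsetI)
  fix A B \<phi> s assume A: "A \<in> C" and B: "B \<in> C" "\<phi> \<in> mor A B" and s: "s \<in> sections rational_witt_presheaf A"
  have "\<phi> \<in> ring_hom A B" using B(2) by (simp add: mor_def)
  from rational_witt_hom[OF assms[OF A] assms[OF B(1)] this]
  show "restr rational_witt_presheaf A B \<phi> s \<in> sections rational_witt_presheaf B"
    using s unfolding restr_rational_witt sections_rational_witt by (auto simp: hom_def)
  fix D \<chi>
  show "restr rational_witt_presheaf A D (compose (carrier A) \<chi> \<phi>) s
      = restr rational_witt_presheaf B D \<chi> (restr rational_witt_presheaf A B \<phi> s)"
    using compose_comp[OF rational_witt_fun[OF assms[OF A]]] s
    unfolding restr_rational_witt sections_rational_witt by blast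
qed

lemma presheaf_morphism_omega:
  assumes "\<And>A. A \<in> C \<Longrightarrow> cring A"
  shows "presheaf_morphism C reduced_monoid_presheaf rational_witt_presheaf omega"
  unfolding presheaf_morphism_def
proof (intro conjI ballI funcsetI)
  fix A s assume A: "A \<in> C" and s: "s \<in> sections reduced_monoid_presheaf A"
  note cA = assms[OF A]
  obtain f where f: "f \<in> carrier (monoid_ring A)" "s = reduced_class A f"
    using s unfolding reduced_monoid_sections[OF cA] by blast
  have "omega_lift A f \<in> teich_products A" unfolding teich_products_def using f(1) by (rule imageI)
  then show "omega A s \<in> sections rational_witt_presheaf A"
    unfolding f(2) omega_reduced_class[OF cA f(1)] sections_rational_witt
    by (rule subsetD[OF teich_products_rational[OF cA]])
  fix B \<phi> assume B: "B \<in> C" "\<phi> \<in> mor A B"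
  show "omega B (restr reduced_monoid_presheaf A B \<phi> s) = restr rational_witt_presheaf A B \<phi> (omega A s)"
    unfolding f(2) restr_reduced_class[OF cA assms[OF B(1)] B(2) f(1)] restr_rational_witt
      omega_reduced_class[OF cA f(1)] omega_reduced_class[OF assms[OF B(1)] monoid_ring_map_closed[OF f(1) B(2)]]
    by (rule omega_lift_natural[OF cA assms[OF B(1)] B(2) f(1), symmetric])
qed

text \<open>What the splitting argument asks of the topology: adjoining a root stays inside
  \<open>C\<close>, and does so along a covering arrow.\<close>

locale syntomic_site = site C Cov for C :: "'u ring set" and Cov +
  assumes infinite: "infinite (UNIV :: 'u set)"
    and monogenic_object: "A \<in> C \<Longrightarrow> monogenic A B \<phi> x n a \<Longrightarrow> B \<in> C"
    and monogenic_cover: "A \<in> C \<Longrightarrow> B \<in> C \<Longrightarrow> \<phi> \<in> mor A B \<Longrightarrow> monogenic A B \<phi> x n a \<Longrightarrow> 0 < n \<Longrightarrow>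
      {(B, \<phi>)} \<in> Cov A"
begin

lemma singleton_cover_compose:
  assumes "A \<in> C" "{(B, \<phi>)} \<in> Cov A" "{(D, \<chi>)} \<in> Cov B"
  shows "{(D, compose (carrier A) \<chi> \<phi>)} \<in> Cov A"
proof -
  have "{(D', compose (carrier A) \<chi>' \<phi>') | B' \<phi>' D' \<chi>'. (B', \<phi>') \<in> {(B, \<phi>)} \<and> (D', \<chi>') \<in> {(D, \<chi>)}} \<in> Cov A"
    by (rule cover_compose[OF assms(1,2), of "\<lambda>_. {(D, \<chi>)}"]) (use assms(3) in simp)
  moreover have "{(D', compose (carrier A) \<chi>' \<phi>') | B' \<phi>' D' \<chi>'. (B', \<phi>') \<in> {(B, \<phi>)} \<and> (D', \<chi>') \<in> {(D, \<chi>)}}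
      = {(D, compose (carrier A) \<chi> \<phi>)}" by auto
  ultimately show ?thesis by simp
qed

lemma singleton_cover_arrow:
  assumes "A \<in> C" "{(B, \<phi>)} \<in> Cov A" shows "B \<in> C" "\<phi> \<in> mor A B" "(B, \<phi>) \<in> arrows C A"
  using cover_arrows[OF assms] by (auto simp: arrows_def)

text \<open>Induction on the degree bound, with ring and polynomial varying: one root is split off
  over \<open>B\<close>, and the quotient is split over a cover \<open>D\<close> of
  \<open>B\<close>. The first factor stays of the form [x] after base change, so the product splits
  over \<open>D\<close>.\<close>

lemma split_polynomial:
  "A \<in> C \<Longrightarrow> P \<in> unit_polynomials A \<Longrightarrow> (\<And>k. d < k \<Longrightarrow> P k = \<zero>\<^bsub>A\<^esub>) \<Longrightarrow>
     \<exists>B \<phi>. {(B, \<phi>)} \<in> Cov A \<and> \<phi> \<circ> P \<in> teich_products B"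
proof (induction d arbitrary: A P)
  case 0
  note cA = objects_cring[OF 0(1)]
  interpret A: cring A by (rule cA)
  have P0: "P 0 = \<one>\<^bsub>A\<^esub>" using 0(2) by (simp add: unit_polynomials_def)
  \<comment> \<open>With bound 0 the polynomial is 1, which is [0].\<close>
  have "((\<lambda>x\<in>carrier A. x) \<circ> P) k = teich A \<zero>\<^bsub>A\<^esub> k" for k
    using 0(3)[of k] P0 by (cases "k = 0") (auto simp: teich_def)
  then have "(\<lambda>x\<in>carrier A. x) \<circ> P = teich A \<zero>\<^bsub>A\<^esub>" by (rule ext)
  then have "(\<lambda>x\<in>carrier A. x) \<circ> P \<in> teich_products A"
    using teich_in_teich_products[OF cA A.zero_closed] by simp
  then show ?case using id_cover[OF 0(1)] by blast
next
  case (Suc d)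
  note cA = objects_cring[OF Suc.prems(1)]
  have PA: "P \<in> UNIV \<rightarrow> carrier A" using Suc.prems(2) by (auto simp: unit_polynomials_def UP_def up_def)
  have "(\<lambda>i. P (Suc d - i)) \<in> UNIV \<rightarrow> carrier A" using PA by auto
  from monogenic_in_type[OF infinite cA this]
  obtain B :: "'u ring" and \<phi> x where \<phi>: "\<phi> \<in> mor A B"
    and M: "monogenic A B \<phi> x (Suc d) (\<lambda>i. P (Suc d - i))" by blast
  interpret M: monogenic A B \<phi> x "Suc d" "\<lambda>i. P (Suc d - i)" by (rule M)
  have B: "B \<in> C" by (rule monogenic_object[OF Suc.prems(1) M])
  have cov: "{(B, \<phi>)} \<in> Cov A" by (rule monogenic_cover[OF Suc.prems(1) B \<phi> M]) simp
  obtain Q where Q: "Q \<in> unit_polynomials B" "\<And>k. d < k \<Longrightarrow> Q k = \<zero>\<^bsub>B\<^esub>"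
    "\<phi> \<circ> P = series_mult B (teich B x) Q" using split_root[OF M Suc.prems(2,3)] by blast
  obtain D \<chi> where D: "{(D, \<chi>)} \<in> Cov B" "\<chi> \<circ> Q \<in> teich_products D"
    using Suc.IH[OF B Q(1,2)] by blast
  note DC = singleton_cover_arrow[OF B D(1)]
  note cB = objects_cring[OF B] and cD = objects_cring[OF DC(1)]
  have \<chi>: "\<chi> \<in> ring_hom B D" using DC(2) by (simp add: mor_def)
  have QB: "Q \<in> UNIV \<rightarrow> carrier B" using Q(1) by (auto simp: unit_polynomials_def UP_def up_def)
  have tB: "teich B x \<in> UNIV \<rightarrow> carrier B" by (auto simp: teich_def)
  have "compose (carrier A) \<chi> \<phi> \<circ> P = \<chi> \<circ> series_mult B (teich B x) Q"
    unfolding compose_comp[OF PA] Q(3) ..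
  also have "\<dots> = series_mult D (teich D (\<chi> x)) (\<chi> \<circ> Q)"
    unfolding series_mult_hom[OF cB cD \<chi> tB QB] teich_hom[OF cB cD \<chi> M.x] ..
  also have "\<dots> = teich D (\<chi> x) \<otimes>\<^bsub>rational_witt_group D\<^esub> (\<chi> \<circ> Q)" by (simp add: rational_witt_mult[OF cD])
  also have "\<dots> \<in> teich_products D"
    by (rule teich_products_closed(1)[OF cD teich_in_teich_products[OF cD ring_hom_closed[OF \<chi> M.x]] D(2)])
  finally show ?case using singleton_cover_compose[OF Suc.prems(1) cov D(1)] by blast
qed

text \<open>Numerator and denominator are split in succession. The splitting of \<open>P\<close>
  over \<open>B\<close> survives the passage to \<open>D\<close>, and the image of \<omega> is
  closed under products and inverses, so it contains the image of P/Q.\<close>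

lemma omega_locally_surjective:
  "sheaf_surjection C Cov reduced_monoid_presheaf rational_witt_presheaf omega"
  unfolding sheaf_surjection_def
proof (intro ballI)
  fix A f assume A: "A \<in> C" and f: "f \<in> sections rational_witt_presheaf A"
  note cA = objects_cring[OF A]
  have f': "f \<in> carrier (rational_witt_group A)" using f by (simp add: sections_rational_witt)
  obtain P Q where PQ: "P \<in> unit_polynomials A" "Q \<in> unit_polynomials A"
    "f = P \<otimes>\<^bsub>rational_witt_group A\<^esub> inv\<^bsub>rational_witt_group A\<^esub> Q"
    using rational_witt_quotient[OF cA f'] by metis
  have bounded: "\<exists>d. \<forall>k>d. P k = \<zero>\<^bsub>A\<^esub>" if "P \<in> unit_polynomials A" for A :: "'u ring" and P
    using that by (auto simp: unit_polynomials_def UP_def up_def bound_def)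
  obtain B \<phi> where B: "{(B, \<phi>)} \<in> Cov A" "\<phi> \<circ> P \<in> teich_products B"
    using split_polynomial[OF A PQ(1)] bounded[OF PQ(1)] by blast
  note BC = singleton_cover_arrow[OF A B(1)]
  note cB = objects_cring[OF BC(1)]
  have \<phi>: "\<phi> \<in> ring_hom A B" using BC(2) by (simp add: mor_def)
  \<comment> \<open>It is the image of \<open>Q\<close> over \<open>B\<close>, not \<open>Q\<close>
    itself, that is split next, so that both splittings live over one and the same ring.\<close>
  have Q': "\<phi> \<circ> Q \<in> unit_polynomials B" by (rule unit_polynomials_hom[OF cA cB \<phi> PQ(2)])
  obtain D \<chi> where D: "{(D, \<chi>)} \<in> Cov B" "\<chi> \<circ> (\<phi> \<circ> Q) \<in> teich_products D"
    using split_polynomial[OF BC(1) Q'] bounded[OF Q'] by blast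
  note DC = singleton_cover_arrow[OF BC(1) D(1)]
  note cD = objects_cring[OF DC(1)]
  let ?\<kappa> = "compose (carrier A) \<chi> \<phi>"
  have cov: "{(D, ?\<kappa>)} \<in> Cov A" by (rule singleton_cover_compose[OF A B(1) D(1)])
  have \<kappa>: "?\<kappa> \<in> ring_hom A D" using singleton_cover_arrow(2)[OF A cov] by (simp add: mor_def)
  interpret RA: comm_group "rational_witt_group A" by (rule rational_witt_group[OF cA])
  interpret RD: comm_group "rational_witt_group D" by (rule rational_witt_group[OF cD])
  interpret h: group_hom "rational_witt_group A" "rational_witt_group D" "\<lambda>f. ?\<kappa> \<circ> f"
    using rational_witt_hom[OF cA cD \<kappa>]
    by (simp add: group_hom_def group_hom_axioms_def RA.is_group RD.is_group)
  note PR = subsetD[OF unit_polynomial_rational[OF cA] PQ(1)]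
    and QR = subsetD[OF unit_polynomial_rational[OF cA] PQ(2)]
  have \<kappa>P: "?\<kappa> \<circ> P \<in> teich_products D"
    unfolding compose_comp[OF rational_witt_fun[OF cA PR]]
    by (rule teich_products_hom[OF cB cD DC(2) B(2)])
  have \<kappa>Q: "?\<kappa> \<circ> Q \<in> teich_products D"
    unfolding compose_comp[OF rational_witt_fun[OF cA QR]] by (rule D(2))
  have "?\<kappa> \<circ> f = (?\<kappa> \<circ> P) \<otimes>\<^bsub>rational_witt_group D\<^esub> inv\<^bsub>rational_witt_group D\<^esub> (?\<kappa> \<circ> Q)"
    unfolding PQ(3) h.hom_mult[OF PR RA.inv_closed[OF QR]] h.hom_inv[OF QR] ..
  also have "\<dots> \<in> teich_products D"
    by (rule teich_products_closed(1)[OF cD \<kappa>P teich_products_closed(2)[OF cD \<kappa>P \<kappa>Q]])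
  finally obtain g where g: "g \<in> carrier (monoid_ring D)" "?\<kappa> \<circ> f = omega_lift D g"
    by (auto simp: teich_products_def)
  have "omega D (reduced_class D g) = restr rational_witt_presheaf A D ?\<kappa> f"
    unfolding omega_reduced_class[OF cD g(1)] restr_rational_witt using g(2) by simp
  moreover have "reduced_class D g \<in> sections reduced_monoid_presheaf D"
    unfolding reduced_monoid_sections[OF cD] using g(1) by (rule imageI)
  ultimately show "\<exists>K\<in>Cov A. \<forall>(B, \<phi>)\<in>K. \<exists>s\<in>sections reduced_monoid_presheaf B.
      omega B s = restr rational_witt_presheaf A B \<phi> f"
    by (intro bexI[OF _ cov]) auto
qed

end

text \<open>The assumed coverings are applied to the algebras that adjoin one root. Such an algebra
  remains in the category: it is a commutative ring, and it is Noetherian over a Noetherian base by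
  the argument with leading coefficients.\<close>

theorem proposition4p3:
  fixes C :: "'u ring set" and Cov :: "'u ring \<Rightarrow> 'u arrow set set"
  assumes "infinite (UNIV :: 'u set)"
    and "C = affine_schemes \<or> C = noetherian_affine_schemes"
    and "pretopology C Cov"
    and "\<And>A B \<phi>. A \<in> C \<Longrightarrow> B \<in> C \<Longrightarrow> \<phi> \<in> mor A B \<Longrightarrow> syntomic A \<phi> B \<Longrightarrow>
           finite_locally_free A \<phi> B \<Longrightarrow> faithfully_flat A \<phi> B \<Longrightarrow> {(B, \<phi>)} \<in> Cov A"
  shows "sheaf_surjection C Cov
           (sheafification C Cov reduced_monoid_presheaf)
           (sheafification C Cov rational_witt_presheaf)
           (sheafification_map C Cov rational_witt_presheaf omega)"
proof -
  have cr: "cring A" if "A \<in> C" for A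
    using assms(2) that by (auto simp: affine_schemes_def noetherian_affine_schemes_def)
  have object: "B \<in> C" if "A \<in> C" and M: "monogenic A B \<phi> x n a" for A B :: "'u ring" and \<phi> x n a
  proof -
    interpret monogenic A B \<phi> x n a by (rule M)
    show ?thesis using assms(2) that(1) noetherian S.is_cring
      by (auto simp: affine_schemes_def noetherian_affine_schemes_def)
  qed
  interpret syntomic_site C Cov
  proof (intro syntomic_site.intro site.intro syntomic_site_axioms.intro assms(1,3))
    show "cring A" if "A \<in> C" for A by (rule cr[OF that])
    show "B \<in> C" if "A \<in> C" "monogenic A B \<phi> x n a" for A B :: "'u ring" and \<phi> x n a
      by (rule object[OF that])
    show "{(B, \<phi>)} \<in> Cov A" if "A \<in> C" "B \<in> C" "\<phi> \<in> mor A B"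
      and M: "monogenic A B \<phi> x n a" "0 < n" for A B :: "'u ring" and \<phi> x n a
      using that(1-3) by (intro assms(4) monogenic_syntomic[OF M] monogenic_finite_locally_free[OF M(1)]
          monogenic_faithfully_flat[OF M])
  qed
  show ?thesis
    by (intro sheaf_surjection_sheafification presheaf_on_reduced_monoid presheaf_on_rational_witt
        presheaf_morphism_omega omega_locally_surjective objects_cring)
qed

end
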